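(* Let $j\in\{1,\dots,d\}$ and $\varphi\in\mathbf{Val}_j$. Let $X$ be a random vector in $\mathbb{R}^d$ with $\mathbb{E}\|X\|^2<\infty$, and let $X_1,X_2,\dots$ be independent, identically distributed copies of $X$. Suppose that the support of the distribution $\mathbb{P}_X$ of $X$ contains the origin and is not contained in a $(j-1)$-dimensional linear subspace. Suppose further that $\varphi(K)\neq 0$ for all convex bodies $K\in\mathcal{K}^d$ with $\dim K\ge j$. For $n\in\mathbb{N}$ let $$Z_n:=\frac1n\left(\overline{X}_1+\dots+\overline{X}_n\right).$$ Then, as $n\to\infty$, $$\sqrt{n}\left(\varphi(Z_n)-\varphi(\mathsf{Z}_X)\right)\stackrel{d}{\to}\mathcal{N}\!\left(0,\left(\frac{j}{j!}\right)^{2}\zeta_1\right),$$ where $$\zeta_1:=\mathbb{E}\left[(h_1(X_1)-\theta)^2\right],\qquad \theta:=\mathbb{E}\,\varphi(\overline{X}_1+\dots+\overline{X}_j),$$ and $h_1(x):=\mathbb{E}\,\varphi(\overline{x}+\overline{X}_2+\dots+\overline{X}_j)$ for $x\in\mathbb{R}^d$.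
   Context: $\mathbb{R}^d$ is Euclidean space with scalar product $\langle\cdot,\cdot\rangle$ and norm $\|\cdot\|$. $\mathcal{K}^d$ is the space of convex bodies (nonempty compact convex subsets) of $\mathbb{R}^d$ with the Hausdorff metric. Sums of sets are Minkowski sums. A function $\varphi:\mathcal{K}^d\to\mathbb{R}$ is a valuation if $\varphi(K\cup L)+\varphi(K\cap L)=\varphi(K)+\varphi(L)$ whenever $K,L,K\cup L\in\mathcal{K}^d$. $\mathbf{Val}$ is the real vector space of translation invariant, continuous (with respect to the Hausdorff metric) real valuations on $\mathcal{K}^d$, and $\mathbf{Val}_j$ is the subspace of those that are homogeneous of degree $j$, i.e. $\varphi(\lambda K)=\lambda^j\varphi(K)$ for all $\lambda> 0$ and $K\in\mathcal{K}^d$. For $x\in\mathbb{R}^d$, $\overline{x}$ denotes the closed segment with endpoints $x$ and the origin $o$. The support function of $K\in\mathcal{K}^d$ is $h(K,u):=\max\{\langle x,u\rangle:x\in K\}$, $u\in\mathbb{R}^d$. For a random vector $X$ in $\mathbb{R}^d$ with $\mathbb{E}\|X\|<\infty$, $\mathsf{Z}_X$ denotes the selection expectation $\mathbb{E}\,\overline{X}$ of the random segment $\overline{X}$; it is the convex body determined by $$h(\mathsf{Z}_X,u)=\mathbb{E}\,h(\overline{X},u)\quad\text{for all }u\in\mathbb{R}^d.$$ $\stackrel{d}{\to}$ denotes convergence in distribution, and $\mathcal{N}(0,\sigma^2)$ is the normal distribution with mean $0$ and variance $\sigma^2$. For $j=1$, $h_1(x)=\varphi(\overline{x})$. *)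

theory Defs
  imports "HOL-Probability.Probability" "HOL-Library.Set_Algebras"
begin

definition convex_bodies :: "'a::euclidean_space set set" where
  "convex_bodies = {K. K \<noteq> {} \<and> compact K \<and> convex K}"

(* The suprema are finite, and the distance is a metric, on nonempty compact sets only. *)
definition hausdorff_dist :: "'a::metric_space set \<Rightarrow> 'a set \<Rightarrow> real" where
  "hausdorff_dist K L = max (SUP x\<in>K. infdist x L) (SUP y\<in>L. infdist y K)"

(* A functional on convex bodies is a function on all sets; only its values on
   convex bodies are ever constrained or used. *)

(* If K, L and K \<union> L are convex bodies then K \<inter> L is nonempty, as K \<union> L is connected, so
   no value at the empty set enters. *)
definition valuation :: "('a::euclidean_space set \<Rightarrow> real) \<Rightarrow> bool" where
  "valuation \<phi> \<longleftrightarrow>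
     (\<forall>K\<in>convex_bodies. \<forall>L\<in>convex_bodies. K \<union> L \<in> convex_bodies \<longrightarrow>
        \<phi> (K \<union> L) + \<phi> (K \<inter> L) = \<phi> K + \<phi> L)"

definition translation_invariant :: "('a::euclidean_space set \<Rightarrow> real) \<Rightarrow> bool" where
  "translation_invariant \<phi> \<longleftrightarrow> (\<forall>K\<in>convex_bodies. \<forall>t. \<phi> ((+) t ` K) = \<phi> K)"

definition hausdorff_continuous :: "('a::euclidean_space set \<Rightarrow> real) \<Rightarrow> bool" where
  "hausdorff_continuous \<phi> \<longleftrightarrow>
     (\<forall>K\<in>convex_bodies. \<forall>\<epsilon>>0. \<exists>\<delta>>0. \<forall>L\<in>convex_bodies.
        hausdorff_dist L K < \<delta> \<longrightarrow> \<bar>\<phi> L - \<phi> K\<bar> < \<epsilon>)"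

definition homogeneous :: "nat \<Rightarrow> ('a::euclidean_space set \<Rightarrow> real) \<Rightarrow> bool" where
  "homogeneous j \<phi> \<longleftrightarrow> (\<forall>K\<in>convex_bodies. \<forall>r>0. \<phi> ((*\<^sub>R) r ` K) = r ^ j * \<phi> K)"

definition Val :: "('a::euclidean_space set \<Rightarrow> real) set" where
  "Val = {\<phi>. valuation \<phi> \<and> translation_invariant \<phi> \<and> hausdorff_continuous \<phi>}"

definition Val_deg :: "nat \<Rightarrow> ('a::euclidean_space set \<Rightarrow> real) set" where
  "Val_deg j = {\<phi> \<in> Val. homogeneous j \<phi>}"

(* The supremum is attained when K is a convex body. *)
definition support_function :: "'a::euclidean_space set \<Rightarrow> 'a \<Rightarrow> real" where
  "support_function K u = (SUP x\<in>K. x \<bullet> u)"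

(* The selection expectation of the random segment from the origin to X; meaningful
   for integrable X, when such a convex body exists and is unique. *)
definition selection_expectation_segment ::
    "'w measure \<Rightarrow> ('w \<Rightarrow> 'a::euclidean_space) \<Rightarrow> 'a set" where
  "selection_expectation_segment M X =
     (THE K. K \<in> convex_bodies \<and>
        (\<forall>u. support_function K u =
              (\<integral>\<omega>. support_function (closed_segment 0 (X \<omega>)) u \<partial>M)))"

definition measure_support :: "'a::topological_space measure \<Rightarrow> 'a set" where
  "measure_support \<mu> = {x. \<forall>U. open U \<longrightarrow> x \<in> U \<longrightarrow> emeasure \<mu> U > 0}"

(* Parametrised by mean and variance; variance 0 gives the point mass, whereas
   the library's density function takes the standard deviation and is 0 there. *)
definition normal_distribution :: "real \<Rightarrow> real \<Rightarrow> real measure" where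
  "normal_distribution m v =
     (if v = 0 then return borel m else density lborel (normal_density m (sqrt v)))"

end

theory Submission
  imports Defs "HOL-Computational_Algebra.Polynomial" "HOL-Real_Asymp.Real_Asymp"
begin

text \<open>By translation invariance and continuity, \<open>\<phi>(K + r s)\<close> is affine in \<open>r \<ge> 0\<close> for every segment
  \<open>s\<close>, so \<open>\<phi>\<close> of a sum of segments \<open>r s\<^sub>i\<close> is a polynomial in \<open>r\<close>. Homogeneity of degree \<open>j\<close>
  leaves only the terms indexed by \<open>j\<close>-element sets:
  \<open>\<phi>\<close> of a sum of \<open>n\<close> segments is the sum of \<open>\<phi>\<close> over all \<open>j\<close>-element subfamilies. Hence \<open>\<phi>(Z\<^sub>n)\<close>
  is, up to normalisation, a U-statistic, whose kernel is bounded by a multiple of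
  \<open>\<parallel>x\<^sub>1\<parallel> \<cdots> \<parallel>x\<^sub>j\<parallel>\<close> and so has a second moment. Hoeffding's projection reduces it to an i.i.d. sum
  with an error of vanishing \<open>L\<^sup>1\<close> norm. The centring constant is \<open>\<phi>(Z\<^sub>X) = \<theta> / j!\<close>, because \<open>Z\<^sub>n\<close>
  converges to \<open>Z\<^sub>X\<close> in the Hausdorff metric in probability.\<close>

subsection \<open>Minkowski sums and the Hausdorff distance\<close>

text \<open>Affinity in \<open>r\<close> is Cauchy's functional equation: cutting the prism over
  \<open>K\<close> with axis \<open>(a + b) v\<close> at height \<open>a\<close> makes the increment
  of \<phi> additive, and continuity makes it linear. Homogeneity only controls a common factor of
  all segments; applied to every subfamily, it identifies each coefficient of the polynomial. Since
  fewer than \<open>j\<close> segments give 0, \<phi> is linear in the length of each of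
  \<open>j\<close> segments. With continuity at \<open>{0}\<close> this yields the product bound, so
  by independence a second moment of a single \<open>X\<close> suffices although the kernel has
  degree \<open>j\<close>. The centring is delicate twice. It is the fixed number
  \<open>\<theta> / j!\<close>, not the mean \<open>(n choose j) / n^j * \<theta>\<close> of
  \<open>\<phi> (Z n)\<close>, so their gap must vanish even after multiplication by
  \<open>sqrt n\<close>. And \<phi> is in general unbounded, so Hausdorff convergence does not by
  itself carry over to expectations; instead a single outcome is found at which \<open>Z n\<close>
  is near its limit and \<open>\<phi> (Z n)\<close> is near \<open>\<theta> / j!\<close>. The factor
  \<open>j / j!\<close> arises because an index lies in a share \<open>j / n\<close> of the
  \<open>j\<close>-subsets, whose number is about \<open>n^j / j!\<close>.\<close>

definition segment_sum :: "('i \<Rightarrow> 'a::euclidean_space) \<Rightarrow> 'i set \<Rightarrow> 'a set" where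
  "segment_sum x I = (\<Sum>i\<in>I. closed_segment 0 (x i))"

lemma convex_bodies_plus: "K \<in> convex_bodies \<Longrightarrow> L \<in> convex_bodies \<Longrightarrow> K + L \<in> convex_bodies"
proof -
  have "K + L = (\<Union>x\<in>K. \<Union>y\<in>L. {x + y})" by (auto simp: set_plus_def)
  then show "K \<in> convex_bodies \<Longrightarrow> L \<in> convex_bodies \<Longrightarrow> K + L \<in> convex_bodies"
    using compact_sums'[of K L] convex_set_plus[of K L] by (auto simp: convex_bodies_def)
qed

lemma convex_bodies_segment: "closed_segment a b \<in> convex_bodies"
  by (auto simp: convex_bodies_def)

lemma convex_bodies_zero: "{0} \<in> convex_bodies"
  by (auto simp: convex_bodies_def)

lemma convex_bodies_segment_sum: "segment_sum x I \<in> convex_bodies"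
  unfolding segment_sum_def
  by (induction I rule: infinite_finite_induct)
     (auto simp: convex_bodies_zero convex_bodies_plus convex_bodies_segment)

lemma convex_bodies_scaleR: "K \<in> convex_bodies \<Longrightarrow> (*\<^sub>R) r ` K \<in> convex_bodies"
  by (auto simp: convex_bodies_def compact_scaling convex_scaling)

lemma segment_sum_empty: "segment_sum x {} = {0}"
  by (simp add: segment_sum_def)

lemma segment_sum_insert:
  "finite I \<Longrightarrow> i \<notin> I \<Longrightarrow> segment_sum x (insert i I) = closed_segment 0 (x i) + segment_sum x I"
  by (simp add: segment_sum_def)

lemma segment_sum_remove:
  "finite I \<Longrightarrow> i \<in> I \<Longrightarrow> segment_sum x I = closed_segment 0 (x i) + segment_sum x (I - {i})"
  by (simp add: segment_sum_def sum.remove)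

lemma segment_sum_cong: "(\<And>i. i \<in> I \<Longrightarrow> x i = y i) \<Longrightarrow> segment_sum x I = segment_sum y I"
  by (simp add: segment_sum_def)

lemma segment_sum_reindex:
  "inj_on t I \<Longrightarrow> segment_sum x (t ` I) = segment_sum (\<lambda>i. x (t i)) I"
  by (simp add: segment_sum_def sum.reindex o_def)

lemma scaleR_set_plus: "(*\<^sub>R) r ` (K + L) = (*\<^sub>R) r ` K + (*\<^sub>R) r ` (L::'a::real_vector set)"
  by (force simp: set_plus_def image_iff scaleR_add_right)

lemma scaleR_segment: "(*\<^sub>R) r ` closed_segment 0 x = closed_segment 0 (r *\<^sub>R x)"
  using closed_segment_linear_image[of "(*\<^sub>R) r" 0 x] by (simp add: linear_scale_self)

lemma scaleR_segment_sum: "(*\<^sub>R) r ` segment_sum x I = segment_sum (\<lambda>i. r *\<^sub>R x i) I"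
proof (induction I rule: infinite_finite_induct)
  case (insert i I)
  then show ?case by (simp add: segment_sum_insert scaleR_set_plus scaleR_segment)
qed (auto simp: segment_sum_def set_zero)

section \<open>Hausdorff closeness, continuity and measurability\<close>

text \<open>A bound on the Hausdorff distance without suprema: the errors add under Minkowski sums,
  and neither nonemptiness nor boundedness has to be carried along. Conversion to
  \<open>hausdorff_dist\<close> happens once, where continuity of a valuation is invoked.\<close>

definition hausdorff_within :: "real \<Rightarrow> 'a::metric_space set \<Rightarrow> 'a set \<Rightarrow> bool" where
  "hausdorff_within e K L \<longleftrightarrow>
     (\<forall>x\<in>K. \<exists>y\<in>L. dist x y \<le> e) \<and> (\<forall>y\<in>L. \<exists>x\<in>K. dist x y \<le> e)"

lemma hausdorff_within_mono: "hausdorff_within d K L \<Longrightarrow> d \<le> e \<Longrightarrow> hausdorff_within e K L"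
  unfolding hausdorff_within_def by (meson order_trans)

lemma hausdorff_within_imp_dist_le:
  assumes "hausdorff_within e K L" "K \<noteq> {}" "L \<noteq> {}"
  shows "hausdorff_dist K L \<le> e"
proof -
  have "infdist x L \<le> e" if "x \<in> K" for x
    using assms(1) that by (meson hausdorff_within_def infdist_le order_trans)
  moreover have "infdist y K \<le> e" if "y \<in> L" for y
    using assms(1) that by (metis hausdorff_within_def infdist_le order_trans dist_commute)
  ultimately show ?thesis
    unfolding hausdorff_dist_def using assms(2,3) by (auto intro!: cSUP_least)
qed

lemma hausdorff_within_refl: "hausdorff_within 0 K K"
  unfolding hausdorff_within_def by (metis dist_self order_refl)

lemma hausdorff_within_plus:
  fixes K :: "'a::real_normed_vector set"
  assumes "hausdorff_within d K L" "hausdorff_within e K' L'"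
  shows "hausdorff_within (d + e) (K + K') (L + L')"
  unfolding hausdorff_within_def
proof (intro conjI ballI)
  fix x assume "x \<in> K + K'"
  then obtain a b where *: "x = a + b" "a \<in> K" "b \<in> K'" by (auto elim: set_plus_elim)
  obtain a' b' where "a' \<in> L" "b' \<in> L'" "dist a a' \<le> d" "dist b b' \<le> e"
    using assms * unfolding hausdorff_within_def by meson
  then show "\<exists>y\<in>L + L'. dist x y \<le> d + e"
    using dist_triangle_add[of a b a' b'] * by (intro bexI[of _ "a' + b'"]) auto
next
  fix y assume "y \<in> L + L'"
  then obtain a b where *: "y = a + b" "a \<in> L" "b \<in> L'" by (auto elim: set_plus_elim)
  obtain a' b' where "a' \<in> K" "b' \<in> K'" "dist a' a \<le> d" "dist b' b \<le> e"
    using assms * unfolding hausdorff_within_def by meson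
  then show "\<exists>x\<in>K + K'. dist x y \<le> d + e"
    using dist_triangle_add[of a' b' a b] * by (intro bexI[of _ "a' + b'"]) auto
qed

text \<open>Points with the same parameter \<open>u\<close> are matched; their distance is
  \<open>u * dist x y\<close>.\<close>

lemma hausdorff_within_segment:
  fixes x y :: "'a::euclidean_space"
  shows "hausdorff_within (dist x y) (closed_segment 0 x) (closed_segment 0 y)"
proof -
  have *: "\<exists>q\<in>closed_segment 0 y. dist p q \<le> dist x y" if "p \<in> closed_segment 0 x" for p x y :: 'a
  proof -
    obtain u where u: "0 \<le> u" "u \<le> 1" "p = u *\<^sub>R x"
      using \<open>p \<in> _\<close> by (auto simp: closed_segment_def)
    have "dist p (u *\<^sub>R y) = u * dist x y"
      using u by (simp add: dist_norm flip: scaleR_diff_right)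
    also have "\<dots> \<le> 1 * dist x y" using u by (intro mult_right_mono) auto
    finally show ?thesis using u by (intro bexI[of _ "u *\<^sub>R y"]) (auto simp: closed_segment_def)
  qed
  show ?thesis
    unfolding hausdorff_within_def using *[of _ x y] *[of _ y x] by (auto simp: dist_commute)
qed

lemma hausdorff_within_segment_sum:
  "hausdorff_within (\<Sum>i\<in>I. dist (x i) (y i)) (segment_sum x I) (segment_sum y I)"
proof (induction I rule: infinite_finite_induct)
  case (insert i I)
  then show ?case
    by (simp add: segment_sum_insert hausdorff_within_plus hausdorff_within_segment)
qed (auto simp: segment_sum_def hausdorff_within_refl)

lemma Val_continuous:
  assumes "\<phi> \<in> Val" "K \<in> convex_bodies" "0 < e"
  obtains d where "0 < d"
    "\<And>L. L \<in> convex_bodies \<Longrightarrow> hausdorff_within d L K \<Longrightarrow> \<bar>\<phi> L - \<phi> K\<bar> < e"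
proof -
  obtain d where d: "0 < d" "\<And>L. L \<in> convex_bodies \<Longrightarrow> hausdorff_dist L K < d \<Longrightarrow> \<bar>\<phi> L - \<phi> K\<bar> < e"
    using assms unfolding Val_def hausdorff_continuous_def by blast
  show thesis
  \<comment> \<open>Halving turns the non-strict bound of \<open>hausdorff_within\<close> into the
    strict one asked for by \<open>hausdorff_continuous\<close>.\<close>
  proof (rule that[of "d/2"])
    fix L assume L: "L \<in> convex_bodies" "hausdorff_within (d/2) L K"
    have "hausdorff_dist L K \<le> d/2"
      using L assms(2) by (intro hausdorff_within_imp_dist_le) (auto simp: convex_bodies_def)
    with d L show "\<bar>\<phi> L - \<phi> K\<bar> < e" by auto
  qed (use d in auto)
qed

text \<open>The distance of two sums of segments is at most the sum of the distances of their
  endpoints, which is continuous in the product topology. This is the source of all measurability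
  statements about \<phi> of random sums.\<close>

lemma continuous_Val_segment_sum:
  fixes \<phi> :: "'a::euclidean_space set \<Rightarrow> real"
  assumes "\<phi> \<in> Val"
  shows "continuous_on UNIV (\<lambda>x::'i \<Rightarrow> 'a. \<phi> (segment_sum x I))"
  unfolding continuous_on_def
proof (intro ballI tendstoI)
  fix x :: "'i \<Rightarrow> 'a" and e :: real assume "0 < e"
  then obtain d where d: "0 < d"
    "\<And>L. L \<in> convex_bodies \<Longrightarrow> hausdorff_within d L (segment_sum x I) \<Longrightarrow> \<bar>\<phi> L - \<phi> (segment_sum x I)\<bar> < e"
    using Val_continuous[OF assms convex_bodies_segment_sum] by metis
  have "((\<lambda>y. \<Sum>i\<in>I. dist (y i) (x i)) \<longlongrightarrow> (\<Sum>i\<in>I. dist (x i) (x i))) (at x within UNIV)"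
  proof (intro tendsto_sum tendsto_dist tendsto_const)
    fix i show "((\<lambda>y. y i) \<longlongrightarrow> x i) (at x within UNIV)"
      using continuous_on_product_coordinates[where i = i, unfolded continuous_on_def] by auto
  qed
  then have "\<forall>\<^sub>F y in at x within UNIV. (\<Sum>i\<in>I. dist (y i) (x i)) < d"
    using d by (intro order_tendstoD(2)) auto
  then show "\<forall>\<^sub>F y in at x within UNIV. dist (\<phi> (segment_sum y I)) (\<phi> (segment_sum x I)) < e"
  proof eventually_elim
    case (elim y)
    then show ?case
      using d(2)[OF convex_bodies_segment_sum hausdorff_within_mono[OF hausdorff_within_segment_sum]]
      by (auto simp: dist_real_def)
  qed
qed

text \<open>Over the countable index type \<open>nat\<close> the Borel sets of the product topology
  are those of the product sigma-algebra, so continuity suffices.\<close>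

lemma measurable_Val_segment_sum:
  fixes \<phi> :: "'a::euclidean_space set \<Rightarrow> real"
  assumes "\<phi> \<in> Val"
  shows "(\<lambda>x::nat \<Rightarrow> 'a. \<phi> (segment_sum x I)) \<in> borel_measurable (PiM UNIV (\<lambda>_. borel))"
  using borel_measurable_continuous_onI[OF continuous_Val_segment_sum[OF assms, of I]]
    sets_PiM_equal_borel measurable_cong_sets by blast

subsection \<open>Homogeneous valuations of zonotopes\<close>

text \<open>The prism over \<open>K\<close> of height \<open>a + b\<close> is cut at height
  \<open>a\<close>: the lower part \<open>A\<close> has height \<open>a\<close>, the upper part
  \<open>B\<close> is a translate of the prism of height \<open>b\<close>, and they meet in the
  translate of \<open>K\<close> by \<open>a v\<close>. The valuation property and translation
  invariance give the identity.\<close>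

lemma Val_additive_segment:
  fixes \<phi> :: "'a::euclidean_space set \<Rightarrow> real"
  assumes \<phi>: "\<phi> \<in> Val" and K: "K \<in> convex_bodies" and ab: "0 \<le> a" "0 \<le> b"
  shows "\<phi> (K + closed_segment 0 ((a + b) *\<^sub>R v)) + \<phi> K =
    \<phi> (K + closed_segment 0 (a *\<^sub>R v)) + \<phi> (K + closed_segment 0 (b *\<^sub>R v))"
proof -
  have seg: "closed_segment 0 (c *\<^sub>R v) = (\<lambda>t. t *\<^sub>R v) ` {0..c}" if "0 \<le> c" for c
  proof -
    have "closed_segment 0 (c *\<^sub>R v) = (\<lambda>t. t *\<^sub>R v) ` closed_segment 0 c"
      using closed_segment_linear_image[of "\<lambda>t. t *\<^sub>R v" 0 c]
      by (simp add: linear_iff scaleR_add_left)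
    then show ?thesis using that by (simp add: closed_segment_eq_real_ivl)
  qed
  define A where "A = K + closed_segment 0 (a *\<^sub>R v)"
  define B where "B = (+) (a *\<^sub>R v) ` (K + closed_segment 0 (b *\<^sub>R v))"
  have A: "x \<in> A \<longleftrightarrow> (\<exists>k\<in>K. \<exists>t\<in>{0..a}. x = k + t *\<^sub>R v)" for x
    using ab by (auto simp: A_def seg set_plus_def)
  have B: "x \<in> B \<longleftrightarrow> (\<exists>k\<in>K. \<exists>t\<in>{a..a+b}. x = k + t *\<^sub>R v)" for x
  proof
    assume "x \<in> B"
    then obtain k t where "k \<in> K" "t \<in> {0..b}" "x = a *\<^sub>R v + (k + t *\<^sub>R v)"
      using ab by (auto simp: B_def seg set_plus_def)
    then show "\<exists>k\<in>K. \<exists>t\<in>{a..a+b}. x = k + t *\<^sub>R v"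
      by (intro bexI[of _ k] bexI[of _ "a + t"]) (auto simp: algebra_simps)
  next
    assume "\<exists>k\<in>K. \<exists>t\<in>{a..a+b}. x = k + t *\<^sub>R v"
    then obtain k t where kt: "k \<in> K" "t \<in> {a..a+b}" "x = k + t *\<^sub>R v" by auto
    then have "x = a *\<^sub>R v + (k + (t - a) *\<^sub>R v)" by (simp add: algebra_simps)
    moreover have "k + (t - a) *\<^sub>R v \<in> K + closed_segment 0 (b *\<^sub>R v)"
      using kt ab by (intro set_plus_intro) (auto simp: seg)
    ultimately show "x \<in> B" unfolding B_def by blast
  qed
  have "K + closed_segment 0 ((a + b) *\<^sub>R v) = A \<union> B"
  proof (intro set_eqI)
    fix x
    have "x \<in> K + closed_segment 0 ((a + b) *\<^sub>R v) \<longleftrightarrow> (\<exists>k\<in>K. \<exists>t\<in>{0..a+b}. x = k + t *\<^sub>R v)"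
      using ab by (auto simp: seg set_plus_def)
    moreover have "{0..a+b} = {0..a} \<union> {a..a+b}" using ab by auto
    ultimately show "x \<in> K + closed_segment 0 ((a + b) *\<^sub>R v) \<longleftrightarrow> x \<in> A \<union> B"
      by (auto simp only: A B Un_iff)
  qed
  moreover have "A \<inter> B = (+) (a *\<^sub>R v) ` K"
  proof (intro set_eqI iffI)
    fix x assume "x \<in> A \<inter> B"
    then obtain k s l t where *: "k \<in> K" "0 \<le> s" "s \<le> a" "x = k + s *\<^sub>R v"
      "l \<in> K" "a \<le> t" "t \<le> a + b" "x = l + t *\<^sub>R v" by (auto simp: A B)
    have "x - a *\<^sub>R v \<in> K"
    proof (cases "s = t")
      case True then show ?thesis using * by auto
    next
      case False
      \<comment> \<open>With \<open>s \<le> a \<le> t\<close> this is the weight for which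
        \<open>(1 - r) s + r t = a\<close>. Hence \<open>x - a v\<close> lies between the points
        \<open>k = x - s v\<close> and \<open>l = x - t v\<close> of \<open>K\<close>, and convexity
        applies.\<close>
      define r where "r = (a - s) / (t - s)"
      have "0 \<le> r" "r \<le> 1" "r * (t - s) = a - s"
        using * False by (auto simp: r_def divide_le_eq)
      then have r: "0 \<le> r" "r \<le> 1" "(1 - r) * s + r * t = a"
        by (auto simp: algebra_simps)
      have "(1 - r) *\<^sub>R k + r *\<^sub>R l \<in> K"
        using K * r by (intro convexD) (auto simp: convex_bodies_def)
      moreover have k: "k = x - s *\<^sub>R v" and l: "l = x - t *\<^sub>R v"
        using * by (auto simp: algebra_simps)
      have "(1 - r) *\<^sub>R k + r *\<^sub>R l = x - ((1 - r) * s + r * t) *\<^sub>R v"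
        unfolding k l by (simp add: algebra_simps)
      ultimately show ?thesis using r by simp
    qed
    then show "x \<in> (+) (a *\<^sub>R v) ` K" by (intro image_eqI[of _ _ "x - a *\<^sub>R v"]) auto
  next
    fix x assume "x \<in> (+) (a *\<^sub>R v) ` K"
    then show "x \<in> A \<inter> B"
      using ab by (auto simp: A B add.commute intro!: bexI[of _ a])
  qed
  moreover have "A \<in> convex_bodies"
    by (simp add: A_def K convex_bodies_plus convex_bodies_segment)
  moreover have Kb: "K + closed_segment 0 (b *\<^sub>R v) \<in> convex_bodies"
    by (simp add: K convex_bodies_plus convex_bodies_segment)
  then have "B \<in> convex_bodies"
    by (auto simp: convex_bodies_def B_def compact_translation)
  moreover have "K + closed_segment 0 ((a + b) *\<^sub>R v) \<in> convex_bodies"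
    by (simp add: K convex_bodies_plus convex_bodies_segment)
  ultimately have "\<phi> (K + closed_segment 0 ((a + b) *\<^sub>R v)) + \<phi> ((+) (a *\<^sub>R v) ` K) = \<phi> A + \<phi> B"
    using \<phi> unfolding Val_def valuation_def by (metis (mono_tags, lifting) mem_Collect_eq)
  moreover have "\<phi> ((+) (a *\<^sub>R v) ` K) = \<phi> K" "\<phi> B = \<phi> (K + closed_segment 0 (b *\<^sub>R v))"
    using \<phi> K Kb unfolding Val_def translation_invariant_def B_def by auto
  ultimately show ?thesis by (simp add: A_def)
qed

text \<open>The only consequence of membership in \<open>Val\<close> that the polynomial expansion
  uses, isolated because the induction there passes to difference functionals. The slope is read off
  at \<open>r = 1\<close>.\<close>

definition segment_affine :: "('a::euclidean_space set \<Rightarrow> real) \<Rightarrow> bool" where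
  "segment_affine \<psi> \<longleftrightarrow> (\<forall>K\<in>convex_bodies. \<forall>v. \<forall>r\<ge>0.
     \<psi> (K + closed_segment 0 (r *\<^sub>R v)) = \<psi> K + r * (\<psi> (K + closed_segment 0 v) - \<psi> K))"

text \<open>The increment \<open>g\<close> is additive on the nonnegative reals by the cutting
  identity, so it is linear on rational multiples; Hausdorff continuity extends this to all
  \<open>r \<ge> 0\<close>.\<close>

lemma Val_segment_affine:
  fixes \<phi> :: "'a::euclidean_space set \<Rightarrow> real"
  assumes \<phi>: "\<phi> \<in> Val"
  shows "segment_affine \<phi>"
  unfolding segment_affine_def
proof (intro ballI allI impI)
  fix K :: "'a set" and v :: 'a and r :: real
  assume K: "K \<in> convex_bodies" and r: "0 \<le> r"
  define g where "g a = \<phi> (K + closed_segment 0 (a *\<^sub>R v)) - \<phi> K" for a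
  have g_add: "g (a + b) = g a + g b" if "0 \<le> a" "0 \<le> b" for a b
    using Val_additive_segment[OF \<phi> K that, of v] by (simp add: g_def)
  have g_nat: "g (real n * a) = real n * g a" if "0 \<le> a" for n a
  proof (induction n)
    case 0
    show ?case using g_add[of 0 0] by simp
  next
    case (Suc n)
    have "real (Suc n) * a = real n * a + a" by (simp add: algebra_simps)
    then show ?case using g_add[of "real n * a" a] that Suc by (simp add: algebra_simps)
  qed
  \<comment> \<open>A nonnegative rational within \<open>1 / (n + 1)\<close> of \<open>r\<close>;
    \<open>Suc n\<close> keeps the denominator nonzero.\<close>
  define q where "q n = real (nat \<lfloor>real (Suc n) * r\<rfloor>) / real (Suc n)" for n
  have g_q: "g (q n) = q n * g 1" for n
  proof -
    have "real (Suc n) * g (q n) = g (real (nat \<lfloor>real (Suc n) * r\<rfloor>) * 1)"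
      using g_nat[of "q n" "Suc n"] by (simp add: q_def)
    also have "\<dots> = real (nat \<lfloor>real (Suc n) * r\<rfloor>) * g 1"
      by (rule g_nat) simp
    finally show ?thesis by (simp add: q_def field_simps)
  qed
  have "\<bar>q n - r\<bar> \<le> 1 / real (Suc n)" for n
  proof -
    have "q n - r = (real (nat \<lfloor>real (Suc n) * r\<rfloor>) - real (Suc n) * r) / real (Suc n)"
      by (simp add: q_def field_simps)
    moreover have "\<bar>real (nat \<lfloor>real (Suc n) * r\<rfloor>) - real (Suc n) * r\<bar> \<le> 1"
    proof -
      have "0 \<le> real (Suc n) * r" using r by simp
      then show ?thesis by linarith
    qed
    ultimately show ?thesis by (simp add: divide_simps abs_divide)
  qed
  then have q: "q \<longlonglongrightarrow> r"
    using LIMSEQ_inverse_real_of_nat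
    by (subst LIM_zero_iff[symmetric], intro Lim_null_comparison[of "\<lambda>n. q n - r" "\<lambda>n. inverse (real (Suc n))"])
      (auto simp: divide_inverse)
  have "(\<lambda>n. g (q n)) \<longlonglongrightarrow> g r"
  proof (rule tendstoI)
    fix e :: real assume "0 < e"
    have Kr: "K + closed_segment 0 (r *\<^sub>R v) \<in> convex_bodies" for r
      by (simp add: K convex_bodies_plus convex_bodies_segment)
    obtain d where d: "0 < d"
      "\<And>L. L \<in> convex_bodies \<Longrightarrow> hausdorff_within d L (K + closed_segment 0 (r *\<^sub>R v)) \<Longrightarrow>
         \<bar>\<phi> L - \<phi> (K + closed_segment 0 (r *\<^sub>R v))\<bar> < e"
      using Val_continuous[OF \<phi> Kr \<open>0 < e\<close>] by metis
    have "(\<lambda>n. dist (q n *\<^sub>R v) (r *\<^sub>R v)) \<longlonglongrightarrow> dist (r *\<^sub>R v) (r *\<^sub>R v)"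
      by (intro tendsto_intros q)
    then have "\<forall>\<^sub>F n in sequentially. dist (q n *\<^sub>R v) (r *\<^sub>R v) < d"
      using d by (intro order_tendstoD(2)) auto
    then show "\<forall>\<^sub>F n in sequentially. dist (g (q n)) (g r) < e"
    proof eventually_elim
      case (elim n)
      have "hausdorff_within (0 + dist (q n *\<^sub>R v) (r *\<^sub>R v))
              (K + closed_segment 0 (q n *\<^sub>R v)) (K + closed_segment 0 (r *\<^sub>R v))"
        by (intro hausdorff_within_plus hausdorff_within_refl hausdorff_within_segment)
      then show ?case
        using d(2)[OF Kr hausdorff_within_mono] elim by (auto simp: dist_real_def g_def)
    qed
  qed
  moreover have "(\<lambda>n. g (q n)) \<longlonglongrightarrow> r * g 1"
    unfolding g_q by (intro tendsto_intros q)
  ultimately have "g r = r * g 1" by (rule LIMSEQ_unique)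
  then show "\<phi> (K + closed_segment 0 (r *\<^sub>R v)) = \<phi> K + r * (\<phi> (K + closed_segment 0 v) - \<phi> K)"
    by (simp add: g_def)
qed

text \<open>\<open>closed_segment 0 s + K\<close> is again a convex body, so both terms are affine
  in \<open>r\<close>, and so is their difference. This keeps the induction over segments
  going.\<close>

lemma segment_affine_difference:
  fixes \<psi> :: "'a::euclidean_space set \<Rightarrow> real"
  assumes "segment_affine \<psi>"
  shows "segment_affine (\<lambda>K. \<psi> (closed_segment 0 s + K) - \<psi> K)"
proof -
  have 1: "\<psi> (K + closed_segment 0 (r *\<^sub>R v)) = \<psi> K + r * (\<psi> (K + closed_segment 0 v) - \<psi> K)"
    if "K \<in> convex_bodies" "0 \<le> r" for K r v
    using assms that unfolding segment_affine_def by blast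
  have 2: "\<psi> (closed_segment 0 s + (K + closed_segment 0 (r *\<^sub>R v))) = \<psi> (closed_segment 0 s + K) +
      r * (\<psi> (closed_segment 0 s + (K + closed_segment 0 v)) - \<psi> (closed_segment 0 s + K))"
    if "K \<in> convex_bodies" "0 \<le> r" for K r v
    using 1[of "closed_segment 0 s + K" r v] that
    by (simp add: convex_bodies_plus convex_bodies_segment add.assoc)
  show ?thesis
    unfolding segment_affine_def
  proof (intro ballI allI impI)
    fix K v and r :: real assume K: "K \<in> (convex_bodies :: 'a set set)" "0 \<le> r"
    show "\<psi> (closed_segment 0 s + (K + closed_segment 0 (r *\<^sub>R v))) - \<psi> (K + closed_segment 0 (r *\<^sub>R v)) =
      \<psi> (closed_segment 0 s + K) - \<psi> K + r * (\<psi> (closed_segment 0 s + (K + closed_segment 0 v)) -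
         \<psi> (K + closed_segment 0 v) - (\<psi> (closed_segment 0 s + K) - \<psi> K))"
      unfolding 1[OF K] 2[OF K] by (simp add: algebra_simps)
  qed
qed

section \<open>Polynomial expansion and multilinearity in the segments\<close>

text \<open>Adding the segment of \<open>a\<close> with factor \<open>r\<close> adds
  \<open>r\<close> times the difference functional, which is itself covered by the induction
  hypothesis. One family \<open>c\<close> serves all subsets \<open>B\<close> of \<open>N\<close>
  simultaneously; this uniformity is what later allows the single coefficients to be
  recovered.\<close>

lemma segment_affine_expansion:
  fixes x :: "'i \<Rightarrow> 'a::euclidean_space"
  assumes "finite N" "segment_affine \<psi>"
  shows "\<exists>c. \<forall>B\<subseteq>N. \<forall>r\<ge>0. \<psi> (segment_sum (\<lambda>i. r *\<^sub>R x i) B) = (\<Sum>I\<in>Pow B. r ^ card I * c I)"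
  using assms
proof (induction N arbitrary: \<psi> rule: finite_induct)
  case empty
  show ?case by (intro exI[of _ "\<lambda>_. \<psi> {0}"]) (auto simp: segment_sum_empty)
next
  case (insert a N)
  let ?D = "\<lambda>K. \<psi> (closed_segment 0 (x a) + K) - \<psi> K"
  obtain c where c: "\<psi> (segment_sum (\<lambda>i. r *\<^sub>R x i) B) = (\<Sum>I\<in>Pow B. r ^ card I * c I)"
    if "B \<subseteq> N" "0 \<le> r" for B r
    using insert.IH[OF insert.prems] by blast
  obtain c' where c': "?D (segment_sum (\<lambda>i. r *\<^sub>R x i) B) = (\<Sum>I\<in>Pow B. r ^ card I * c' I)"
    if "B \<subseteq> N" "0 \<le> r" for B r
    using insert.IH[OF segment_affine_difference[OF insert.prems, of "x a"]] by blast
  \<comment> \<open>Sets avoiding \<open>a\<close> keep the coefficient of \<open>\<psi>\<close>;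
    those containing \<open>a\<close> take the one of the difference functional, the extra factor
    \<open>r\<close> accounting for the element \<open>a\<close>.\<close>
  define e where "e I = (if a \<in> I then c' (I - {a}) else c I)" for I
  have "\<psi> (segment_sum (\<lambda>i. r *\<^sub>R x i) B) = (\<Sum>I\<in>Pow B. r ^ card I * e I)"
    if B: "B \<subseteq> insert a N" and r: "0 \<le> r" for B r
  proof (cases "a \<in> B")
    case False
    then have "B \<subseteq> N" using B by auto
    then show ?thesis using False c[of B r] r by (auto simp: e_def intro!: sum.cong)
  next
    case True
    define B' where "B' = B - {a}"
    have B': "B = insert a B'" "a \<notin> B'" "B' \<subseteq> N" "finite B'"
      using B True insert.hyps by (auto simp: B'_def intro: finite_subset)
    let ?S = "segment_sum (\<lambda>i. r *\<^sub>R x i) B'"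
    have "\<psi> (segment_sum (\<lambda>i. r *\<^sub>R x i) B) = \<psi> (?S + closed_segment 0 (r *\<^sub>R x a))"
      using B' by (simp add: segment_sum_insert add.commute)
    also have "\<dots> = \<psi> ?S + r * ?D ?S"
      using insert.prems[unfolded segment_affine_def, rule_format, OF convex_bodies_segment_sum r]
      by (simp only: add.commute[of "closed_segment 0 (x a)"])
    also have "\<dots> = (\<Sum>I\<in>Pow B'. r ^ card I * e I) + (\<Sum>I\<in>Pow B'. r ^ card (insert a I) * e (insert a I))"
    proof -
      have "\<psi> ?S = (\<Sum>I\<in>Pow B'. r ^ card I * e I)"
        unfolding c[OF \<open>B' \<subseteq> N\<close> r] using B' by (intro sum.cong) (auto simp: e_def)
      moreover have "r * ?D ?S = (\<Sum>I\<in>Pow B'. r ^ card (insert a I) * e (insert a I))"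
        unfolding c'[OF \<open>B' \<subseteq> N\<close> r] sum_distrib_left
      proof (intro sum.cong refl)
        fix I assume "I \<in> Pow B'"
        then have "finite I" "a \<notin> I" using B' by (auto intro: finite_subset)
        then show "r * (r ^ card I * c' I) = r ^ card (insert a I) * e (insert a I)"
          by (simp add: e_def)
      qed
      ultimately show ?thesis by simp
    qed
    also have "\<dots> = (\<Sum>I\<in>Pow B' \<union> insert a ` Pow B'. r ^ card I * e I)"
    proof (subst sum.union_disjoint)
      have "inj_on (insert a) (Pow B')" using B' by (auto simp: inj_on_def)
      then show "(\<Sum>I\<in>Pow B'. r ^ card I * e I) + (\<Sum>I\<in>Pow B'. r ^ card (insert a I) * e (insert a I)) =
        (\<Sum>I\<in>Pow B'. r ^ card I * e I) + (\<Sum>I\<in>insert a ` Pow B'. r ^ card I * e I)"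
        by (simp add: sum.reindex)
    qed (use B' in auto)
    also have "\<dots> = (\<Sum>I\<in>Pow B. r ^ card I * e I)"
      using B' by (simp add: Pow_insert)
    finally show ?thesis .
  qed
  then show ?case by blast
qed

text \<open>On each subset \<open>B\<close> the expansion agrees with
  \<open>r ^ j * \<phi> (segment_sum x B)\<close> for all \<open>r > 0\<close>, hence as a
  polynomial. For \<open>B = I\<close> with \<open>card I = j\<close> the only
  \<open>j\<close>-subset is \<open>I\<close> itself, which determines \<open>c I\<close>; for
  \<open>B = N\<close> the coefficient of degree \<open>j\<close> is the claim.\<close>

lemma Val_deg_segment_sum:
  fixes x :: "'i \<Rightarrow> 'a::euclidean_space"
  assumes \<phi>: "\<phi> \<in> Val_deg j" and "finite N"
  shows "\<phi> (segment_sum x N) = (\<Sum>I | I \<subseteq> N \<and> card I = j. \<phi> (segment_sum x I))"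
proof -
  have "segment_affine \<phi>" using \<phi> by (auto simp: Val_deg_def Val_segment_affine)
  then obtain c where c: "\<And>B r. B \<subseteq> N \<Longrightarrow> 0 \<le> r \<Longrightarrow>
      \<phi> (segment_sum (\<lambda>i. r *\<^sub>R x i) B) = (\<Sum>I\<in>Pow B. r ^ card I * c I)"
    using segment_affine_expansion[OF \<open>finite N\<close>, of \<phi> x] by blast
  \<comment> \<open>compare coefficients in \<open>r\<close> of the expansion and of \<open>r ^ j\<close>\<close>
  have coeffs: "(\<Sum>I | I \<subseteq> B \<and> card I = k. c I) = (if k = j then \<phi> (segment_sum x B) else 0)"
    if B: "B \<subseteq> N" for B k
  proof -
    have fB: "finite B" using B \<open>finite N\<close> finite_subset by blast
    define p where "p = (\<Sum>I\<in>Pow B. monom (c I) (card I)) - monom (\<phi> (segment_sum x B)) j"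
    have "poly p r = 0" if "r > 0" for r
    proof -
      have "r ^ j * \<phi> (segment_sum x B) = \<phi> (segment_sum (\<lambda>i. r *\<^sub>R x i) B)"
        using \<phi> that by (simp add: Val_deg_def homogeneous_def convex_bodies_segment_sum
            flip: scaleR_segment_sum)
      also have "\<dots> = (\<Sum>I\<in>Pow B. r ^ card I * c I)" using that by (intro c B) auto
      finally show ?thesis by (simp add: p_def poly_sum poly_monom mult.commute)
    qed
    then have "{0<..} \<subseteq> {r. poly p r = 0}" by auto
    then have "infinite {r. poly p r = 0}"
      using infinite_Ioi[of "0::real"] finite_subset by blast
    then have "p = 0" using poly_roots_finite by blast
    then have "0 = coeff p k" by simp
    also have "\<dots> = (\<Sum>I\<in>Pow B. if card I = k then c I else 0) - (if k = j then \<phi> (segment_sum x B) else 0)"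
      by (auto simp: p_def coeff_sum coeff_monom)
    also have "(\<Sum>I\<in>Pow B. if card I = k then c I else 0) = (\<Sum>I | I \<subseteq> B \<and> card I = k. c I)"
      using fB by (simp add: sum.If_cases Int_def)
    finally show ?thesis by simp
  qed
  have c_eq: "c I = \<phi> (segment_sum x I)" if "I \<subseteq> N" "card I = j" for I
  proof -
    have "finite I" using that \<open>finite N\<close> finite_subset by blast
    then have "{J. J \<subseteq> I \<and> card J = j} = {I}" using that by (auto dest: card_subset_eq)
    then show ?thesis using coeffs[of I j] that by simp
  qed
  have "\<phi> (segment_sum x N) = (\<Sum>I | I \<subseteq> N \<and> card I = j. c I)"
    using coeffs[of N j] by simp
  also have "\<dots> = (\<Sum>I | I \<subseteq> N \<and> card I = j. \<phi> (segment_sum x I))"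
    by (intro sum.cong) (auto simp: c_eq)
  finally show ?thesis .
qed

text \<open>The expansion runs over \<open>j\<close>-element subsets of \<open>I\<close>, and there
  are none.\<close>

lemma Val_deg_segment_sum_eq_0:
  assumes "\<phi> \<in> Val_deg j" "finite I" "card I < j"
  shows "\<phi> (segment_sum x I) = 0"
proof -
  have no: "\<not> (J \<subseteq> I \<and> card J = j)" for J
    using assms card_mono[of I J] by auto
  show ?thesis
    unfolding Val_deg_segment_sum[OF assms(1,2)] by (simp only: no) simp
qed

text \<open>In the length of one segment \<phi> is affine, and its constant term is \<phi> of the
  other \<open>j - 1\<close> segments, which is 0; so it is linear. The set \<open>A\<close> of
  already rescaled indices is there for the induction.\<close>

lemma Val_deg_segment_sum_scale:
  fixes x :: "'i \<Rightarrow> 'a::euclidean_space"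
  assumes \<phi>: "\<phi> \<in> Val_deg j" and I: "finite I" "card I = j"
    and A: "A \<subseteq> I" and r: "\<And>i. i \<in> A \<Longrightarrow> 0 \<le> r i"
  shows "\<phi> (segment_sum (\<lambda>i. if i \<in> A then r i *\<^sub>R x i else x i) I) = (\<Prod>i\<in>A. r i) * \<phi> (segment_sum x I)"
proof -
  have "finite A" using A I finite_subset by blast
  then show ?thesis using A r
  proof (induction A rule: finite_induct)
    case (insert a A)
    let ?y = "\<lambda>i. if i \<in> A then r i *\<^sub>R x i else x i"
    let ?z = "\<lambda>i. if i \<in> insert a A then r i *\<^sub>R x i else x i"
    let ?K = "segment_sum ?y (I - {a})"
    have "?K = segment_sum ?z (I - {a})"
      by (intro segment_sum_cong) auto
    then have z: "segment_sum ?z I = ?K + closed_segment 0 (r a *\<^sub>R x a)"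
      using insert I segment_sum_remove[of I a ?z] by (simp add: add.commute)
    have y: "segment_sum ?y I = ?K + closed_segment 0 (x a)"
      using insert I segment_sum_remove[of I a ?y] by (simp add: add.commute)
    have a: "a \<in> I" using insert by auto
    then have "card (I - {a}) < j" using I by (metis card_Diff1_less)
    then have K0: "\<phi> ?K = 0"
      using I \<phi> by (intro Val_deg_segment_sum_eq_0) auto
    have "segment_affine \<phi>" using \<phi> by (auto simp: Val_deg_def Val_segment_affine)
    then have "\<phi> (segment_sum ?z I) = \<phi> ?K + r a * (\<phi> (segment_sum ?y I) - \<phi> ?K)"
      unfolding z y segment_affine_def using insert.prems by (simp add: convex_bodies_segment_sum)
    also have "\<dots> = r a * ((\<Prod>i\<in>A. r i) * \<phi> (segment_sum x I))"
      using insert by (simp add: K0)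
    finally show ?case using insert.hyps by simp
  qed simp
qed

text \<open>Continuity at \<open>{0}\<close> bounds \<phi> on sums of short segments, and linearity
  in each length transfers the bound to arbitrary ones.\<close>

lemma Val_deg_segment_sum_bound:
  fixes \<phi> :: "'a::euclidean_space set \<Rightarrow> real"
  assumes \<phi>: "\<phi> \<in> Val_deg j"
  obtains C where "0 \<le> C"
    "\<And>(x::'i \<Rightarrow> 'a) I. finite I \<Longrightarrow> card I = j \<Longrightarrow> \<bar>\<phi> (segment_sum x I)\<bar> \<le> C * (\<Prod>i\<in>I. norm (x i))"
proof -
  have "\<phi> \<in> Val" using \<phi> by (simp add: Val_deg_def)
  then obtain d where d: "0 < d"
    "\<And>L. L \<in> convex_bodies \<Longrightarrow> hausdorff_within d L {0} \<Longrightarrow> \<bar>\<phi> L - \<phi> {0}\<bar> < 1"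
    using Val_continuous[OF _ convex_bodies_zero zero_less_one] by metis
  \<comment> \<open>A sum of \<open>j\<close> segments of length at most \<open>e\<close> stays
    within \<open>d\<close> of \<open>{0}\<close>; the summand 1 keeps the denominator
    positive.\<close>
  define e where "e = d / (real j + 1)"
  have e: "0 < e" using d by (simp add: e_def)
  show thesis
  proof (rule that[of "(1 + \<bar>\<phi> {0}\<bar>) / e ^ j"])
    show "0 \<le> (1 + \<bar>\<phi> {0}\<bar>) / e ^ j" using e by simp
    fix x :: "'i \<Rightarrow> 'a" and I :: "'i set" assume I: "finite I" "card I = j"
    \<comment> \<open>The vector rescaled to length \<open>e\<close>. For \<open>x i = 0\<close>
      division by zero makes the factor 0, so \<open>y i = 0\<close> and the relation
      \<open>xy\<close> below still holds.\<close>
    define y where "y i = (e / norm (x i)) *\<^sub>R x i" for i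
    have y: "norm (y i) \<le> e" for i using e by (simp add: y_def)
    have xy: "x i = (norm (x i) / e) *\<^sub>R y i" for i using e by (cases "x i = 0") (auto simp: y_def)
    have "(\<Sum>i\<in>I. dist (y i) 0) \<le> (\<Sum>i\<in>I. e)"
      using y by (intro sum_mono) simp
    also have "\<dots> \<le> d" using I d by (simp add: e_def field_simps)
    finally have "hausdorff_within d (segment_sum y I) (segment_sum (\<lambda>_. 0) I)"
      using hausdorff_within_segment_sum[of y "\<lambda>_. 0" I] hausdorff_within_mono by blast
    moreover have "segment_sum (\<lambda>_. 0::'a) I = {0}" by (simp add: segment_sum_def flip: set_zero)
    ultimately have b: "\<bar>\<phi> (segment_sum y I)\<bar> \<le> 1 + \<bar>\<phi> {0}\<bar>"
      using d(2)[OF convex_bodies_segment_sum, of y I] by simp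
    have "segment_sum x I = segment_sum (\<lambda>i. if i \<in> I then (norm (x i) / e) *\<^sub>R y i else y i) I"
      using xy by (intro segment_sum_cong) simp
    then have "\<phi> (segment_sum x I) = (\<Prod>i\<in>I. norm (x i) / e) * \<phi> (segment_sum y I)"
      using Val_deg_segment_sum_scale[OF \<phi> I, of I "\<lambda>i. norm (x i) / e" y] e by simp
    also have "(\<Prod>i\<in>I. norm (x i) / e) = (\<Prod>i\<in>I. norm (x i)) / e ^ j"
      using I by (simp add: prod_dividef)
    finally have "\<bar>\<phi> (segment_sum x I)\<bar> = (\<Prod>i\<in>I. norm (x i)) / e ^ j * \<bar>\<phi> (segment_sum y I)\<bar>"
      using e by (simp add: abs_mult prod_nonneg)
    also have "\<dots> \<le> (\<Prod>i\<in>I. norm (x i)) / e ^ j * (1 + \<bar>\<phi> {0}\<bar>)"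
      using b e by (intro mult_left_mono) (auto simp: prod_nonneg)
    finally show "\<bar>\<phi> (segment_sum x I)\<bar> \<le> (1 + \<bar>\<phi> {0}\<bar>) / e ^ j * (\<Prod>i\<in>I. norm (x i))"
      by (simp add: mult.commute)
  qed
qed

subsection \<open>Support functions and the selection expectation\<close>

lemma support_function_ge:
  assumes "K \<in> convex_bodies" "x \<in> K"
  shows "x \<bullet> u \<le> support_function K u"
  unfolding support_function_def
proof (rule cSUP_upper[OF assms(2)])
  have "compact ((\<lambda>x. x \<bullet> u) ` K)"
    using assms by (intro compact_continuous_image continuous_intros) (auto simp: convex_bodies_def)
  then show "bdd_above ((\<lambda>x. x \<bullet> u) ` K)" by (simp add: bounded_imp_bdd_above compact_imp_bounded)
qed

lemma support_function_attained:
  assumes "K \<in> convex_bodies"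
  obtains x where "x \<in> K" "support_function K u = x \<bullet> u"
proof -
  have "continuous_on K (\<lambda>x. x \<bullet> u)" by (intro continuous_intros)
  then obtain x where x: "x \<in> K" "\<And>y. y \<in> K \<Longrightarrow> y \<bullet> u \<le> x \<bullet> u"
    using continuous_attains_sup[of K "\<lambda>x. x \<bullet> u"] assms by (auto simp: convex_bodies_def)
  have "support_function K u \<le> x \<bullet> u"
    unfolding support_function_def using x by (intro cSUP_least) auto
  then show thesis using that x support_function_ge[OF assms x(1), of u] by force
qed

lemma support_function_eqI:
  assumes "K \<in> convex_bodies" "x \<in> K" "\<And>y. y \<in> K \<Longrightarrow> y \<bullet> u \<le> x \<bullet> u"
  shows "support_function K u = x \<bullet> u"
proof -
  obtain z where "z \<in> K" "support_function K u = z \<bullet> u"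
    using support_function_attained[OF assms(1), of u] .
  then show ?thesis using assms support_function_ge[OF assms(1,2), of u] by force
qed

lemma support_function_plus:
  assumes "K \<in> convex_bodies" "L \<in> convex_bodies"
  shows "support_function (K + L) u = support_function K u + support_function L u"
proof -
  obtain x where x: "x \<in> K" "support_function K u = x \<bullet> u"
    using support_function_attained[OF assms(1), of u] .
  obtain y where y: "y \<in> L" "support_function L u = y \<bullet> u"
    using support_function_attained[OF assms(2), of u] .
  have "support_function (K + L) u = (x + y) \<bullet> u"
  proof (rule support_function_eqI)
    fix z assume "z \<in> K + L"
    then obtain a b where ab: "z = a + b" "a \<in> K" "b \<in> L" by (auto elim: set_plus_elim)
    show "z \<bullet> u \<le> (x + y) \<bullet> u"
      using support_function_ge[OF assms(1) ab(2), of u] support_function_ge[OF assms(2) ab(3), of u]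
      by (simp add: ab(1) inner_add_left x y)
  qed (use x y assms in \<open>auto simp: convex_bodies_plus\<close>)
  then show ?thesis by (simp add: x y inner_add_left)
qed

lemma support_function_scaleR:
  assumes "K \<in> convex_bodies" "0 \<le> r"
  shows "support_function ((*\<^sub>R) r ` K) u = r * support_function K u"
proof -
  obtain x where x: "x \<in> K" "support_function K u = x \<bullet> u"
    using support_function_attained[OF assms(1), of u] .
  have "support_function ((*\<^sub>R) r ` K) u = (r *\<^sub>R x) \<bullet> u"
  proof (rule support_function_eqI)
    fix z assume "z \<in> (*\<^sub>R) r ` K"
    then show "z \<bullet> u \<le> r *\<^sub>R x \<bullet> u"
      using support_function_ge[OF assms(1), of _ u] assms(2) x by (auto intro!: mult_left_mono)
  qed (use x assms in \<open>auto simp: convex_bodies_scaleR\<close>)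
  then show ?thesis by (simp add: x)
qed

lemma support_function_segment: "support_function (closed_segment 0 x) u = max 0 (x \<bullet> u)"
proof (cases "x \<bullet> u \<le> 0")
  case True
  have "support_function (closed_segment 0 x) u = 0 \<bullet> u"
  proof (rule support_function_eqI)
    fix y assume "y \<in> closed_segment 0 x"
    then show "y \<bullet> u \<le> 0 \<bullet> u" using True by (auto simp: closed_segment_def mult_nonneg_nonpos)
  qed (auto simp: convex_bodies_segment)
  then show ?thesis using True by simp
next
  case False
  have "support_function (closed_segment 0 x) u = x \<bullet> u"
  proof (rule support_function_eqI)
    fix y assume "y \<in> closed_segment 0 x"
    then obtain t where "y = t *\<^sub>R x" "t \<le> 1" by (auto simp: closed_segment_def)
    then show "y \<bullet> u \<le> x \<bullet> u" using False mult_right_mono[of t 1 "x \<bullet> u"] by auto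
  qed (auto simp: convex_bodies_segment)
  then show ?thesis using False by simp
qed

lemma support_function_segment_sum:
  "support_function (segment_sum x I) u = (\<Sum>i\<in>I. max 0 (x i \<bullet> u))"
proof (induction I rule: infinite_finite_induct)
  case (insert i I)
  then show ?case
    by (simp add: segment_sum_insert support_function_plus support_function_segment
        convex_bodies_segment convex_bodies_segment_sum)
qed (auto simp: segment_sum_def support_function_def)

text \<open>Let \<open>y\<close> be the point of \<open>L\<close> nearest to \<open>x\<close>. Then
  \<open>y\<close> maximises the inner product with \<open>x - y\<close> over \<open>L\<close>, and
  the hypothesis in the direction \<open>u = x - y\<close> reads
  \<open>norm (x - y) ^ 2 \<le> e * norm (x - y)\<close>.\<close>

lemma support_function_le_imp_near:
  assumes K: "K \<in> convex_bodies" and L: "L \<in> convex_bodies"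
    and le: "\<And>u. support_function K u \<le> support_function L u + e * norm u"
    and x: "x \<in> K" and "0 \<le> e"
  obtains y where "y \<in> L" "dist x y \<le> e"
proof -
  obtain y where y: "y \<in> L" "\<And>z. z \<in> L \<Longrightarrow> dist x y \<le> dist x z"
    using distance_attains_inf[of L x] L by (auto simp: convex_bodies_def compact_imp_closed)
  have "support_function L (x - y) = y \<bullet> (x - y)"
  proof (rule support_function_eqI[OF L y(1)])
    fix z assume "z \<in> L"
    then have "(x - y) \<bullet> (z - y) \<le> 0"
      using y L by (intro any_closest_point_dot[of L]) (auto simp: convex_bodies_def compact_imp_closed)
    then show "z \<bullet> (x - y) \<le> y \<bullet> (x - y)" by (simp add: algebra_simps inner_commute)
  qed
  then have "x \<bullet> (x - y) \<le> y \<bullet> (x - y) + e * norm (x - y)"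
    using le[of "x - y"] support_function_ge[OF K x, of "x - y"] by simp
  then have "(x - y) \<bullet> (x - y) \<le> e * norm (x - y)"
    by (simp add: inner_diff_left)
  then have "norm (x - y) * norm (x - y) \<le> e * norm (x - y)"
    by (simp add: dot_square_norm power2_eq_square)
  then have "dist x y \<le> e"
    using \<open>0 \<le> e\<close> by (cases "x = y") (auto simp: dist_norm)
  then show thesis using that y by blast
qed

text \<open>The factor \<open>norm u\<close> encodes a bound on the unit sphere by positive
  homogeneity, so directions need not be normalised when it is applied.\<close>

lemma hausdorff_within_support_function:
  assumes "K \<in> convex_bodies" "L \<in> convex_bodies" "0 \<le> e"
    and "\<And>u. \<bar>support_function K u - support_function L u\<bar> \<le> e * norm u"
  shows "hausdorff_within e K L"
proof -
  have "support_function K u \<le> support_function L u + e * norm u"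
    "support_function L u \<le> support_function K u + e * norm u" for u
    using assms(4)[of u] by auto
  then show ?thesis
    unfolding hausdorff_within_def
    using support_function_le_imp_near[OF assms(1,2)] support_function_le_imp_near[OF assms(2,1)] assms(3)
    by (metis dist_commute)
qed

text \<open>The case \<open>e = 0\<close> of the preceding estimate. It supplies the uniqueness
  required by the \<open>THE\<close> in \<open>selection_expectation_segment\<close>.\<close>

lemma support_function_inject:
  assumes "K \<in> convex_bodies" "L \<in> convex_bodies" "support_function K = support_function L"
  shows "K = L"
proof -
  have "hausdorff_within 0 K L"
    using assms by (intro hausdorff_within_support_function) auto
  then show ?thesis
    unfolding hausdorff_within_def by auto
qed

text \<open>The body is realised as the closure of the set of all \<open>E[\<xi> X]\<close> with \<open>0 \<le> \<xi> \<le> 1\<close>;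
  in direction \<open>u\<close> the maximum is attained at the indicator of \<open>{X \<bullet> u > 0}\<close>.\<close>
lemma selection_expectation_segment:
  fixes X :: "'w \<Rightarrow> 'a::euclidean_space"
  assumes X: "integrable M X"
  shows selection_expectation_segment_convex_body: "selection_expectation_segment M X \<in> convex_bodies"
    and support_function_selection_expectation_segment:
      "support_function (selection_expectation_segment M X) u = (\<integral>\<omega>. max 0 (X \<omega> \<bullet> u) \<partial>M)"
proof -
  define W where "W = {\<xi>::'w \<Rightarrow> real. \<xi> \<in> borel_measurable M \<and> (\<forall>\<omega>. 0 \<le> \<xi> \<omega> \<and> \<xi> \<omega> \<le> 1)}"
  define S where "S = (\<lambda>\<xi>. \<integral>\<omega>. \<xi> \<omega> *\<^sub>R X \<omega> \<partial>M) ` W"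
  have [measurable]: "X \<in> borel_measurable M" using X by auto
  have int: "integrable M (\<lambda>\<omega>. \<xi> \<omega> *\<^sub>R X \<omega>)" if "\<xi> \<in> W" for \<xi>
  proof (rule Bochner_Integration.integrable_bound[OF X])
    have [measurable]: "\<xi> \<in> borel_measurable M" using that by (simp add: W_def)
    show "(\<lambda>\<omega>. \<xi> \<omega> *\<^sub>R X \<omega>) \<in> borel_measurable M" by measurable
    show "AE \<omega> in M. norm (\<xi> \<omega> *\<^sub>R X \<omega>) \<le> norm (X \<omega>)"
      using that by (intro AE_I2) (auto simp: W_def intro!: mult_left_le_one_le)
  qed
  have int_max: "integrable M (\<lambda>\<omega>. max 0 (X \<omega> \<bullet> u))" for u
    using X by (intro integrable_max integrable_inner_left) auto
  have "convex S"
  proof (rule convexI)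
    fix x y and a b :: real assume "x \<in> S" "y \<in> S" and ab: "0 \<le> a" "0 \<le> b" "a + b = 1"
    then obtain \<xi> \<eta> where *: "\<xi> \<in> W" "\<eta> \<in> W" "x = (\<integral>\<omega>. \<xi> \<omega> *\<^sub>R X \<omega> \<partial>M)" "y = (\<integral>\<omega>. \<eta> \<omega> *\<^sub>R X \<omega> \<partial>M)"
      by (auto simp: S_def)
    have "a *\<^sub>R x + b *\<^sub>R y = (\<integral>\<omega>. a *\<^sub>R \<xi> \<omega> *\<^sub>R X \<omega> + b *\<^sub>R \<eta> \<omega> *\<^sub>R X \<omega> \<partial>M)"
      using int[OF *(1)] int[OF *(2)] by (simp add: * Bochner_Integration.integral_add del: scaleR_scaleR)
    also have "\<dots> = (\<integral>\<omega>. (a * \<xi> \<omega> + b * \<eta> \<omega>) *\<^sub>R X \<omega> \<partial>M)"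
      by (simp add: scaleR_add_left)
    finally have "a *\<^sub>R x + b *\<^sub>R y = (\<integral>\<omega>. (a * \<xi> \<omega> + b * \<eta> \<omega>) *\<^sub>R X \<omega> \<partial>M)" .
    moreover have "(\<lambda>\<omega>. a * \<xi> \<omega> + b * \<eta> \<omega>) \<in> W"
      using * ab convex_bound_le[of _ 1 _ a b] by (auto simp: W_def)
    ultimately show "a *\<^sub>R x + b *\<^sub>R y \<in> S" by (auto simp: S_def)
  qed
  moreover have "bounded S"
  proof (rule boundedI[where B = "\<integral>\<omega>. norm (X \<omega>) \<partial>M"])
    fix x assume "x \<in> S"
    then obtain \<xi> where *: "\<xi> \<in> W" "x = (\<integral>\<omega>. \<xi> \<omega> *\<^sub>R X \<omega> \<partial>M)" by (auto simp: S_def)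
    have "norm x \<le> (\<integral>\<omega>. norm (\<xi> \<omega> *\<^sub>R X \<omega>) \<partial>M)"
      unfolding * by (rule integral_norm_bound)
    also have "\<dots> \<le> (\<integral>\<omega>. norm (X \<omega>) \<partial>M)"
    proof (rule integral_mono)
      show "integrable M (\<lambda>\<omega>. norm (\<xi> \<omega> *\<^sub>R X \<omega>))" by (intro integrable_norm int *)
      show "integrable M (\<lambda>\<omega>. norm (X \<omega>))" by (intro integrable_norm X)
    qed (use * in \<open>auto simp: W_def intro!: mult_left_le_one_le\<close>)
    finally show "norm x \<le> (\<integral>\<omega>. norm (X \<omega>) \<partial>M)" .
  qed
  moreover have "(\<lambda>_. 0) \<in> W" by (auto simp: W_def)
  then have "S \<noteq> {}" by (auto simp: S_def)
  ultimately have body: "closure S \<in> convex_bodies"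
    by (auto simp: convex_bodies_def convex_closure)
  have support: "support_function (closure S) u = (\<integral>\<omega>. max 0 (X \<omega> \<bullet> u) \<partial>M)" for u
  proof -
    define \<xi> where "\<xi> \<omega> = (if X \<omega> \<bullet> u > 0 then 1 else 0 :: real)" for \<omega>
    have "\<xi> \<in> borel_measurable M" unfolding \<xi>_def by measurable
    then have \<xi>: "\<xi> \<in> W" by (auto simp: W_def \<xi>_def)
    have inner: "(\<integral>\<omega>. \<eta> \<omega> *\<^sub>R X \<omega> \<partial>M) \<bullet> u = (\<integral>\<omega>. \<eta> \<omega> * (X \<omega> \<bullet> u) \<partial>M)" if "\<eta> \<in> W" for \<eta>
      using integral_inner_left[OF int[OF that], of u] by simp
    have \<xi>_eq: "(\<integral>\<omega>. \<xi> \<omega> *\<^sub>R X \<omega> \<partial>M) \<bullet> u = (\<integral>\<omega>. max 0 (X \<omega> \<bullet> u) \<partial>M)"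
      unfolding inner[OF \<xi>] by (intro Bochner_Integration.integral_cong) (auto simp: \<xi>_def)
    \<comment> \<open>Pointwise, \<open>\<eta> * (X \<bullet> u)\<close> is at most
      \<open>max 0 (X \<bullet> u)\<close> because \<open>0 \<le> \<eta> \<le> 1\<close>. The
      half-space is closed, so the bound passes to the closure of \<open>S\<close>.\<close>
    have "S \<subseteq> {y. y \<bullet> u \<le> (\<integral>\<omega>. max 0 (X \<omega> \<bullet> u) \<partial>M)}"
    proof
      fix y assume "y \<in> S"
      then obtain \<eta> where *: "\<eta> \<in> W" "y = (\<integral>\<omega>. \<eta> \<omega> *\<^sub>R X \<omega> \<partial>M)" by (auto simp: S_def)
      have "(\<integral>\<omega>. \<eta> \<omega> * (X \<omega> \<bullet> u) \<partial>M) \<le> (\<integral>\<omega>. max 0 (X \<omega> \<bullet> u) \<partial>M)"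
      proof (rule integral_mono)
        show "integrable M (\<lambda>\<omega>. \<eta> \<omega> * (X \<omega> \<bullet> u))"
          using integrable_inner_left[OF int[OF *(1)], of u] by simp
        fix \<omega>
        have "0 \<le> \<eta> \<omega>" "\<eta> \<omega> \<le> 1" using * by (auto simp: W_def)
        then show "\<eta> \<omega> * (X \<omega> \<bullet> u) \<le> max 0 (X \<omega> \<bullet> u)"
          by (cases "0 \<le> X \<omega> \<bullet> u") (auto simp: max_def mult_left_le_one_le mult_nonneg_nonpos)
      qed (rule int_max)
      then show "y \<in> {y. y \<bullet> u \<le> (\<integral>\<omega>. max 0 (X \<omega> \<bullet> u) \<partial>M)}"
        using inner[OF *(1)] * by simp
    qed
    then have "closure S \<subseteq> {y. y \<bullet> u \<le> (\<integral>\<omega>. max 0 (X \<omega> \<bullet> u) \<partial>M)}"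
      by (intro closure_minimal) (simp_all add: closed_halfspace_le inner_commute[of _ u])
    moreover have "(\<integral>\<omega>. \<xi> \<omega> *\<^sub>R X \<omega> \<partial>M) \<in> closure S"
      using \<xi> closure_subset[of S] by (auto simp: S_def)
    ultimately have "support_function (closure S) u = (\<integral>\<omega>. \<xi> \<omega> *\<^sub>R X \<omega> \<partial>M) \<bullet> u"
      by (intro support_function_eqI[OF body]) (auto simp: \<xi>_eq)
    then show ?thesis by (simp add: \<xi>_eq)
  qed
  have "selection_expectation_segment M X = closure S"
    unfolding selection_expectation_segment_def
  proof (rule the_equality)
    fix K :: "'a set" assume "K \<in> convex_bodies \<and>
      (\<forall>u. support_function K u = (\<integral>\<omega>. support_function (closed_segment 0 (X \<omega>)) u \<partial>M))"
    then show "K = closure S"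
      by (intro support_function_inject) (auto simp: body support support_function_segment)
  qed (auto simp: body support support_function_segment)
  then show "selection_expectation_segment M X \<in> convex_bodies"
    "support_function (selection_expectation_segment M X) u = (\<integral>\<omega>. max 0 (X \<omega> \<bullet> u) \<partial>M)"
    using body support by auto
qed

subsection \<open>Second moments and weak convergence\<close>

lemma char_distr:
  fixes Y :: "'a \<Rightarrow> real"
  assumes [measurable]: "Y \<in> borel_measurable M"
  shows "char (distr M borel Y) t = (\<integral>\<omega>. iexp (t * Y \<omega>) \<partial>M)"
  unfolding char_def by (rule integral_distr) auto

context prob_space
begin

text \<open>Nonnegativity of the variance of \<open>\<bar>Y\<bar>\<close>. Error terms are computed
  in second moment, while the weak limit needs their first absolute moment.\<close>

lemma expectation_abs_le_sqrt:
  fixes Y :: "'a \<Rightarrow> real"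
  assumes [measurable]: "Y \<in> borel_measurable M" and Y2: "integrable M (\<lambda>\<omega>. (Y \<omega>)\<^sup>2)"
    and le: "expectation (\<lambda>\<omega>. (Y \<omega>)\<^sup>2) \<le> B"
  shows "expectation (\<lambda>\<omega>. \<bar>Y \<omega>\<bar>) \<le> sqrt B"
proof -
  have "integrable M Y" by (rule square_integrable_imp_integrable) (use Y2 in auto)
  then have "variance (\<lambda>\<omega>. \<bar>Y \<omega>\<bar>) = expectation (\<lambda>\<omega>. \<bar>Y \<omega>\<bar>\<^sup>2) - (expectation (\<lambda>\<omega>. \<bar>Y \<omega>\<bar>))\<^sup>2"
    using Y2 by (intro variance_eq) auto
  then have "(expectation (\<lambda>\<omega>. \<bar>Y \<omega>\<bar>))\<^sup>2 \<le> expectation (\<lambda>\<omega>. (Y \<omega>)\<^sup>2)"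
    using variance_positive[of "\<lambda>\<omega>. \<bar>Y \<omega>\<bar>"] by simp
  then show ?thesis using le by (intro real_le_rsqrt) linarith
qed

lemma square_integrable_add:
  fixes Y Z :: "'a \<Rightarrow> real"
  assumes [measurable]: "Y \<in> borel_measurable M" "Z \<in> borel_measurable M"
    and "integrable M (\<lambda>\<omega>. (Y \<omega>)\<^sup>2)" "integrable M (\<lambda>\<omega>. (Z \<omega>)\<^sup>2)"
  shows "integrable M (\<lambda>\<omega>. (Y \<omega> + Z \<omega>)\<^sup>2)"
proof (rule Bochner_Integration.integrable_bound[where f = "\<lambda>\<omega>. 2 * (Y \<omega>)\<^sup>2 + 2 * (Z \<omega>)\<^sup>2"])
  have "(a + b)\<^sup>2 \<le> 2 * a\<^sup>2 + 2 * b\<^sup>2" for a b :: real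
    using sum_squares_bound[of a b] by (simp add: power2_sum)
  then show "AE \<omega> in M. norm ((Y \<omega> + Z \<omega>)\<^sup>2) \<le> norm (2 * (Y \<omega>)\<^sup>2 + 2 * (Z \<omega>)\<^sup>2)"
    by (intro AE_I2) simp
qed (use assms in auto)

lemma square_integrable_sum:
  fixes Y :: "'i \<Rightarrow> 'a \<Rightarrow> real"
  assumes "\<And>i. i \<in> I \<Longrightarrow> Y i \<in> borel_measurable M" "\<And>i. i \<in> I \<Longrightarrow> integrable M (\<lambda>\<omega>. (Y i \<omega>)\<^sup>2)"
  shows "integrable M (\<lambda>\<omega>. (\<Sum>i\<in>I. Y i \<omega>)\<^sup>2)"
  using assms
proof (induction I rule: infinite_finite_induct)
  case (insert i I)
  have "integrable M (\<lambda>\<omega>. (Y i \<omega> + (\<Sum>i\<in>I. Y i \<omega>))\<^sup>2)"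
    using insert by (intro square_integrable_add) (auto intro!: borel_measurable_sum)
  then show ?case using insert by simp
qed auto

lemma square_integrable_mult:
  fixes Y Z :: "'a \<Rightarrow> real"
  assumes [measurable]: "Y \<in> borel_measurable M" "Z \<in> borel_measurable M"
    and "integrable M (\<lambda>\<omega>. (Y \<omega>)\<^sup>2)" "integrable M (\<lambda>\<omega>. (Z \<omega>)\<^sup>2)"
  shows "integrable M (\<lambda>\<omega>. Y \<omega> * Z \<omega>)"
proof (rule Bochner_Integration.integrable_bound[where f = "\<lambda>\<omega>. (Y \<omega>)\<^sup>2 + (Z \<omega>)\<^sup>2"])
  have "\<bar>a * b\<bar> \<le> a\<^sup>2 + b\<^sup>2" for a b :: real
    using sum_squares_bound[of a b] sum_squares_bound[of a "- b"] zero_le_power2[of a] zero_le_power2[of b]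
    by (simp add: abs_le_iff)
  then show "AE \<omega> in M. norm (Y \<omega> * Z \<omega>) \<le> norm ((Y \<omega>)\<^sup>2 + (Z \<omega>)\<^sup>2)"
    by (intro AE_I2) simp
qed (use assms in auto)

text \<open>In the expanded square only the pairs in \<open>R\<close> survive, and each contributes
  at most \<open>C\<close> since \<open>g a * g b\<close> is at most the mean of the two squares.
  The bound thus becomes a matter of counting correlated pairs.\<close>

lemma second_moment_sum_le:
  fixes g :: "'i \<Rightarrow> 'a \<Rightarrow> real"
  assumes "finite A" and R: "R \<subseteq> A \<times> A"
    and g: "\<And>a. a \<in> A \<Longrightarrow> g a \<in> borel_measurable M" "\<And>a. a \<in> A \<Longrightarrow> integrable M (\<lambda>\<omega>. (g a \<omega>)\<^sup>2)"
    and C: "\<And>a. a \<in> A \<Longrightarrow> expectation (\<lambda>\<omega>. (g a \<omega>)\<^sup>2) \<le> C"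
    and orth: "\<And>a b. a \<in> A \<Longrightarrow> b \<in> A \<Longrightarrow> (a, b) \<notin> R \<Longrightarrow> expectation (\<lambda>\<omega>. g a \<omega> * g b \<omega>) = 0"
  shows "expectation (\<lambda>\<omega>. (\<Sum>a\<in>A. g a \<omega>)\<^sup>2) \<le> real (card R) * C"
proof -
  have int: "integrable M (\<lambda>\<omega>. g a \<omega> * g b \<omega>)" if "a \<in> A" "b \<in> A" for a b
    using that g by (intro square_integrable_mult) auto
  have "expectation (\<lambda>\<omega>. (\<Sum>a\<in>A. g a \<omega>)\<^sup>2) = expectation (\<lambda>\<omega>. \<Sum>(a, b)\<in>A \<times> A. g a \<omega> * g b \<omega>)"
    by (simp add: power2_eq_square sum_product sum.cartesian_product)
  also have "\<dots> = (\<Sum>(a, b)\<in>A \<times> A. expectation (\<lambda>\<omega>. g a \<omega> * g b \<omega>))"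
    using int by (subst Bochner_Integration.integral_sum) (auto simp: case_prod_unfold)
  also have "\<dots> = (\<Sum>(a, b)\<in>R. expectation (\<lambda>\<omega>. g a \<omega> * g b \<omega>))"
    using R orth \<open>finite A\<close> by (intro sum.mono_neutral_right) auto
  also have "\<dots> \<le> (\<Sum>(a, b)\<in>R. C)"
  proof (intro sum_mono, clarsimp)
    fix a b assume "(a, b) \<in> R"
    then have ab: "a \<in> A" "b \<in> A" using R by auto
    have "expectation (\<lambda>\<omega>. g a \<omega> * g b \<omega>) \<le> expectation (\<lambda>\<omega>. ((g a \<omega>)\<^sup>2 + (g b \<omega>)\<^sup>2) / 2)"
    proof (rule integral_mono)
      fix \<omega> show "g a \<omega> * g b \<omega> \<le> ((g a \<omega>)\<^sup>2 + (g b \<omega>)\<^sup>2) / 2"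
        using sum_squares_bound[of "g a \<omega>" "g b \<omega>"] by simp
    qed (use ab int g in auto)
    also have "\<dots> = (expectation (\<lambda>\<omega>. (g a \<omega>)\<^sup>2) + expectation (\<lambda>\<omega>. (g b \<omega>)\<^sup>2)) / 2"
      using ab g by simp
    finally show "expectation (\<lambda>\<omega>. g a \<omega> * g b \<omega>) \<le> C"
      using C[OF ab(1)] C[OF ab(2)] by simp
  qed
  also have "\<dots> = real (card R) * C" by (simp add: case_prod_unfold)
  finally show ?thesis .
qed

text \<open>Fubini for the joint law, which is a product by independence. Both integrals are pulled
  back to \<open>M\<close>, so the second outcome \<open>\<omega>'\<close> plays the part of an
  independent copy.\<close>

lemma indep_var_integral_iterated:
  fixes F :: "'b \<times> 'b \<Rightarrow> real"
  assumes "indep_var N Y N' W" and F [measurable]: "F \<in> borel_measurable (N \<Otimes>\<^sub>M N')"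
    and int: "integrable M (\<lambda>\<omega>. F (Y \<omega>, W \<omega>))"
  shows "expectation (\<lambda>\<omega>. F (Y \<omega>, W \<omega>)) = expectation (\<lambda>\<omega>. expectation (\<lambda>\<omega>'. F (Y \<omega>, W \<omega>')))"
proof -
  have [measurable]: "Y \<in> measurable M N" "W \<in> measurable M N'"
    and eq: "distr M N Y \<Otimes>\<^sub>M distr M N' W = distr M (N \<Otimes>\<^sub>M N') (\<lambda>\<omega>. (Y \<omega>, W \<omega>))"
    using assms(1) unfolding indep_var_distribution_eq by auto
  interpret Y: prob_space "distr M N Y" by (rule prob_space_distr) simp
  interpret W: prob_space "distr M N' W" by (rule prob_space_distr) simp
  interpret YW: pair_prob_space "distr M N Y" "distr M N' W" ..
  have "expectation (\<lambda>\<omega>. F (Y \<omega>, W \<omega>)) = (\<integral>p. F p \<partial>(distr M N Y \<Otimes>\<^sub>M distr M N' W))"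
    unfolding eq by (subst integral_distr) auto
  also have "\<dots> = (\<integral>y. (\<integral>w. F (y, w) \<partial>distr M N' W) \<partial>distr M N Y)"
    by (rule YW.integral_fst'[symmetric], unfold eq, subst integrable_distr_eq) (use int in auto)
  also have "\<dots> = (\<integral>y. expectation (\<lambda>\<omega>'. F (y, W \<omega>')) \<partial>distr M N Y)"
    by (intro Bochner_Integration.integral_cong refl integral_distr) auto
  also have "\<dots> = expectation (\<lambda>\<omega>. expectation (\<lambda>\<omega>'. F (Y \<omega>, W \<omega>')))"
    by (intro integral_distr) auto
  finally show ?thesis .
qed

section \<open>Characteristic functions and perturbation of weak limits\<close>

lemma real_distribution_distr:
  "Y \<in> borel_measurable M \<Longrightarrow> real_distribution (distr M borel Y)"
  unfolding real_distribution_def real_distribution_axioms_def by (simp add: prob_space_distr)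

text \<open>The map \<open>a \<mapsto> exp(i a)\<close> is 1-Lipschitz on the real line, so the
  estimate holds pointwise before integration.\<close>

lemma char_distr_diff_le:
  fixes A B :: "'a \<Rightarrow> real"
  assumes [measurable]: "A \<in> borel_measurable M" "B \<in> borel_measurable M"
    and int: "integrable M (\<lambda>\<omega>. A \<omega> - B \<omega>)"
  shows "cmod (char (distr M borel A) t - char (distr M borel B) t) \<le>
    \<bar>t\<bar> * expectation (\<lambda>\<omega>. \<bar>A \<omega> - B \<omega>\<bar>)"
proof -
  have iexp: "cmod (iexp a - iexp b) \<le> \<bar>a - b\<bar>" for a b :: real
  proof -
    have "iexp a - iexp b = iexp b * (iexp (a - b) - 1)"
      by (simp add: algebra_simps flip: exp_add)
    then show ?thesis using iexp_approx1[of "a - b" 0] by (simp add: norm_mult)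
  qed
  have int_iexp: "integrable M (\<lambda>\<omega>. iexp (t * Y \<omega>))" if [measurable]: "Y \<in> borel_measurable M" for Y
    by (rule integrable_const_bound[where B = 1]) auto
  have "char (distr M borel A) t - char (distr M borel B) t =
      (\<integral>\<omega>. iexp (t * A \<omega>) - iexp (t * B \<omega>) \<partial>M)"
    unfolding char_distr[OF assms(1)] char_distr[OF assms(2)]
    by (rule Bochner_Integration.integral_diff[symmetric]; rule int_iexp) fact+
  also have "cmod \<dots> \<le> (\<integral>\<omega>. cmod (iexp (t * A \<omega>) - iexp (t * B \<omega>)) \<partial>M)"
    by (rule integral_norm_bound)
  also have "\<dots> \<le> (\<integral>\<omega>. \<bar>t\<bar> * \<bar>A \<omega> - B \<omega>\<bar> \<partial>M)"
  proof (rule integral_mono)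
    fix \<omega>
    show "cmod (iexp (t * A \<omega>) - iexp (t * B \<omega>)) \<le> \<bar>t\<bar> * \<bar>A \<omega> - B \<omega>\<bar>"
      using iexp[of "t * A \<omega>" "t * B \<omega>"] by (simp add: abs_mult flip: right_diff_distrib)
  next
    show "integrable M (\<lambda>\<omega>. cmod (iexp (t * A \<omega>) - iexp (t * B \<omega>)))"
      by (intro integrable_norm Bochner_Integration.integrable_diff int_iexp assms)
    show "integrable M (\<lambda>\<omega>. \<bar>t\<bar> * \<bar>A \<omega> - B \<omega>\<bar>)" using int by simp
  qed
  finally show ?thesis by simp
qed

text \<open>A Slutsky-type statement: a difference tending to 0 in mean does not change limits of
  characteristic functions, and Levy's continuity theorem converts both ways.\<close>

lemma weak_conv_m_L1_perturbation:
  fixes A B :: "nat \<Rightarrow> 'a \<Rightarrow> real"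
  assumes meas: "\<And>n. A n \<in> borel_measurable M" "\<And>n. B n \<in> borel_measurable M"
    and int: "\<And>n. integrable M (\<lambda>\<omega>. A n \<omega> - B n \<omega>)"
    and lim: "(\<lambda>n. expectation (\<lambda>\<omega>. \<bar>A n \<omega> - B n \<omega>\<bar>)) \<longlonglongrightarrow> 0"
    and N: "real_distribution N" and B: "weak_conv_m (\<lambda>n. distr M borel (B n)) N"
  shows "weak_conv_m (\<lambda>n. distr M borel (A n)) N"
proof (rule levy_continuity[OF real_distribution_distr[OF meas(1)] N])
  fix t
  have "(\<lambda>n. char (distr M borel (A n)) t - char (distr M borel (B n)) t) \<longlonglongrightarrow> 0"
  proof (rule Lim_null_comparison)
    show "\<forall>\<^sub>F n in sequentially. cmod (char (distr M borel (A n)) t - char (distr M borel (B n)) t)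
        \<le> \<bar>t\<bar> * expectation (\<lambda>\<omega>. \<bar>A n \<omega> - B n \<omega>\<bar>)"
      by (intro always_eventually allI char_distr_diff_le meas int)
    show "(\<lambda>n. \<bar>t\<bar> * expectation (\<lambda>\<omega>. \<bar>A n \<omega> - B n \<omega>\<bar>)) \<longlonglongrightarrow> 0"
      using tendsto_mult_left[OF lim, of "\<bar>t\<bar>"] by simp
  qed
  moreover have "(\<lambda>n. char (distr M borel (B n)) t) \<longlonglongrightarrow> char N t"
    by (rule levy_continuity1[OF real_distribution_distr[OF meas(2)] N B])
  ultimately show "(\<lambda>n. char (distr M borel (A n)) t) \<longlonglongrightarrow> char N t"
    by (rule Lim_transform[rotated])
qed

end

lemma normal_distribution_eq_distr:
  assumes "0 < s"
  shows "normal_distribution 0 (s\<^sup>2) = distr std_normal_distribution borel (\<lambda>x. s * x)"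
proof -
  interpret N: prob_space std_normal_distribution by (rule prob_space_normal_density) simp
  have "distributed std_normal_distribution lborel (\<lambda>x. x) (\<lambda>x. ennreal (std_normal_density x))"
    by (auto simp: distributed_def distr_id2)
  from N.normal_density_affine[OF this, of s 0] assms
  have "distr std_normal_distribution lborel (\<lambda>x. s * x) = density lborel (normal_density 0 s)"
    by (simp add: distributed_def)
  then show ?thesis using assms by (simp add: normal_distribution_def cong: distr_cong)
qed

lemma real_distribution_normal_distribution:
  assumes "0 \<le> v"
  shows "real_distribution (normal_distribution m v)"
proof (cases "v = 0")
  case True
  then show ?thesis
    by (auto simp: normal_distribution_def real_distribution_def real_distribution_axioms_def
        intro!: prob_space_return)
next
  case False
  then show ?thesis using assms prob_space_normal_density[of "sqrt v" m]
    by (auto simp: normal_distribution_def real_distribution_def real_distribution_axioms_def)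
qed

text \<open>Standardising divides by the standard deviation, so variance 0 is separate: then every
  \<open>V n\<close> vanishes almost surely and both sides are the point mass at 0. Otherwise the
  normalised sum is the standardised one times \<open>c * s\<close>, and its characteristic function
  at \<open>t\<close> is that of the latter at \<open>t * (c * s)\<close>.\<close>

lemma (in prob_space) weak_conv_m_scaled_iid_sum:
  fixes V :: "nat \<Rightarrow> 'a \<Rightarrow> real"
  assumes indep: "indep_vars (\<lambda>_. borel) V UNIV"
    and mean: "\<And>n. expectation (V n) = 0"
    and sq: "\<And>n. integrable M (\<lambda>\<omega>. (V n \<omega>)\<^sup>2)"
    and var: "\<And>n. expectation (\<lambda>\<omega>. (V n \<omega>)\<^sup>2) = v"
    and distr: "\<And>n. distr M borel (V n) = \<mu>"
    and c: "0 < c"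
  shows "weak_conv_m (\<lambda>n. distr M borel (\<lambda>\<omega>. c / sqrt (real n) * (\<Sum>i<n. V i \<omega>)))
    (normal_distribution 0 (c\<^sup>2 * v))"
proof -
  have V [measurable]: "V n \<in> borel_measurable M" for n
    using indep unfolding indep_vars_def2 by simp
  have "0 \<le> expectation (\<lambda>\<omega>. (V 0 \<omega>)\<^sup>2)" by simp
  then have "0 \<le> v" by (simp add: var)
  then have N: "real_distribution (normal_distribution 0 (c\<^sup>2 * v))"
    by (intro real_distribution_normal_distribution) auto
  let ?B = "\<lambda>n \<omega>. c / sqrt (real n) * (\<Sum>i<n. V i \<omega>)"
  show ?thesis
  proof (cases "v = 0")
    case True
    have "AE \<omega> in M. V n \<omega> = 0" for n
      using integral_nonneg_eq_0_iff_AE[OF sq[of n]] by (simp add: var True)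
    then have "AE \<omega> in M. \<forall>n. V n \<omega> = 0" by (simp add: AE_all_countable)
    then have "AE \<omega> in M. ?B n \<omega> = 0" for n by eventually_elim simp
    then have "distr M borel (?B n) = distr M borel (\<lambda>_. 0)" for n
      by (intro distr_cong_AE) auto
    then have "distr M borel (?B n) = normal_distribution 0 (c\<^sup>2 * v)" for n
      by (simp add: True normal_distribution_def)
    then show ?thesis by (simp add: weak_conv_m_def weak_conv_def)
  next
    case False
    define s where "s = sqrt v"
    have s: "0 < s" "s\<^sup>2 = v" using \<open>0 \<le> v\<close> False by (auto simp: s_def)
    have "weak_conv_m (\<lambda>n. distr M borel (\<lambda>\<omega>. (\<Sum>i<n. V i \<omega> - 0) / sqrt (n * s\<^sup>2))) std_normal_distribution"
      by (rule central_limit_theorem[OF indep mean s(1) sq _ distr]) (simp add: mean var s)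
    then have clt: "weak_conv_m (\<lambda>n. distr M borel (\<lambda>\<omega>. (\<Sum>i<n. V i \<omega>) / sqrt (n * s\<^sup>2))) std_normal_distribution"
      by simp
    show ?thesis
    proof (rule levy_continuity[OF real_distribution_distr N])
      fix t
      have "char (distr M borel (?B n)) t =
          char (distr M borel (\<lambda>\<omega>. (\<Sum>i<n. V i \<omega>) / sqrt (n * s\<^sup>2))) (t * (c * s))" for n
      proof -
        have "t * (c * s) * (x / sqrt (real n * s\<^sup>2)) = t * (c / sqrt (real n) * x)" for x
          using s(1) by (simp add: real_sqrt_mult)
        then show ?thesis
          by (subst (1 2) char_distr) (auto simp del: of_real_mult)
      qed
      moreover have "(\<lambda>n. char (distr M borel (\<lambda>\<omega>. (\<Sum>i<n. V i \<omega>) / sqrt (n * s\<^sup>2))) (t * (c * s)))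
          \<longlonglongrightarrow> char std_normal_distribution (t * (c * s))"
        by (rule levy_continuity1[OF real_distribution_distr real_dist_normal_dist clt]) simp
      moreover have "char (normal_distribution 0 (c\<^sup>2 * v)) t = char std_normal_distribution (t * (c * s))"
      proof -
        have "normal_distribution 0 (c\<^sup>2 * v) = distr std_normal_distribution borel (\<lambda>x. c * s * x)"
          using normal_distribution_eq_distr[of "c * s"] s c by (simp add: power_mult_distrib)
        then show ?thesis
          by (simp only:) (subst char_distr, simp, simp add: char_def mult.assoc)
      qed
      ultimately show "(\<lambda>n. char (distr M borel (?B n)) t) \<longlonglongrightarrow> char (normal_distribution 0 (c\<^sup>2 * v)) t"
        by simp
    qed simp
  qed
qed

subsection \<open>U-statistics\<close>

lemma card_subsets_containing:
  assumes "finite N" "T \<subseteq> N" "card T \<le> j"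
  shows "card {I. T \<subseteq> I \<and> I \<subseteq> N \<and> card I = j} = (card N - card T) choose (j - card T)"
proof -
  have T: "finite T" using assms finite_subset by blast
  have "bij_betw (\<lambda>I. I \<union> T) {I. I \<subseteq> N - T \<and> card I = j - card T} {I. T \<subseteq> I \<and> I \<subseteq> N \<and> card I = j}"
  proof (rule bij_betwI[where g = "\<lambda>I. I - T"])
    show "(\<lambda>I. I \<union> T) \<in> {I. I \<subseteq> N - T \<and> card I = j - card T} \<rightarrow> {I. T \<subseteq> I \<and> I \<subseteq> N \<and> card I = j}"
    proof clarsimp
      fix I assume I: "I \<subseteq> N - T" "card I = j - card T"
      then have "finite I" "I \<inter> T = {}"
        using finite_subset[OF I(1)] assms(1) by auto
      then have "card (I \<union> T) = j"
        using I(2) T assms(3) by (simp add: card_Un_disjoint)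
      then show "I \<subseteq> N \<and> T \<subseteq> N \<and> card (I \<union> T) = j"
        using I(1) assms(2) by blast
    qed
    show "(\<lambda>I. I - T) \<in> {I. T \<subseteq> I \<and> I \<subseteq> N \<and> card I = j} \<rightarrow> {I. I \<subseteq> N - T \<and> card I = j - card T}"
      using T by (auto simp: card_Diff_subset)
  qed auto
  from bij_betw_same_card[OF this]
  have "card {I. T \<subseteq> I \<and> I \<subseteq> N \<and> card I = j} = card {I. I \<subseteq> N - T \<and> card I = j - card T}"
    by simp
  also have "\<dots> = (card N - card T) choose (j - card T)"
    using assms T by (simp add: n_subsets card_Diff_subset)
  finally show ?thesis .
qed

lemma choose_le_power: "n choose k \<le> n ^ k"
  by (cases "k \<le> n") (auto simp: binomial_le_pow binomial_eq_0)

text \<open>Two distinct common elements can be chosen in at most \<open>n^2\<close> ways, and each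
  of \<open>I\<close> and \<open>J\<close> is completed in at most \<open>n^(j-2)\<close> ways.
  Constants are given away; what matters is the gain of \<open>n^2\<close> over all
  \<open>n^(2j)\<close> pairs. For \<open>j < 2\<close> there is no such pair.\<close>

lemma card_overlapping_pairs_le:
  fixes n j :: nat
  defines "P \<equiv> {I. I \<subseteq> {1..n} \<and> card I = j}"
  shows "card {(I, J). I \<in> P \<and> J \<in> P \<and> 2 \<le> card (I \<inter> J)} \<le> n ^ (2 * j - 2)"
    (is "card ?R \<le> _")
proof (cases "2 \<le> j")
  case False
  have "\<not> 2 \<le> card (I \<inter> J)" if "I \<in> P" for I J
    using that False card_mono[of I "I \<inter> J"] finite_subset[of I "{1..n}"] by (auto simp: P_def)
  then have R: "?R = {}" by auto
  show ?thesis unfolding R by simp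
next
  case True
  define Q where "Q p = {I. {fst p, snd p} \<subseteq> I \<and> I \<subseteq> {1..n} \<and> card I = j}" for p
  define D where "D = {p \<in> {1..n} \<times> {1..n}. fst p \<noteq> snd p}"
  have finD: "finite D" by (rule finite_subset[of _ "{1..n} \<times> {1..n}"]) (auto simp: D_def)
  have cardD: "card D \<le> n * n"
    using card_mono[of "{1..n} \<times> {1..n}" D] by (auto simp: D_def)
  have finQ: "finite (Q p)" for p
    by (rule finite_subset[of _ "Pow {1..n}"]) (auto simp: Q_def)
  have cardQ: "card (Q p) \<le> n ^ (j - 2)" if "p \<in> D" for p
  proof -
    have "card {fst p, snd p} = 2" using that by (auto simp: D_def)
    then have "card (Q p) = (n - 2) choose (j - 2)"
      using card_subsets_containing[of "{1..n}" "{fst p, snd p}" j] that True by (auto simp: Q_def D_def)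
    also have "\<dots> \<le> (n - 2) ^ (j - 2)" by (rule choose_le_power)
    also have "\<dots> \<le> n ^ (j - 2)" by (rule power_mono) auto
    finally show ?thesis .
  qed
  have "?R \<subseteq> (\<Union>p\<in>D. Q p \<times> Q p)"
  proof clarify
    fix I J assume IJ: "I \<in> P" "J \<in> P" "2 \<le> card (I \<inter> J)"
    then obtain T where "T \<subseteq> I \<inter> J" "card T = 2" "finite T"
      using obtain_subset_with_card_n by metis
    then obtain a b where "a \<noteq> b" "{a, b} \<subseteq> I \<inter> J" by (auto simp: card_2_iff)
    then show "(I, J) \<in> (\<Union>p\<in>D. Q p \<times> Q p)"
      using IJ by (intro UN_I[of "(a, b)"]) (auto simp: P_def D_def Q_def)
  qed
  then have "card ?R \<le> card (\<Union>p\<in>D. Q p \<times> Q p)"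
    using finD finQ by (intro card_mono) auto
  also have "\<dots> \<le> (\<Sum>p\<in>D. card (Q p \<times> Q p))" by (rule card_UN_le[OF finD])
  also have "\<dots> \<le> (\<Sum>p\<in>D. n ^ (j - 2) * n ^ (j - 2))"
    using cardQ by (intro sum_mono) (auto simp: card_cartesian_product intro!: mult_mono)
  also have "\<dots> \<le> (n * n) * (n ^ (j - 2) * n ^ (j - 2))"
    using cardD by simp
  also have "\<dots> = n ^ (2 * j - 2)"
  proof -
    have "2 * j - 2 = 1 + (1 + ((j - 2) + (j - 2)))" using True by simp
    then show ?thesis by (simp only: power_add power_one_right mult.assoc)
  qed
  finally show ?thesis .
qed

text \<open>Up to \<open>1 / j!\<close> the quotient is the product of \<open>1 - i/n\<close> over
  \<open>i < j\<close>, which differs from 1 by order \<open>1/n\<close>; that beats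
  \<open>sqrt n\<close>. It permits centring at \<open>\<theta> / j!\<close> in place of the exact
  mean.\<close>

lemma binomial_over_power_rate:
  "(\<lambda>n. sqrt (real n) * (real (n choose j) / real n ^ j - 1 / fact j)) \<longlonglongrightarrow> 0"
proof -
  define p where "p k n = (\<Prod>i<k. 1 - real i / real n)" for k n
  have lim: "(\<lambda>n. sqrt (real n) * (p k n - 1)) \<longlonglongrightarrow> 0" for k
  proof (induction k)
    case (Suc k)
    have inv: "(\<lambda>n. sqrt (real n) / real n) \<longlonglongrightarrow> 0"
      by real_asymp
    have 1: "(\<lambda>n. real k / real n) \<longlonglongrightarrow> 0" by real_asymp
    \<comment> \<open>From \<open>p (k+1) - 1 = (p k - 1) (1 - k/n) - k/n\<close>.\<close>
    have "(\<lambda>n. sqrt (real n) * (p k n - 1) * (1 - real k / real n) - real k * (sqrt (real n) / real n)) \<longlonglongrightarrow> 0 * (1 - 0) - real k * 0"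
      by (intro tendsto_intros Suc.IH inv 1)
    moreover have "sqrt (real n) * (p (Suc k) n - 1) =
        sqrt (real n) * (p k n - 1) * (1 - real k / real n) - real k * (sqrt (real n) / real n)" for n
      by (simp add: p_def algebra_simps)
    ultimately show ?case by simp
  qed (simp add: p_def)
  have "real (n choose j) / real n ^ j = p j n / fact j" if "n > 0" for n
  proof -
    have "real (n choose j) = (\<Prod>i<j. real n - real i) / fact j"
      by (simp add: binomial_gbinomial gbinomial_prod_rev atLeast0LessThan)
    also have "(\<Prod>i<j. real n - real i) = (\<Prod>i<j. real n * (1 - real i / real n))"
      using that by (intro prod.cong) (auto simp: field_simps)
    also have "\<dots> = real n ^ j * p j n" by (simp add: prod.distrib p_def)
    finally show ?thesis using that by simp
  qed
  then have "\<forall>\<^sub>F n in sequentially. sqrt (real n) * (p j n - 1) / fact j =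
      sqrt (real n) * (real (n choose j) / real n ^ j - 1 / fact j)"
    by (intro eventually_sequentiallyI[of 1]) (auto simp: field_simps)
  moreover have "(\<lambda>n. sqrt (real n) * (p j n - 1) / fact j) \<longlonglongrightarrow> 0"
    using tendsto_divide[OF lim[of j] tendsto_const, of "fact j"] by simp
  ultimately show ?thesis by (rule Lim_transform_eventually[rotated])
qed

section \<open>Exchangeability and integration over blocks of an i.i.d. sequence\<close>

text \<open>The sample is indexed from 1 and nothing is known about \<open>Xs 0\<close>, hence the
  side conditions on indices throughout. \<open>X\<close> only provides the common law.\<close>

locale iid_sequence = prob_space M for M :: "'w measure" +
  fixes X :: "'w \<Rightarrow> 'a::euclidean_space" and Xs :: "nat \<Rightarrow> 'w \<Rightarrow> 'a"
  assumes X_measurable [measurable]: "X \<in> borel_measurable M"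
    and Xs_indep: "indep_vars (\<lambda>_. borel) Xs {1..}"
    and Xs_distr: "i \<ge> 1 \<Longrightarrow> distr M borel (Xs i) = distr M borel X"
begin

lemma Xs_measurable [measurable (raw)]: "i \<ge> 1 \<Longrightarrow> Xs i \<in> borel_measurable M"
  using Xs_indep unfolding indep_vars_def2 by simp

lemma integral_Xs:
  fixes F :: "'a \<Rightarrow> real"
  assumes [measurable]: "F \<in> borel_measurable borel" and i: "i \<ge> 1"
  shows "expectation (\<lambda>\<omega>. F (Xs i \<omega>)) = expectation (\<lambda>\<omega>. F (X \<omega>))"
proof -
  have "expectation (\<lambda>\<omega>. F (Xs i \<omega>)) = integral\<^sup>L (distr M borel (Xs i)) F"
    using i by (subst integral_distr) auto
  also have "\<dots> = expectation (\<lambda>\<omega>. F (X \<omega>))"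
    using i by (simp add: Xs_distr integral_distr)
  finally show ?thesis .
qed

lemma integrable_Xs:
  fixes F :: "'a \<Rightarrow> real"
  assumes [measurable]: "F \<in> borel_measurable borel" and i: "i \<ge> 1"
  shows "integrable M (\<lambda>\<omega>. F (Xs i \<omega>)) \<longleftrightarrow> integrable M (\<lambda>\<omega>. F (X \<omega>))"
proof -
  have "integrable M (\<lambda>\<omega>. F (Xs i \<omega>)) \<longleftrightarrow> integrable (distr M borel (Xs i)) F"
    using i by (subst integrable_distr_eq) auto
  also have "\<dots> \<longleftrightarrow> integrable M (\<lambda>\<omega>. F (X \<omega>))"
    using i by (simp add: Xs_distr integrable_distr_eq)
  finally show ?thesis .
qed

text \<open>The whole sequence has a power of the common law as its joint law, and injectively
  selecting coordinates maps such a power to a power again.\<close>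

lemma distr_Xs_reindex:
  assumes t: "inj_on t I" "t ` I \<subseteq> {1..}"
  shows "distr M (PiM I (\<lambda>_. borel)) (\<lambda>\<omega>. \<lambda>i\<in>I. Xs (t i) \<omega>) = PiM I (\<lambda>_. distr M borel X)"
proof -
  let ?\<mu> = "distr M borel X"
  have \<mu>: "prob_space ?\<mu>" by (rule prob_space_distr) simp
  have meas: "(\<lambda>\<omega>. \<lambda>i\<in>{1..}. Xs i \<omega>) \<in> measurable M (PiM {1..} (\<lambda>_. borel))"
    by (intro measurable_restrict Xs_measurable) auto
  have sets: "sets (PiM I (\<lambda>_. ?\<mu>)) = sets (PiM I (\<lambda>_. borel))"
    by (rule sets_PiM_cong) simp_all
  have "distr M (PiM {1..} (\<lambda>_. borel)) (\<lambda>\<omega>. \<lambda>i\<in>{1..}. Xs i \<omega>) = PiM {1..} (\<lambda>i. distr M borel (Xs i))"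
    using Xs_indep by (subst (asm) indep_vars_iff_distr_eq_PiM') auto
  also have "\<dots> = PiM {1..} (\<lambda>_. ?\<mu>)"
    by (intro PiM_cong) (auto simp: Xs_distr)
  finally have all: "distr M (PiM {1..} (\<lambda>_. borel)) (\<lambda>\<omega>. \<lambda>i\<in>{1..}. Xs i \<omega>) = PiM {1..} (\<lambda>_. ?\<mu>)" .
  have "PiM I (\<lambda>_. ?\<mu>) = distr (PiM {1..} (\<lambda>_. ?\<mu>)) (PiM I (\<lambda>_. ?\<mu>)) (\<lambda>x. \<lambda>n\<in>I. x (t n))"
    using t \<mu> by (intro distr_PiM_reindex[symmetric]) auto
  also have "\<dots> = distr (PiM {1..} (\<lambda>_. ?\<mu>)) (PiM I (\<lambda>_. borel)) (\<lambda>x. \<lambda>n\<in>I. x (t n))"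
    by (intro distr_cong refl sets)
  also have "\<dots> = distr M (PiM I (\<lambda>_. borel)) ((\<lambda>x. \<lambda>n\<in>I. x (t n)) \<circ> (\<lambda>\<omega>. \<lambda>i\<in>{1..}. Xs i \<omega>))"
  proof (unfold all[symmetric], rule distr_distr[OF _ meas])
    show "(\<lambda>x. \<lambda>n\<in>I. x (t n)) \<in> measurable (PiM {1..} (\<lambda>_. borel)) (PiM I (\<lambda>_. borel))"
      using t by (intro measurable_restrict measurable_component_singleton) auto
  qed
  also have "\<dots> = distr M (PiM I (\<lambda>_. borel)) (\<lambda>\<omega>. \<lambda>i\<in>I. Xs (t i) \<omega>)"
    using t by (intro distr_cong refl) (auto simp: fun_eq_iff restrict_def)
  finally show ?thesis by simp
qed

text \<open>Exchangeability in integrated form: both sides are the integral of \<open>G\<close>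
  against the same product measure over \<open>I\<close>.\<close>

lemma integral_Xs_reindex:
  fixes G :: "(nat \<Rightarrow> 'a) \<Rightarrow> real"
  assumes "inj_on t I" "t ` I \<subseteq> {1..}" "I \<subseteq> {1..}"
    and G: "G \<in> borel_measurable (PiM UNIV (\<lambda>_. borel))"
    and cong: "\<And>x y. (\<And>i. i \<in> I \<Longrightarrow> x i = y i) \<Longrightarrow> G x = G y"
  shows "expectation (\<lambda>\<omega>. G (\<lambda>i. Xs (t i) \<omega>)) = expectation (\<lambda>\<omega>. G (\<lambda>i. Xs i \<omega>))"
proof -
  \<comment> \<open>Coordinates outside \<open>I\<close> are filled with 0, which \<open>G\<close>
    does not see; this turns \<open>G\<close> into a measurable function on the product over
    \<open>I\<close>.\<close>
  define E where "E x i = (if i \<in> I then x i else 0)" for x :: "nat \<Rightarrow> 'a" and i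
  have "E \<in> measurable (PiM I (\<lambda>_. borel)) (PiM UNIV (\<lambda>_. borel))"
  proof (rule measurable_PiM_single')
    show "(\<lambda>x. E x i) \<in> borel_measurable (PiM I (\<lambda>_. borel))" for i
      by (cases "i \<in> I") (auto simp: E_def)
  qed (auto simp: space_PiM)
  then have GE: "(\<lambda>x. G (E x)) \<in> borel_measurable (PiM I (\<lambda>_. borel))"
    using G by (rule measurable_compose)
  have *: "expectation (\<lambda>\<omega>. G (\<lambda>i. Xs (s i) \<omega>)) =
      (\<integral>x. G (E x) \<partial>PiM I (\<lambda>_. distr M borel X))" if "inj_on s I" "s ` I \<subseteq> {1..}" for s
  proof -
    have "(\<integral>x. G (E x) \<partial>PiM I (\<lambda>_. distr M borel X)) = expectation (\<lambda>\<omega>. G (E (\<lambda>i\<in>I. Xs (s i) \<omega>)))"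
      unfolding distr_Xs_reindex[OF that, symmetric]
      using that by (intro integral_distr GE measurable_restrict Xs_measurable) auto
    also have "\<dots> = expectation (\<lambda>\<omega>. G (\<lambda>i. Xs (s i) \<omega>))"
      by (intro Bochner_Integration.integral_cong cong) (auto simp: E_def)
    finally show ?thesis by simp
  qed
  have "expectation (\<lambda>\<omega>. G (\<lambda>i. Xs i \<omega>)) = (\<integral>x. G (E x) \<partial>PiM I (\<lambda>_. distr M borel X))"
    by (rule *) (use assms(3) in auto)
  then show ?thesis using *[OF assms(1,2)] by (simp only:)
qed

text \<open>Disjoint blocks of variables are independent, so Fubini applies. The inner integral is
  the conditional expectation given the variables of block \<open>A\<close>.\<close>

lemma integral_Xs_blocks:
  fixes F :: "(nat \<Rightarrow> 'a) \<Rightarrow> real"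
  assumes AB: "A \<inter> B = {}" "A \<subseteq> {1..}" "B \<subseteq> {1..}"
    and F: "F \<in> borel_measurable (PiM UNIV (\<lambda>_. borel))"
    and cong: "\<And>x y. (\<And>i. i \<in> A \<union> B \<Longrightarrow> x i = y i) \<Longrightarrow> F x = F y"
    and int: "integrable M (\<lambda>\<omega>. F (\<lambda>i. Xs i \<omega>))"
  shows "expectation (\<lambda>\<omega>. F (\<lambda>i. Xs i \<omega>)) =
    expectation (\<lambda>\<omega>. expectation (\<lambda>\<omega>'. F (\<lambda>i. if i \<in> A then Xs i \<omega> else Xs i \<omega>')))"
proof -
  define E :: "(nat \<Rightarrow> 'a) \<times> (nat \<Rightarrow> 'a) \<Rightarrow> nat \<Rightarrow> 'a"
    where "E p i = (if i \<in> A then fst p i else if i \<in> B then snd p i else 0)" for p i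
  let ?Y = "\<lambda>S \<omega>. \<lambda>i\<in>S. Xs i \<omega>"
  have "E \<in> measurable (PiM A (\<lambda>_. borel) \<Otimes>\<^sub>M PiM B (\<lambda>_. borel)) (PiM UNIV (\<lambda>_. borel))"
  proof (rule measurable_PiM_single')
    show "(\<lambda>p. E p i) \<in> borel_measurable (PiM A (\<lambda>_. borel) \<Otimes>\<^sub>M PiM B (\<lambda>_. borel))" for i
      by (cases "i \<in> A"; cases "i \<in> B") (auto simp: E_def)
  qed (auto simp: space_PiM)
  then have FE: "(\<lambda>p. F (E p)) \<in> borel_measurable (PiM A (\<lambda>_. borel) \<Otimes>\<^sub>M PiM B (\<lambda>_. borel))"
    using F by (rule measurable_compose)
  have eq: "F (E (?Y A \<omega>, ?Y B \<omega>')) = F (\<lambda>i. if i \<in> A then Xs i \<omega> else Xs i \<omega>')" for \<omega> \<omega>'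
    by (rule cong) (auto simp: E_def)
  have "indep_var (PiM A (\<lambda>_. borel)) (?Y A) (PiM B (\<lambda>_. borel)) (?Y B)"
    by (rule indep_var_restrict[OF Xs_indep]) (use AB in auto)
  from indep_var_integral_iterated[OF this FE] int show ?thesis
    by (simp only: eq if_cancel)
qed

text \<open>By independence the \<open>m\<close>-th moment of the product factorises, so no moment
  of \<open>X\<close> beyond the \<open>m\<close>-th is asked for.\<close>

lemma integrable_prod_norm:
  assumes "finite I" "I \<subseteq> {1..}" "integrable M (\<lambda>\<omega>. norm (X \<omega>) ^ m)"
  shows "integrable M (\<lambda>\<omega>. (\<Prod>i\<in>I. norm (Xs i \<omega>)) ^ m)"
proof -
  have "indep_vars (\<lambda>_. borel) (\<lambda>i \<omega>. norm (Xs i \<omega>) ^ m) I"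
    by (rule indep_vars_compose2[OF indep_vars_subset[OF Xs_indep assms(2)]]) auto
  moreover have "integrable M (\<lambda>\<omega>. norm (Xs i \<omega>) ^ m)" if "i \<in> I" for i
    using that assms integrable_Xs[of "\<lambda>x. norm x ^ m" i] by auto
  ultimately show ?thesis
    using indep_vars_integrable[OF assms(1), of "\<lambda>i \<omega>. norm (Xs i \<omega>) ^ m"]
    by (simp add: prod_power_distrib)
qed

end

section \<open>Hoeffding projection of a symmetric kernel\<close>

text \<open>The kernel takes the whole sequence together with an index set. \<open>k_cong\<close>
  says that it sees only the coordinates in that set, and \<open>k_reindex\<close> expresses
  symmetry, so no ordering of arguments has to be tracked.\<close>

locale product_bounded_kernel = iid_sequence M X Xs
  for M :: "'w measure" and X :: "'w \<Rightarrow> 'a::euclidean_space" and Xs +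
  fixes k :: "(nat \<Rightarrow> 'a) \<Rightarrow> nat set \<Rightarrow> real" and j :: nat and C :: real
  assumes X_square_integrable: "integrable M (\<lambda>\<omega>. (norm (X \<omega>))\<^sup>2)"
    and j: "1 \<le> j" and C: "0 \<le> C"
    and k_reindex: "inj_on t I \<Longrightarrow> k x (t ` I) = k (\<lambda>i. x (t i)) I"
    and k_cong: "(\<And>i. i \<in> I \<Longrightarrow> x i = y i) \<Longrightarrow> k x I = k y I"
    and k_measurable_PiM: "(\<lambda>x. k x I) \<in> borel_measurable (PiM UNIV (\<lambda>_. borel))"
    and k_bound: "finite I \<Longrightarrow> card I = j \<Longrightarrow> \<bar>k x I\<bar> \<le> C * (\<Prod>i\<in>I. norm (x i))"
begin

definition mean :: real where
  "mean = expectation (\<lambda>\<omega>. k (\<lambda>i. Xs i \<omega>) {1..j})"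

text \<open>The first-order Hoeffding projection: the conditional expectation of the kernel given
  that its first argument is \<open>x\<close>.\<close>

definition proj :: "'a \<Rightarrow> real" where
  "proj x = expectation (\<lambda>\<omega>. k ((\<lambda>i. Xs i \<omega>)(1 := x)) {1..j})"

definition centred :: "'a \<Rightarrow> real" where
  "centred x = proj x - mean"

text \<open>All terms of order at least 2 in the Hoeffding decomposition, kept together, since only
  their total second moment matters.\<close>

definition residual :: "(nat \<Rightarrow> 'a) \<Rightarrow> nat set \<Rightarrow> real" where
  "residual x I = k x I - mean - (\<Sum>i\<in>I. centred (x i))"

text \<open>Coordinates outside \<open>I\<close> are overwritten by 0, so nothing need be known
  about them; in particular \<open>Xs 0\<close> does no harm.\<close>

lemma k_measurable:
  assumes "\<And>i. i \<in> I \<Longrightarrow> (\<lambda>\<omega>. Y \<omega> i) \<in> borel_measurable N"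
  shows "(\<lambda>\<omega>. k (Y \<omega>) I) \<in> borel_measurable N"
proof -
  have "(\<lambda>\<omega> i. if i \<in> I then Y \<omega> i else 0) \<in> measurable N (PiM UNIV (\<lambda>_. borel))"
  proof (rule measurable_PiM_single')
    show "(\<lambda>\<omega>. if i \<in> I then Y \<omega> i else 0) \<in> borel_measurable N" for i
      using assms by (cases "i \<in> I") auto
  qed auto
  then have "(\<lambda>\<omega>. k (\<lambda>i. if i \<in> I then Y \<omega> i else 0) I) \<in> borel_measurable N"
    using k_measurable_PiM by (rule measurable_compose)
  also have "(\<lambda>\<omega>. k (\<lambda>i. if i \<in> I then Y \<omega> i else 0) I) = (\<lambda>\<omega>. k (Y \<omega>) I)"
    by (intro ext k_cong) simp
  finally show ?thesis .
qed

lemma k_Xs_measurable: "I \<subseteq> {1..} \<Longrightarrow> (\<lambda>\<omega>. k (\<lambda>i. Xs i \<omega>) I) \<in> borel_measurable M"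
  by (intro k_measurable Xs_measurable) auto

lemma X_integrable: "integrable M X"
proof -
  have "integrable M (\<lambda>\<omega>. norm (X \<omega>))"
    by (rule square_integrable_imp_integrable) (use X_square_integrable in auto)
  then show ?thesis by (subst (asm) integrable_norm_iff) auto
qed

lemma k_square_integrable:
  assumes I: "finite I" "I \<subseteq> {1..}" "card I = j"
  shows "integrable M (\<lambda>\<omega>. (k (\<lambda>i. Xs i \<omega>) I)\<^sup>2)"
proof (rule Bochner_Integration.integrable_bound)
  show "integrable M (\<lambda>\<omega>. C\<^sup>2 * (\<Prod>i\<in>I. norm (Xs i \<omega>))\<^sup>2)"
    using integrable_prod_norm[OF I(1,2), of 2] X_square_integrable by simp
  show "AE \<omega> in M. norm ((k (\<lambda>i. Xs i \<omega>) I)\<^sup>2) \<le> norm (C\<^sup>2 * (\<Prod>i\<in>I. norm (Xs i \<omega>))\<^sup>2)"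
  proof (intro AE_I2)
    fix \<omega>
    have "\<bar>k (\<lambda>i. Xs i \<omega>) I\<bar>\<^sup>2 \<le> (C * (\<Prod>i\<in>I. norm (Xs i \<omega>)))\<^sup>2"
      using I by (intro power_mono k_bound) auto
    then show "norm ((k (\<lambda>i. Xs i \<omega>) I)\<^sup>2) \<le> norm (C\<^sup>2 * (\<Prod>i\<in>I. norm (Xs i \<omega>))\<^sup>2)"
      by (simp add: power_mult_distrib)
  qed
  show "(\<lambda>\<omega>. (k (\<lambda>i. Xs i \<omega>) I)\<^sup>2) \<in> borel_measurable M"
    using k_Xs_measurable[OF I(2)] by measurable
qed

lemma k_upd_bound:
  assumes I: "finite I" "card I = j" "i \<in> I"
  shows "\<bar>k ((\<lambda>m. Xs m \<omega>)(i := x)) I\<bar> \<le> C * norm x * (\<Prod>m\<in>I - {i}. norm (Xs m \<omega>))"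
proof -
  have "\<bar>k ((\<lambda>m. Xs m \<omega>)(i := x)) I\<bar> \<le> C * (\<Prod>m\<in>I. norm (((\<lambda>m. Xs m \<omega>)(i := x)) m))"
    using I by (intro k_bound) auto
  also have "(\<Prod>m\<in>I. norm (((\<lambda>m. Xs m \<omega>)(i := x)) m)) = norm x * (\<Prod>m\<in>I - {i}. norm (Xs m \<omega>))"
    using I by (subst prod.remove[OF I(1,3)]) (auto intro!: prod.cong)
  finally show ?thesis by (simp only: mult.assoc)
qed

lemma k_upd_integrable:
  assumes I: "finite I" "I \<subseteq> {1..}" "card I = j" "i \<in> I"
  shows "integrable M (\<lambda>\<omega>. k ((\<lambda>m. Xs m \<omega>)(i := x)) I)"
proof (rule Bochner_Integration.integrable_bound)
  show "integrable M (\<lambda>\<omega>. C * norm x * (\<Prod>m\<in>I - {i}. norm (Xs m \<omega>)))"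
    using integrable_prod_norm[of "I - {i}" 1] X_integrable I by (auto intro!: integrable_mult_right)
  show "AE \<omega> in M. norm (k ((\<lambda>m. Xs m \<omega>)(i := x)) I) \<le> norm (C * norm x * (\<Prod>m\<in>I - {i}. norm (Xs m \<omega>)))"
    using k_upd_bound[OF I(1,3,4)] C by (intro AE_I2) (auto simp: abs_mult prod_nonneg)
  show "(\<lambda>\<omega>. k ((\<lambda>m. Xs m \<omega>)(i := x)) I) \<in> borel_measurable M"
    using I by (intro k_measurable) (auto simp: fun_upd_apply intro: Xs_measurable)
qed

text \<open>By symmetry it is immaterial which set \<open>I\<close> is taken and which of its
  indices is frozen. The bijection \<open>t\<close> from \<open>{1..j}\<close> to \<open>I\<close>
  sends 1 to \<open>i\<close>; the remaining variables are exchanged by equality of joint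
  laws.\<close>

lemma expectation_k_upd:
  assumes I: "finite I" "I \<subseteq> {1..}" "card I = j" "i \<in> I"
  shows "expectation (\<lambda>\<omega>. k ((\<lambda>m. Xs m \<omega>)(i := x)) I) = proj x"
proof -
  have "card {2..j} = card (I - {i})" using I j by simp
  then obtain s where s: "bij_betw s {2..j} (I - {i})"
    using finite_same_card_bij[of "{2..j}" "I - {i}"] I by auto
  define t where "t = s(1 := i)"
  have ins: "{1..j} = insert 1 {2..j}" using j by auto
  have t: "inj_on t {1..j}" "t ` {1..j} = I" "t 1 = i"
  proof -
    have "t ` {2..j} = s ` {2..j}" by (intro image_cong) (auto simp: t_def)
    moreover have "t ` {1..j} = insert (t 1) (t ` {2..j})" by (simp only: ins image_insert)
    ultimately have "t ` {1..j} = insert i (I - {i})"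
      using s by (simp add: bij_betw_def t_def)
    then show "t ` {1..j} = I" using I(4) by auto
    show "inj_on t {1..j}" using s unfolding ins t_def
      by (auto simp: bij_betw_def inj_on_def)
  qed (simp add: t_def)
  have "{2..j} \<subseteq> {1..j}" by auto
  then have t2: "inj_on t {2..j}" "t ` {2..j} \<subseteq> {1..}"
    using inj_on_subset[OF t(1)] image_mono[of "{2..j}" "{1..j}" t] t(2) I(2) by auto
  have "k ((\<lambda>m. Xs m \<omega>)(i := x)) I = k ((\<lambda>m. Xs (t m) \<omega>)(1 := x)) {1..j}" for \<omega>
  proof -
    have "k ((\<lambda>m. Xs m \<omega>)(i := x)) I = k (\<lambda>m. ((\<lambda>m. Xs m \<omega>)(i := x)) (t m)) {1..j}"
      using k_reindex[OF t(1), of "(\<lambda>m. Xs m \<omega>)(i := x)"] by (simp only: t(2))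
    also have "\<dots> = k ((\<lambda>m. Xs (t m) \<omega>)(1 := x)) {1..j}"
    proof (rule k_cong)
      fix m assume m: "m \<in> {1..j}"
      show "((\<lambda>m. Xs m \<omega>)(i := x)) (t m) = ((\<lambda>m. Xs (t m) \<omega>)(1 := x)) m"
      proof (cases "m = 1")
        case False
        then have "t m \<noteq> i" using inj_onD[OF t(1), of m 1] m t(3) j by force
        then show ?thesis using False by simp
      qed (use t(3) in simp)
    qed
    finally show ?thesis .
  qed
  moreover have "expectation (\<lambda>\<omega>. k ((\<lambda>m. Xs (t m) \<omega>)(1 := x)) {1..j}) = proj x"
    unfolding proj_def
  proof (rule integral_Xs_reindex[where I = "{2..j}" and G = "\<lambda>y. k (y(1 := x)) {1..j}"])
    show "(\<lambda>y. k (y(1 := x)) {1..j}) \<in> borel_measurable (PiM UNIV (\<lambda>_. borel))"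
      by (rule k_measurable) (auto simp: fun_upd_apply)
    show "k (y(1 := x)) {1..j} = k (z(1 := x)) {1..j}" if "\<And>i. i \<in> {2..j} \<Longrightarrow> y i = z i" for y z
      using that by (intro k_cong) auto
  qed (use t2 in auto)
  ultimately show ?thesis by simp
qed

lemma proj_measurable [measurable]: "proj \<in> borel_measurable borel"
proof -
  have "(\<lambda>p. k ((\<lambda>i. Xs i (snd p))(1 := fst p)) {1..j}) \<in> borel_measurable (borel \<Otimes>\<^sub>M M)"
  proof (rule k_measurable)
    fix i assume "i \<in> {1..j}"
    then have [measurable]: "Xs i \<in> borel_measurable M" by (intro Xs_measurable) auto
    show "(\<lambda>p. ((\<lambda>i. Xs i (snd p))(1 := fst p)) i) \<in> borel_measurable (borel \<Otimes>\<^sub>M M)"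
      by (cases "i = 1") auto
  qed
  then have "(\<lambda>x. expectation (\<lambda>\<omega>. k ((\<lambda>i. Xs i \<omega>)(1 := x)) {1..j})) \<in> borel_measurable borel"
    by (intro borel_measurable_lebesgue_integral) (simp add: case_prod_unfold)
  then show ?thesis by (simp add: proj_def[abs_def])
qed

lemma centred_measurable [measurable]: "centred \<in> borel_measurable borel"
  unfolding centred_def[abs_def] by measurable

text \<open>Integrating out all but one argument in the product bound gives
  \<open>\<bar>proj x\<bar> \<le> D * norm x\<close>, so the second moment of \<open>X\<close> is
  enough.\<close>

lemma centred_square_integrable:
  assumes i: "1 \<le> i"
  shows "integrable M (\<lambda>\<omega>. (centred (Xs i \<omega>))\<^sup>2)"
proof -
  define D where "D = C * expectation (\<lambda>\<omega>. \<Prod>m\<in>{1..j} - {1}. norm (Xs m \<omega>))"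
  have int: "integrable M (\<lambda>\<omega>. \<Prod>m\<in>{1..j} - {1}. norm (Xs m \<omega>))"
  proof -
    have "{1..j} - {1} \<subseteq> {1..}" by auto
    then show ?thesis using integrable_prod_norm[of "{1..j} - {1}" 1] X_integrable by simp
  qed
  have bound: "\<bar>proj x\<bar> \<le> D * norm x" for x
  proof -
    have "\<bar>proj x\<bar> \<le> expectation (\<lambda>\<omega>. \<bar>k ((\<lambda>i. Xs i \<omega>)(1 := x)) {1..j}\<bar>)"
      unfolding proj_def by (rule integral_abs_bound)
    also have "\<dots> \<le> expectation (\<lambda>\<omega>. C * norm x * (\<Prod>m\<in>{1..j} - {1}. norm (Xs m \<omega>)))"
    proof (rule integral_mono)
      show "integrable M (\<lambda>\<omega>. \<bar>k ((\<lambda>i. Xs i \<omega>)(1 := x)) {1..j}\<bar>)"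
        using j by (intro integrable_abs k_upd_integrable) auto
      show "integrable M (\<lambda>\<omega>. C * norm x * (\<Prod>m\<in>{1..j} - {1}. norm (Xs m \<omega>)))"
        using int by (intro integrable_mult_right) auto
    qed (use j k_upd_bound[of "{1..j}" 1] in auto)
    also have "\<dots> = D * norm x" by (simp add: D_def)
    finally show ?thesis .
  qed
  have "integrable M (\<lambda>\<omega>. (proj (X \<omega>))\<^sup>2)"
  proof (rule Bochner_Integration.integrable_bound)
    show "integrable M (\<lambda>\<omega>. D\<^sup>2 * (norm (X \<omega>))\<^sup>2)" using X_square_integrable by simp
    show "AE \<omega> in M. norm ((proj (X \<omega>))\<^sup>2) \<le> norm (D\<^sup>2 * (norm (X \<omega>))\<^sup>2)"
    proof (intro AE_I2)
      fix \<omega>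
      show "norm ((proj (X \<omega>))\<^sup>2) \<le> norm (D\<^sup>2 * (norm (X \<omega>))\<^sup>2)"
        using power_mono[OF bound[of "X \<omega>"], of 2] by (simp add: power_mult_distrib)
    qed
  qed measurable
  then have "integrable M (\<lambda>\<omega>. (proj (X \<omega>) + (- mean))\<^sup>2)"
    by (intro square_integrable_add) auto
  then have "integrable M (\<lambda>\<omega>. (centred (X \<omega>))\<^sup>2)" by (simp add: centred_def)
  then show ?thesis using i by (subst integrable_Xs) auto
qed

lemma centred_integrable: "1 \<le> i \<Longrightarrow> integrable M (\<lambda>\<omega>. centred (Xs i \<omega>))"
  by (rule square_integrable_imp_integrable) (auto intro: centred_square_integrable)

text \<open>Tower property: integrating out \<open>{2..j}\<close> first and then the variable 1
  shows that \<open>proj\<close> has expectation \<open>mean\<close>. Equality of laws carries this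
  to every index.\<close>

lemma expectation_centred:
  assumes i: "1 \<le> i"
  shows "expectation (\<lambda>\<omega>. centred (Xs i \<omega>)) = 0"
proof -
  have int: "integrable M (\<lambda>\<omega>. k (\<lambda>i. Xs i \<omega>) {1..j})"
    by (rule square_integrable_imp_integrable)
      (auto intro!: k_square_integrable k_Xs_measurable)
  have "mean = expectation (\<lambda>\<omega>. expectation (\<lambda>\<omega>'. k (\<lambda>i. if i \<in> {1} then Xs i \<omega> else Xs i \<omega>') {1..j}))"
    unfolding mean_def
  proof (rule integral_Xs_blocks[where B = "{2..j}"])
    show "k x {1..j} = k y {1..j}" if "\<And>i. i \<in> {1} \<union> {2..j} \<Longrightarrow> x i = y i" for x y
    proof -
      have U: "{1..j} = {1} \<union> {2..j}" using j by auto
      show ?thesis unfolding U by (rule k_cong) (rule that)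
    qed
    show "integrable M (\<lambda>\<omega>. k (\<lambda>i. Xs i \<omega>) {1..j})" by (rule int)
  qed (auto simp: k_measurable_PiM)
  also have "\<dots> = expectation (\<lambda>\<omega>. proj (Xs 1 \<omega>))"
    unfolding proj_def by (intro Bochner_Integration.integral_cong refl k_cong) auto
  finally have mean_eq: "mean = expectation (\<lambda>\<omega>. proj (Xs 1 \<omega>))" .
  have "integrable M (\<lambda>\<omega>. centred (Xs 1 \<omega>) + mean)"
    by (intro Bochner_Integration.integrable_add centred_integrable) auto
  then have "integrable M (\<lambda>\<omega>. proj (Xs 1 \<omega>))" by (simp add: centred_def)
  then have "expectation (\<lambda>\<omega>. centred (Xs 1 \<omega>)) = expectation (\<lambda>\<omega>. proj (Xs 1 \<omega>)) - mean"
    by (simp add: centred_def prob_space)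
  then have "expectation (\<lambda>\<omega>. centred (Xs 1 \<omega>)) = 0" using mean_eq by simp
  then show ?thesis
    using integral_Xs[of centred 1] integral_Xs[of centred i] i by simp
qed

lemma residual_cong: "(\<And>i. i \<in> I \<Longrightarrow> x i = y i) \<Longrightarrow> residual x I = residual y I"
  unfolding residual_def using k_cong[of I x y] by simp

lemma residual_measurable:
  assumes "\<And>i. i \<in> I \<Longrightarrow> (\<lambda>\<omega>. Y \<omega> i) \<in> borel_measurable N"
  shows "(\<lambda>\<omega>. residual (Y \<omega>) I) \<in> borel_measurable N"
  unfolding residual_def using assms
  by (intro borel_measurable_diff borel_measurable_sum k_measurable
      measurable_compose[OF _ centred_measurable] borel_measurable_const) auto

lemma residual_square_integrable:
  assumes I: "finite I" "I \<subseteq> {1..}" "card I = j"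
  shows "integrable M (\<lambda>\<omega>. (residual (\<lambda>i. Xs i \<omega>) I)\<^sup>2)"
proof -
  have meas: "(\<lambda>\<omega>. centred (Xs i \<omega>)) \<in> borel_measurable M" if "i \<in> I" for i
    using that I by (intro measurable_compose[OF _ centred_measurable] Xs_measurable) auto
  have "integrable M (\<lambda>\<omega>. (centred (Xs i \<omega>))\<^sup>2)" if "i \<in> I" for i
    using that I(2) by (intro centred_square_integrable) auto
  then have "integrable M (\<lambda>\<omega>. (\<Sum>i\<in>I. - centred (Xs i \<omega>))\<^sup>2)"
    using meas by (intro square_integrable_sum) simp_all
  then have "integrable M (\<lambda>\<omega>. ((k (\<lambda>i. Xs i \<omega>) I + (- mean)) + (\<Sum>i\<in>I. - centred (Xs i \<omega>)))\<^sup>2)"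
    using I meas k_square_integrable[OF I]
    by (intro square_integrable_add borel_measurable_add k_Xs_measurable borel_measurable_sum) auto
  then show ?thesis by (simp add: residual_def sum_negf)
qed

lemma residual_second_moment:
  assumes I: "finite I" "I \<subseteq> {1..}" "card I = j"
  shows "expectation (\<lambda>\<omega>. (residual (\<lambda>i. Xs i \<omega>) I)\<^sup>2) =
    expectation (\<lambda>\<omega>. (residual (\<lambda>i. Xs i \<omega>) {1..j})\<^sup>2)"
proof -
  obtain t where t: "bij_betw t {1..j} I"
    using finite_same_card_bij[of "{1..j}" I] I by auto
  then have inj: "inj_on t {1..j}" "t ` {1..j} = I" by (auto simp: bij_betw_def)
  have "residual x I = residual (\<lambda>i. x (t i)) {1..j}" for x
    using k_reindex[OF inj(1), of x, unfolded inj(2)]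
      sum.reindex[OF inj(1), of "\<lambda>i. centred (x i)", unfolded inj(2)]
    by (simp add: residual_def)
  moreover have "expectation (\<lambda>\<omega>. (residual (\<lambda>i. Xs (t i) \<omega>) {1..j})\<^sup>2) =
      expectation (\<lambda>\<omega>. (residual (\<lambda>i. Xs i \<omega>) {1..j})\<^sup>2)"
  proof (rule integral_Xs_reindex[where I = "{1..j}" and G = "\<lambda>y. (residual y {1..j})\<^sup>2"])
    show "(\<lambda>y. (residual y {1..j})\<^sup>2) \<in> borel_measurable (PiM UNIV (\<lambda>_. borel))"
      by (intro borel_measurable_power residual_measurable) auto
    show "(residual y {1..j})\<^sup>2 = (residual z {1..j})\<^sup>2" if "\<And>i. i \<in> {1..j} \<Longrightarrow> y i = z i" for y z
      using residual_cong[of "{1..j}" y z] that by simp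
  qed (use inj I in auto)
  ultimately show ?thesis by simp
qed

text \<open>If \<open>I \<inter> J \<subseteq> {i}\<close> with \<open>i \<in> I\<close>, then already the conditional expectation of the residual of
  \<open>I\<close> given the variables with index in \<open>insert i J\<close> vanishes.\<close>
lemma residual_orthogonal:
  assumes I: "finite I" "I \<subseteq> {1..}" "card I = j" and J: "finite J" "J \<subseteq> {1..}" "card J = j"
    and IJ: "card (I \<inter> J) < 2"
  shows "expectation (\<lambda>\<omega>. residual (\<lambda>i. Xs i \<omega>) I * residual (\<lambda>i. Xs i \<omega>) J) = 0"
proof -
  \<comment> \<open>The common index if there is one, otherwise any element of \<open>I\<close>,
    which is nonempty as \<open>1 \<le> j\<close>.\<close>
  obtain i where i: "i \<in> I" "I \<inter> J \<subseteq> {i}"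
  proof (cases "I \<inter> J = {}")
    case True
    then show ?thesis using that I j by (metis card.empty ex_in_conv empty_subsetI not_one_le_zero)
  next
    case False
    then have "card (I \<inter> J) = 1" using IJ I by (simp add: card_gt_0_iff less_2_cases_iff)
    then show ?thesis using that by (metis card_1_singletonE Int_iff insertI1 order_refl)
  qed
  \<comment> \<open>\<open>A\<close> is held fixed and \<open>B\<close> integrated out: the residual
    of \<open>J\<close> sees only \<open>A\<close>, and \<open>i\<close> is the only index of
    \<open>I\<close> in \<open>A\<close>.\<close>
  define A where "A = insert i J"
  define B where "B = I - {i}"
  have AB: "A \<inter> B = {}" "A \<subseteq> {1..}" "B \<subseteq> {1..}" "I \<subseteq> A \<union> B" "J \<subseteq> A" "i \<in> A" "I = insert i B" "i \<notin> B"
    using i I J by (auto simp: A_def B_def)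
  have finB: "finite B" using I by (simp add: B_def)
  let ?F = "\<lambda>x. residual x I * residual x J"
  let ?mix = "\<lambda>\<omega> \<omega>' m. if m \<in> A then Xs m \<omega> else Xs m \<omega>'"
  have "expectation (\<lambda>\<omega>. ?F (\<lambda>i. Xs i \<omega>)) = expectation (\<lambda>\<omega>. expectation (\<lambda>\<omega>'. ?F (?mix \<omega> \<omega>')))"
  proof (rule integral_Xs_blocks[OF AB(1-3)])
    show "?F \<in> borel_measurable (PiM UNIV (\<lambda>_. borel))"
      by (intro borel_measurable_times residual_measurable) auto
    show "?F x = ?F y" if "\<And>i. i \<in> A \<union> B \<Longrightarrow> x i = y i" for x y
      using residual_cong[of I x y] residual_cong[of J x y] that AB(4,5) by (simp add: subset_eq)
    show "integrable M (\<lambda>\<omega>. ?F (\<lambda>i. Xs i \<omega>))"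
      using I J by (intro square_integrable_mult residual_measurable residual_square_integrable Xs_measurable) auto
  qed
  also have "\<dots> = expectation (\<lambda>\<omega>. 0)"
  proof (intro Bochner_Integration.integral_cong refl)
    fix \<omega>
    \<comment> \<open>The \<open>mean\<close> in the residual of \<open>I\<close> cancels against
      the one inside \<open>centred (Xs i \<omega>)\<close>, leaving
      \<open>proj (Xs i \<omega>)\<close>.\<close>
    have "?F (?mix \<omega> \<omega>') = residual (\<lambda>m. Xs m \<omega>) J *
        (k ((\<lambda>m. Xs m \<omega>')(i := Xs i \<omega>)) I - proj (Xs i \<omega>) - (\<Sum>m\<in>B. centred (Xs m \<omega>')))" for \<omega>'
    proof -
      have "residual (?mix \<omega> \<omega>') J = residual (\<lambda>m. Xs m \<omega>) J"
        using AB(5) by (intro residual_cong) auto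
      moreover have "k (?mix \<omega> \<omega>') I = k ((\<lambda>m. Xs m \<omega>')(i := Xs i \<omega>)) I"
        using AB by (intro k_cong) auto
      moreover have "(\<Sum>m\<in>I. centred (?mix \<omega> \<omega>' m)) = centred (Xs i \<omega>) + (\<Sum>m\<in>B. centred (Xs m \<omega>'))"
      proof -
        have "(\<Sum>m\<in>B. centred (?mix \<omega> \<omega>' m)) = (\<Sum>m\<in>B. centred (Xs m \<omega>'))"
          using AB(1) by (intro sum.cong) auto
        then show ?thesis using AB(6,8) finB by (subst AB(7)) simp
      qed
      ultimately show ?thesis
        by (simp add: residual_def[of _ I] centred_def[of "Xs i \<omega>"])
    qed
    \<comment> \<open>The kernel with index \<open>i\<close> frozen has expectation
      \<open>proj\<close> at that value, and the other centred terms have mean 0.\<close>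
    moreover have "expectation (\<lambda>\<omega>'. k ((\<lambda>m. Xs m \<omega>')(i := Xs i \<omega>)) I - proj (Xs i \<omega>) -
        (\<Sum>m\<in>B. centred (Xs m \<omega>'))) = 0"
    proof -
      have B: "integrable M (\<lambda>\<omega>'. centred (Xs m \<omega>'))" "expectation (\<lambda>\<omega>'. centred (Xs m \<omega>')) = 0"
        if "m \<in> B" for m
      proof -
        have "1 \<le> m" using that AB(3) by auto
        then show "integrable M (\<lambda>\<omega>'. centred (Xs m \<omega>'))" "expectation (\<lambda>\<omega>'. centred (Xs m \<omega>')) = 0"
          by (rule centred_integrable, rule expectation_centred)
      qed
      then have "expectation (\<lambda>\<omega>'. \<Sum>m\<in>B. centred (Xs m \<omega>')) = 0"
        by (subst Bochner_Integration.integral_sum) auto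
      moreover have "integrable M (\<lambda>\<omega>'. \<Sum>m\<in>B. centred (Xs m \<omega>'))"
        using B by (intro Bochner_Integration.integrable_sum)
      ultimately show ?thesis
        using k_upd_integrable[OF I i(1), of "Xs i \<omega>"] expectation_k_upd[OF I i(1), of "Xs i \<omega>"]
        by (simp add: prob_space)
    qed
    ultimately show "expectation (\<lambda>\<omega>'. ?F (?mix \<omega> \<omega>')) = 0" by simp
  qed
  finally show ?thesis by simp
qed

end

section \<open>First absolute moments of centred sums and a weak law in mean\<close>

context iid_sequence
begin

text \<open>Shifts the sample to start at 0, the index set over which the central limit theorem for
  independent sums is formulated.\<close>

lemma indep_vars_Xs_Suc: "indep_vars (\<lambda>_. borel) (\<lambda>i. Xs (Suc i)) UNIV"
proof -
  have "distr M (PiM UNIV (\<lambda>_. borel)) (\<lambda>\<omega>. \<lambda>i\<in>UNIV. Xs (Suc i) \<omega>) = PiM UNIV (\<lambda>_. distr M borel X)"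
    by (rule distr_Xs_reindex) auto
  also have "\<dots> = PiM UNIV (\<lambda>i. distr M borel (Xs (Suc i)))"
    by (intro PiM_cong) (auto simp: Xs_distr)
  finally show ?thesis
    by (subst indep_vars_iff_distr_eq_PiM) auto
qed

text \<open>Distinct centred terms are uncorrelated, so only the \<open>n\<close> diagonal pairs
  count in the second moment.\<close>

lemma expectation_abs_sum_le:
  fixes F :: "'a \<Rightarrow> real"
  assumes F [measurable]: "F \<in> borel_measurable borel"
    and sq: "integrable M (\<lambda>\<omega>. (F (X \<omega>))\<^sup>2)" and mean0: "expectation (\<lambda>\<omega>. F (X \<omega>)) = 0"
  shows "expectation (\<lambda>\<omega>. \<bar>\<Sum>i=1..n. F (Xs i \<omega>)\<bar>) \<le> sqrt (real n * expectation (\<lambda>\<omega>. (F (X \<omega>))\<^sup>2))"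
proof (rule expectation_abs_le_sqrt)
  have meas: "(\<lambda>\<omega>. F (Xs i \<omega>)) \<in> borel_measurable M" if "i \<in> {1..n}" for i
    using that by (intro measurable_compose[OF _ F] Xs_measurable) auto
  have sqi: "integrable M (\<lambda>\<omega>. (F (Xs i \<omega>))\<^sup>2)" if "i \<in> {1..n}" for i
    using that sq integrable_Xs[of "\<lambda>x. (F x)\<^sup>2" i] by auto
  show "(\<lambda>\<omega>. \<Sum>i=1..n. F (Xs i \<omega>)) \<in> borel_measurable M" by (intro borel_measurable_sum meas)
  show "integrable M (\<lambda>\<omega>. (\<Sum>i=1..n. F (Xs i \<omega>))\<^sup>2)" by (intro square_integrable_sum meas sqi)
  have "expectation (\<lambda>\<omega>. (\<Sum>i=1..n. F (Xs i \<omega>))\<^sup>2) \<le>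
      real (card ((\<lambda>i. (i, i)) ` {1..n})) * expectation (\<lambda>\<omega>. (F (X \<omega>))\<^sup>2)"
  proof (rule second_moment_sum_le)
    fix a b assume ab: "a \<in> {1..n}" "b \<in> {1..n}" "(a, b) \<notin> (\<lambda>i. (i, i)) ` {1..n}"
    then have "a \<noteq> b" by auto
    have "indep_vars (\<lambda>_. borel) (\<lambda>i \<omega>. F (Xs i \<omega>)) {a, b}"
      by (rule indep_vars_compose2[OF indep_vars_subset[OF Xs_indep]]) (use ab in auto)
    moreover have "integrable M (\<lambda>\<omega>. F (Xs i \<omega>))" if "i \<in> {a, b}" for i
    proof -
      have "i \<in> {1..n}" using that ab by blast
      then show ?thesis by (intro square_integrable_imp_integrable[OF meas sqi])
    qed
    ultimately have "expectation (\<lambda>\<omega>. \<Prod>i\<in>{a, b}. F (Xs i \<omega>)) = (\<Prod>i\<in>{a, b}. expectation (\<lambda>\<omega>. F (Xs i \<omega>)))"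
      by (intro indep_vars_lebesgue_integral) simp_all
    then have "expectation (\<lambda>\<omega>. F (Xs a \<omega>) * F (Xs b \<omega>)) =
        expectation (\<lambda>\<omega>. F (Xs a \<omega>)) * expectation (\<lambda>\<omega>. F (Xs b \<omega>))"
      using \<open>a \<noteq> b\<close> by simp
    then show "expectation (\<lambda>\<omega>. F (Xs a \<omega>) * F (Xs b \<omega>)) = 0"
      using ab integral_Xs[OF F, of a] mean0 by simp
  next
    fix a assume "a \<in> {1..n}"
    then show "expectation (\<lambda>\<omega>. (F (Xs a \<omega>))\<^sup>2) \<le> expectation (\<lambda>\<omega>. (F (X \<omega>))\<^sup>2)"
      by (subst integral_Xs) auto
  qed (use meas sqi in auto)
  then show "expectation (\<lambda>\<omega>. (\<Sum>i=1..n. F (Xs i \<omega>))\<^sup>2) \<le> real n * expectation (\<lambda>\<omega>. (F (X \<omega>))\<^sup>2)"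
    by (simp add: card_image inj_on_def)
qed

lemma weak_law_L1:
  fixes F :: "'a \<Rightarrow> real"
  assumes F [measurable]: "F \<in> borel_measurable borel" and sq: "integrable M (\<lambda>\<omega>. (F (X \<omega>))\<^sup>2)"
  shows "(\<lambda>n. expectation (\<lambda>\<omega>. \<bar>(\<Sum>i=1..n. F (Xs i \<omega>)) / real n - expectation (\<lambda>\<omega>. F (X \<omega>))\<bar>)) \<longlonglongrightarrow> 0"
proof -
  define m where "m = expectation (\<lambda>\<omega>. F (X \<omega>))"
  define v where "v = expectation (\<lambda>\<omega>. (F (X \<omega>) - m)\<^sup>2)"
  have intF: "integrable M (\<lambda>\<omega>. F (X \<omega>))"
    by (rule square_integrable_imp_integrable) (use sq in auto)
  have "integrable M (\<lambda>\<omega>. (F (X \<omega>) + (- m))\<^sup>2)"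
    using sq by (intro square_integrable_add) auto
  then have sum_le: "expectation (\<lambda>\<omega>. \<bar>\<Sum>i=1..n. F (Xs i \<omega>) - m\<bar>) \<le> sqrt (real n * v)" for n
    unfolding v_def using intF
    by (intro expectation_abs_sum_le[of "\<lambda>x. F x - m"]) (auto simp: prob_space m_def)
  show ?thesis
    unfolding m_def[symmetric]
  proof (rule Lim_null_comparison)
    show "(\<lambda>n. sqrt v * (sqrt (real n) / real n)) \<longlonglongrightarrow> 0"
    proof -
      have "(\<lambda>n. sqrt (real n) / real n) \<longlonglongrightarrow> 0" by real_asymp
      from tendsto_mult_right_zero[OF this] show ?thesis .
    qed
    show "\<forall>\<^sub>F n in sequentially. norm (expectation (\<lambda>\<omega>. \<bar>(\<Sum>i=1..n. F (Xs i \<omega>)) / real n - m\<bar>))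
        \<le> sqrt v * (sqrt (real n) / real n)"
    proof (intro eventually_sequentiallyI[of 1])
      fix n :: nat assume n: "1 \<le> n"
      have "\<bar>(\<Sum>i=1..n. F (Xs i \<omega>)) / real n - m\<bar> = \<bar>\<Sum>i=1..n. F (Xs i \<omega>) - m\<bar> / real n" for \<omega>
      proof -
        have "(\<Sum>i=1..n. F (Xs i \<omega>)) / real n - m = (\<Sum>i=1..n. F (Xs i \<omega>) - m) / real n"
          using n by (simp add: sum_subtractf field_simps)
        then show ?thesis by simp
      qed
      then have "expectation (\<lambda>\<omega>. \<bar>(\<Sum>i=1..n. F (Xs i \<omega>)) / real n - m\<bar>) =
          expectation (\<lambda>\<omega>. \<bar>\<Sum>i=1..n. F (Xs i \<omega>) - m\<bar>) / real n" by simp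
      also have "\<dots> \<le> sqrt (real n * v) / real n" by (intro divide_right_mono sum_le) auto
      finally show "norm (expectation (\<lambda>\<omega>. \<bar>(\<Sum>i=1..n. F (Xs i \<omega>)) / real n - m\<bar>))
        \<le> sqrt v * (sqrt (real n) / real n)"
        by (simp add: real_sqrt_mult mult.commute)
    qed
  qed
qed

end

section \<open>Linearisation of the U-statistic and its limit law\<close>

context product_bounded_kernel
begin

definition subset_sum :: "nat \<Rightarrow> 'w \<Rightarrow> real" where
  "subset_sum n \<omega> = (\<Sum>I | I \<subseteq> {1..n} \<and> card I = j. k (\<lambda>i. Xs i \<omega>) I)"

definition residual_sum :: "nat \<Rightarrow> 'w \<Rightarrow> real" where
  "residual_sum n \<omega> = (\<Sum>I | I \<subseteq> {1..n} \<and> card I = j. residual (\<lambda>i. Xs i \<omega>) I)"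

definition proj_variance :: real where
  "proj_variance = expectation (\<lambda>\<omega>. (centred (X \<omega>))\<^sup>2)"

lemma index_subset:
  fixes I :: "nat set"
  assumes "I \<in> {I. I \<subseteq> {1..n} \<and> card I = j}"
  shows "finite I" "I \<subseteq> {1..}" "card I = j"
  using assms by (auto intro: finite_subset)

lemma subset_sum_measurable: "subset_sum n \<in> borel_measurable M"
  unfolding subset_sum_def[abs_def] by (intro borel_measurable_sum k_Xs_measurable index_subset(2))

lemma residual_sum_integrable: "integrable M (residual_sum n)"
  unfolding residual_sum_def[abs_def]
proof (rule Bochner_Integration.integrable_sum)
  fix I assume "I \<in> {I. I \<subseteq> {1..n} \<and> card I = j}"
  note I = index_subset[OF this]
  have "(\<lambda>\<omega>. residual (\<lambda>i. Xs i \<omega>) I) \<in> borel_measurable M"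
    using I by (intro residual_measurable Xs_measurable) auto
  then show "integrable M (\<lambda>\<omega>. residual (\<lambda>i. Xs i \<omega>) I)"
    by (rule square_integrable_imp_integrable[OF _ residual_square_integrable[OF I]])
qed

text \<open>Only pairs of sets sharing at least two indices are correlated. The resulting order
  \<open>n^(j-1)\<close> is smaller by \<open>sqrt n\<close> than the scale
  \<open>n^(j - 1/2)\<close> on which fluctuations of \<open>subset_sum\<close> are
  observed.\<close>

lemma expectation_residual_sum_le:
  "expectation (\<lambda>\<omega>. \<bar>residual_sum n \<omega>\<bar>) \<le>
    sqrt (real (n ^ (2 * j - 2)) * expectation (\<lambda>\<omega>. (residual (\<lambda>i. Xs i \<omega>) {1..j})\<^sup>2))"
proof (rule expectation_abs_le_sqrt)
  let ?P = "{I. I \<subseteq> {1..n} \<and> card I = j}"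
  let ?R = "{(I, J). I \<in> ?P \<and> J \<in> ?P \<and> 2 \<le> card (I \<inter> J)}"
  let ?c = "expectation (\<lambda>\<omega>. (residual (\<lambda>i. Xs i \<omega>) {1..j})\<^sup>2)"
  have meas: "(\<lambda>\<omega>. residual (\<lambda>i. Xs i \<omega>) I) \<in> borel_measurable M" if "I \<in> ?P" for I
    using index_subset[OF that] by (intro residual_measurable Xs_measurable) auto
  show "residual_sum n \<in> borel_measurable M"
    using residual_sum_integrable by auto
  show "integrable M (\<lambda>\<omega>. (residual_sum n \<omega>)\<^sup>2)"
    unfolding residual_sum_def
    by (intro square_integrable_sum meas residual_square_integrable index_subset)
  have "expectation (\<lambda>\<omega>. (residual_sum n \<omega>)\<^sup>2) \<le> real (card ?R) * ?c"
    unfolding residual_sum_def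
  proof (rule second_moment_sum_le[OF _ _ meas])
    show "finite ?P" by simp
    show "?R \<subseteq> ?P \<times> ?P" by auto
    fix I assume I: "I \<in> ?P"
    show "integrable M (\<lambda>\<omega>. (residual (\<lambda>i. Xs i \<omega>) I)\<^sup>2)"
      by (rule residual_square_integrable[OF index_subset[OF I]])
    show "expectation (\<lambda>\<omega>. (residual (\<lambda>i. Xs i \<omega>) I)\<^sup>2) \<le> ?c"
      using residual_second_moment[OF index_subset[OF I]] by simp
    fix J assume J: "J \<in> ?P" and "(I, J) \<notin> ?R"
    then have "card (I \<inter> J) < 2" using I by auto
    then show "expectation (\<lambda>\<omega>. residual (\<lambda>i. Xs i \<omega>) I * residual (\<lambda>i. Xs i \<omega>) J) = 0"
      by (rule residual_orthogonal[OF index_subset[OF I] index_subset[OF J]])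
  qed
  also have "\<dots> \<le> real (n ^ (2 * j - 2)) * ?c"
    using card_overlapping_pairs_le[of n j] by (intro mult_right_mono) simp_all
  finally show "expectation (\<lambda>\<omega>. (residual_sum n \<omega>)\<^sup>2) \<le> real (n ^ (2 * j - 2)) * ?c" .
qed

lemma expectation_centred_X: "expectation (\<lambda>\<omega>. centred (X \<omega>)) = 0"
  using expectation_centred[of 1] integral_Xs[of centred 1] by simp

lemma centred_X_square_integrable: "integrable M (\<lambda>\<omega>. (centred (X \<omega>))\<^sup>2)"
  using centred_square_integrable[of 1] integrable_Xs[of "\<lambda>x. (centred x)\<^sup>2" 1] by simp

lemma expectation_centred_sum_le:
  "expectation (\<lambda>\<omega>. \<bar>\<Sum>i=1..n. centred (Xs i \<omega>)\<bar>) \<le> sqrt (real n * proj_variance)"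
  unfolding proj_variance_def
  by (rule expectation_abs_sum_le[OF centred_measurable centred_X_square_integrable expectation_centred_X])

lemma centred_sum_integrable: "integrable M (\<lambda>\<omega>. \<Sum>i=1..n. centred (Xs i \<omega>))"
  by (intro Bochner_Integration.integrable_sum centred_integrable) auto

text \<open>Double counting: each index lies in
  \<open>(n - 1) choose (j - 1) = (n choose j) * j / n\<close> of the sets, so the linear parts of
  all kernels combine into one i.i.d. sum.\<close>

lemma subset_sum_decomposition:
  assumes n: "1 \<le> n"
  shows "subset_sum n \<omega> = real (n choose j) * (mean + real j / real n * (\<Sum>i=1..n. centred (Xs i \<omega>)))
    + residual_sum n \<omega>"
proof -
  let ?P = "{I. I \<subseteq> {1..n} \<and> card I = j}"
  have finP: "finite ?P" by simp
  have "(\<Sum>I\<in>?P. \<Sum>i\<in>I. centred (Xs i \<omega>)) = (\<Sum>I\<in>?P. \<Sum>i\<in>{i\<in>{1..n}. i \<in> I}. centred (Xs i \<omega>))"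
    by (intro sum.cong) auto
  also have "\<dots> = (\<Sum>i\<in>{1..n}. \<Sum>I\<in>{I\<in>?P. i \<in> I}. centred (Xs i \<omega>))"
    by (rule sum.swap_restrict) auto
  also have "\<dots> = (\<Sum>i\<in>{1..n}. real (n - 1 choose (j - 1)) * centred (Xs i \<omega>))"
  proof (intro sum.cong refl)
    fix i assume "i \<in> {1..n}"
    moreover have "{I\<in>?P. i \<in> I} = {I. {i} \<subseteq> I \<and> I \<subseteq> {1..n} \<and> card I = j}" by auto
    ultimately show "(\<Sum>I\<in>{I\<in>?P. i \<in> I}. centred (Xs i \<omega>)) = real (n - 1 choose (j - 1)) * centred (Xs i \<omega>)"
      using card_subsets_containing[of "{1..n}" "{i}" j] j by simp
  qed
  also have "\<dots> = real (n - 1 choose (j - 1)) * (\<Sum>i=1..n. centred (Xs i \<omega>))"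
    by (simp add: sum_distrib_left)
  also have "real (n - 1 choose (j - 1)) = real (n choose j) * (real j / real n)"
  proof -
    have "j * (n choose j) = n * (n - 1 choose (j - 1))"
      using j by (intro times_binomial_minus1_eq) auto
    then have "real j * real (n choose j) = real n * real (n - 1 choose (j - 1))"
      by (metis of_nat_mult)
    then show ?thesis using n by (simp add: field_simps)
  qed
  finally have "(\<Sum>I\<in>?P. \<Sum>i\<in>I. centred (Xs i \<omega>)) =
      real (n choose j) * (real j / real n) * (\<Sum>i=1..n. centred (Xs i \<omega>))" .
  moreover have "residual_sum n \<omega> = subset_sum n \<omega> - real (card ?P) * mean - (\<Sum>I\<in>?P. \<Sum>i\<in>I. centred (Xs i \<omega>))"
    by (simp add: residual_sum_def residual_def subset_sum_def sum_subtractf)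
  moreover have "card ?P = n choose j" using n_subsets[of "{1..n}" j] by simp
  ultimately show ?thesis by (simp add: algebra_simps)
qed

lemma subset_sum_L1_linearisation:
  "(\<lambda>n. expectation (\<lambda>\<omega>. \<bar>sqrt (real n) * (subset_sum n \<omega> / real n ^ j - mean / fact j)
      - (real j / fact j) / sqrt (real n) * (\<Sum>i=1..n. centred (Xs i \<omega>))\<bar>)) \<longlonglongrightarrow> 0"
proof -
  define d where "d n = real (n choose j) / real n ^ j - 1 / fact j" for n
  define c where "c = expectation (\<lambda>\<omega>. (residual (\<lambda>i. Xs i \<omega>) {1..j})\<^sup>2)"
  let ?S = "\<lambda>n \<omega>. \<Sum>i=1..n. centred (Xs i \<omega>)"
  let ?D = "\<lambda>n \<omega>. sqrt (real n) * (subset_sum n \<omega> / real n ^ j - mean / fact j)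
      - (real j / fact j) / sqrt (real n) * ?S n \<omega>"
  \<comment> \<open>The three errors: replacing \<open>(n choose j) / n^j\<close> by
    \<open>1 / j!\<close> in the constant, the same in the linear term, and the residual. The first
    two vanish by the rate of \<open>d n\<close>, the last has order
    \<open>1 / sqrt n\<close>.\<close>
  let ?b = "\<lambda>n. \<bar>sqrt (real n) * d n\<bar> * \<bar>mean\<bar> + \<bar>sqrt (real n) * d n\<bar> * real j * (sqrt proj_variance / sqrt (real n))
      + sqrt c / sqrt (real n)"
  have dlim: "(\<lambda>n. \<bar>sqrt (real n) * d n\<bar>) \<longlonglongrightarrow> 0"
    using binomial_over_power_rate[of j] unfolding d_def by (rule tendsto_rabs_zero)
  have inv: "(\<lambda>n. a / sqrt (real n)) \<longlonglongrightarrow> 0" for a :: real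
    by (intro tendsto_divide_0[OF tendsto_const] filterlim_at_top_imp_at_infinity
        filterlim_compose[OF sqrt_at_top filterlim_real_sequentially])
  have "?b \<longlonglongrightarrow> 0 * \<bar>mean\<bar> + 0 * real j * 0 + 0"
    by (intro tendsto_intros dlim inv)
  then have blim: "?b \<longlonglongrightarrow> 0" by simp
  have le: "expectation (\<lambda>\<omega>. \<bar>?D n \<omega>\<bar>) \<le> ?b n" if n: "1 \<le> n" for n
  proof -
    let ?s = "sqrt (real n)"
    have s: "0 < ?s" "?s * ?s = real n" using n by auto
    have D: "?D n \<omega> = ?s * d n * mean + ?s * d n * real j / real n * ?S n \<omega> + ?s / real n ^ j * residual_sum n \<omega>" for \<omega>
    proof -
      have "?D n \<omega> = ?s * (real (n choose j) / real n ^ j * (mean + real j / real n * ?S n \<omega>)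
          + residual_sum n \<omega> / real n ^ j - mean / fact j) - (real j / fact j) / ?s * ?S n \<omega>"
        by (simp add: subset_sum_decomposition[OF n] add_divide_distrib)
      moreover have "1 / ?s = ?s / real n" using s by (simp add: field_simps)
      then have "(real j / fact j) / ?s = ?s * (1 / fact j) * real j / real n"
        by (simp add: divide_inverse)
      ultimately have "?D n \<omega> = ?s * (real (n choose j) / real n ^ j * (mean + real j / real n * ?S n \<omega>)
          + residual_sum n \<omega> / real n ^ j - mean / fact j) - ?s * (1 / fact j) * real j / real n * ?S n \<omega>"
        by simp
      also have "\<dots> = ?s * d n * mean + ?s * d n * real j / real n * ?S n \<omega> + ?s / real n ^ j * residual_sum n \<omega>"
        unfolding d_def by (simp add: algebra_simps diff_divide_distrib add_divide_distrib)
      finally show ?thesis .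
    qed
    have int: "integrable M (\<lambda>\<omega>. \<bar>?S n \<omega>\<bar>)" "integrable M (\<lambda>\<omega>. \<bar>residual_sum n \<omega>\<bar>)"
      using centred_sum_integrable residual_sum_integrable by (auto intro!: integrable_abs)
    have intD: "integrable M (?D n)"
      unfolding D using centred_sum_integrable residual_sum_integrable
      by (intro Bochner_Integration.integrable_add integrable_mult_right integrable_const) auto
    have "expectation (\<lambda>\<omega>. \<bar>?D n \<omega>\<bar>) \<le>
      expectation (\<lambda>\<omega>. \<bar>?s * d n * mean\<bar> + \<bar>?s * d n * real j / real n\<bar> * \<bar>?S n \<omega>\<bar> + ?s / real n ^ j * \<bar>residual_sum n \<omega>\<bar>)"
    proof (rule integral_mono)
      fix \<omega>
      have "\<bar>?D n \<omega>\<bar> \<le> \<bar>?s * d n * mean\<bar> + \<bar>?s * d n * real j / real n * ?S n \<omega>\<bar> + \<bar>?s / real n ^ j * residual_sum n \<omega>\<bar>"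
        unfolding D by (intro order_trans[OF abs_triangle_ineq] add_mono abs_triangle_ineq order_refl)
      then show "\<bar>?D n \<omega>\<bar> \<le> \<bar>?s * d n * mean\<bar> + \<bar>?s * d n * real j / real n\<bar> * \<bar>?S n \<omega>\<bar> + ?s / real n ^ j * \<bar>residual_sum n \<omega>\<bar>"
        by (simp add: abs_mult)
    qed (use int intD in \<open>auto intro!: integrable_abs\<close>)
    also have "\<dots> = \<bar>?s * d n * mean\<bar> + \<bar>?s * d n * real j / real n\<bar> * expectation (\<lambda>\<omega>. \<bar>?S n \<omega>\<bar>)
        + ?s / real n ^ j * expectation (\<lambda>\<omega>. \<bar>residual_sum n \<omega>\<bar>)"
      using int by (simp add: prob_space)
    also have "\<dots> \<le> \<bar>?s * d n * mean\<bar> + \<bar>?s * d n * real j / real n\<bar> * sqrt (real n * proj_variance)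
        + ?s / real n ^ j * sqrt (real (n ^ (2 * j - 2)) * c)"
      using expectation_centred_sum_le expectation_residual_sum_le
      by (intro add_mono mult_left_mono) (auto simp: c_def)
    also have "\<dots> = ?b n"
    proof -
      have "\<bar>?s * d n * real j / real n\<bar> * sqrt (real n * proj_variance) =
          \<bar>?s * d n\<bar> * real j * (sqrt proj_variance / ?s)"
        using s by (simp add: real_sqrt_mult abs_mult field_simps)
      moreover have "?s / real n ^ j * sqrt (real (n ^ (2 * j - 2)) * c) = sqrt c / ?s"
      proof -
        have "2 * j - 2 = (j - 1) * 2" by simp
        then have "sqrt (real (n ^ (2 * j - 2))) = real n ^ (j - 1)"
          by (simp add: power_mult)
        moreover have "real n ^ j = real n * real n ^ (j - 1)"
          using j by (cases j) auto
        ultimately show ?thesis using s n by (simp add: real_sqrt_mult field_simps)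
      qed
      ultimately show ?thesis by (simp add: abs_mult)
    qed
    finally show ?thesis .
  qed
  show ?thesis
  proof (rule Lim_null_comparison[OF _ blim])
    show "\<forall>\<^sub>F n in sequentially. norm (expectation (\<lambda>\<omega>. \<bar>?D n \<omega>\<bar>)) \<le> ?b n"
      using le by (intro eventually_sequentiallyI[of 1]) simp
  qed
qed

lemma subset_sum_integrable: "integrable M (subset_sum n)"
  unfolding subset_sum_def[abs_def]
proof (rule Bochner_Integration.integrable_sum)
  fix I assume "I \<in> {I. I \<subseteq> {1..n} \<and> card I = j}"
  note I = index_subset[OF this]
  show "integrable M (\<lambda>\<omega>. k (\<lambda>i. Xs i \<omega>) I)"
    by (rule square_integrable_imp_integrable[OF k_Xs_measurable[OF I(2)] k_square_integrable[OF I]])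
qed

theorem subset_sum_central_limit:
  "weak_conv_m (\<lambda>n. distr M borel (\<lambda>\<omega>. sqrt (real n) * (subset_sum n \<omega> / real n ^ j - mean / fact j)))
    (normal_distribution 0 ((real j / fact j)\<^sup>2 * proj_variance))"
proof (rule weak_conv_m_L1_perturbation[OF _ _ _ subset_sum_L1_linearisation])
  let ?V = "\<lambda>i \<omega>. centred (Xs (Suc i) \<omega>)"
  have "indep_vars (\<lambda>_. borel) ?V UNIV"
    by (rule indep_vars_compose2[OF indep_vars_Xs_Suc]) simp
  then have "weak_conv_m (\<lambda>n. distr M borel (\<lambda>\<omega>. (real j / fact j) / sqrt (real n) * (\<Sum>i<n. ?V i \<omega>)))
      (normal_distribution 0 ((real j / fact j)\<^sup>2 * proj_variance))"
  proof (rule weak_conv_m_scaled_iid_sum)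
    fix n
    show "expectation (?V n) = 0" by (rule expectation_centred) simp
    show "integrable M (\<lambda>\<omega>. (?V n \<omega>)\<^sup>2)" by (rule centred_square_integrable) simp
    show "expectation (\<lambda>\<omega>. (?V n \<omega>)\<^sup>2) = proj_variance"
      unfolding proj_variance_def by (rule integral_Xs) auto
    have "distr M borel (?V n) = distr (distr M borel (Xs (Suc n))) borel centred"
      by (subst distr_distr) (auto simp: o_def)
    also have "\<dots> = distr (distr M borel X) borel centred" by (simp add: Xs_distr)
    finally show "distr M borel (?V n) = distr (distr M borel X) borel centred" .
  qed (use j in auto)
  moreover have "(\<Sum>i<n. ?V i \<omega>) = (\<Sum>i=1..n. centred (Xs i \<omega>))" for n \<omega>
    by (rule sum.reindex_bij_witness[of _ "\<lambda>i. i - 1" Suc]) auto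
  ultimately show "weak_conv_m (\<lambda>n. distr M borel (\<lambda>\<omega>. (real j / fact j) / sqrt (real n) * (\<Sum>i=1..n. centred (Xs i \<omega>))))
      (normal_distribution 0 ((real j / fact j)\<^sup>2 * proj_variance))"
    by simp
  have "0 \<le> proj_variance" by (simp add: proj_variance_def)
  then show "real_distribution (normal_distribution 0 ((real j / fact j)\<^sup>2 * proj_variance))"
    by (intro real_distribution_normal_distribution) simp
  note [measurable] = subset_sum_measurable
  show "(\<lambda>\<omega>. sqrt (real n) * (subset_sum n \<omega> / real n ^ j - mean / fact j)) \<in> borel_measurable M" for n
    by measurable
  show "(\<lambda>\<omega>. (real j / fact j) / sqrt (real n) * (\<Sum>i=1..n. centred (Xs i \<omega>))) \<in> borel_measurable M" for n
    using centred_sum_integrable[of n] by (intro borel_measurable_times) auto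
  show "integrable M (\<lambda>\<omega>. sqrt (real n) * (subset_sum n \<omega> / real n ^ j - mean / fact j) -
      (real j / fact j) / sqrt (real n) * (\<Sum>i=1..n. centred (Xs i \<omega>)))" for n
    using subset_sum_integrable centred_sum_integrable
    by (intro Bochner_Integration.integrable_diff integrable_mult_right integrable_divide integrable_const) auto
qed

text \<open>The linearised statistic, still multiplied by \<open>sqrt n\<close>, is bounded in mean;
  dividing by \<open>sqrt n\<close> makes it vanish.\<close>

lemma subset_sum_L1_consistent:
  "(\<lambda>n. expectation (\<lambda>\<omega>. \<bar>subset_sum n \<omega> / real n ^ j - mean / fact j\<bar>)) \<longlonglongrightarrow> 0"
proof -
  let ?S = "\<lambda>n \<omega>. \<Sum>i=1..n. centred (Xs i \<omega>)"
  let ?U = "\<lambda>n \<omega>. subset_sum n \<omega> / real n ^ j - mean / fact j"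
  let ?c = "real j / fact j"
  let ?e = "\<lambda>n. expectation (\<lambda>\<omega>. \<bar>sqrt (real n) * ?U n \<omega> - ?c / sqrt (real n) * ?S n \<omega>\<bar>)"
  have inv: "(\<lambda>n. 1 / sqrt (real n)) \<longlonglongrightarrow> 0" by real_asymp
  have "(\<lambda>n. 1 / sqrt (real n) * (?e n + ?c * sqrt proj_variance)) \<longlonglongrightarrow> 0 * (0 + ?c * sqrt proj_variance)"
    by (intro tendsto_mult tendsto_add inv subset_sum_L1_linearisation tendsto_const)
  then have lim: "(\<lambda>n. 1 / sqrt (real n) * (?e n + ?c * sqrt proj_variance)) \<longlonglongrightarrow> 0" by simp
  have le: "expectation (\<lambda>\<omega>. \<bar>?U n \<omega>\<bar>) \<le> 1 / sqrt (real n) * (?e n + ?c * sqrt proj_variance)" if n: "1 \<le> n" for n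
  proof -
    let ?s = "sqrt (real n)"
    have s: "0 < ?s" using n by auto
    have intU: "integrable M (?U n)"
      using subset_sum_integrable by (intro Bochner_Integration.integrable_diff integrable_divide integrable_const) auto
    have intE: "integrable M (\<lambda>\<omega>. \<bar>?s * ?U n \<omega> - ?c / ?s * ?S n \<omega>\<bar>)"
    proof (rule integrable_abs, rule Bochner_Integration.integrable_diff)
      show "integrable M (\<lambda>\<omega>. ?s * ?U n \<omega>)" using intU by (rule integrable_mult_right)
      show "integrable M (\<lambda>\<omega>. ?c / ?s * ?S n \<omega>)"
        using centred_sum_integrable by (rule integrable_mult_right)
    qed
    have intS: "integrable M (\<lambda>\<omega>. ?c / ?s * \<bar>?S n \<omega>\<bar>)"
      using centred_sum_integrable by (intro integrable_mult_right integrable_abs) auto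
    have "?s * expectation (\<lambda>\<omega>. \<bar>?U n \<omega>\<bar>) = expectation (\<lambda>\<omega>. ?s * \<bar>?U n \<omega>\<bar>)" by simp
    also have "\<dots> \<le> expectation (\<lambda>\<omega>. \<bar>?s * ?U n \<omega> - ?c / ?s * ?S n \<omega>\<bar> + ?c / ?s * \<bar>?S n \<omega>\<bar>)"
    proof (rule integral_mono)
      fix \<omega>
      have "?s * \<bar>?U n \<omega>\<bar> = \<bar>?s * ?U n \<omega>\<bar>" "?c / ?s * \<bar>?S n \<omega>\<bar> = \<bar>?c / ?s * ?S n \<omega>\<bar>"
        using s by (simp_all add: abs_mult)
      then show "?s * \<bar>?U n \<omega>\<bar> \<le> \<bar>?s * ?U n \<omega> - ?c / ?s * ?S n \<omega>\<bar> + ?c / ?s * \<bar>?S n \<omega>\<bar>"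
        by linarith
    next
      show "integrable M (\<lambda>\<omega>. ?s * \<bar>?U n \<omega>\<bar>)" using intU by (intro integrable_mult_right integrable_abs)
    qed (intro Bochner_Integration.integrable_add intE intS)
    also have "\<dots> = ?e n + ?c / ?s * expectation (\<lambda>\<omega>. \<bar>?S n \<omega>\<bar>)"
      using intE intS by (subst Bochner_Integration.integral_add) auto
    also have "\<dots> \<le> ?e n + ?c / ?s * sqrt (real n * proj_variance)"
      using expectation_centred_sum_le by (intro add_left_mono mult_left_mono) auto
    also have "?c / ?s * sqrt (real n * proj_variance) = ?c * sqrt proj_variance"
      using s by (simp add: real_sqrt_mult)
    finally have "?s * expectation (\<lambda>\<omega>. \<bar>?U n \<omega>\<bar>) \<le> ?e n + ?c * sqrt proj_variance" .
    moreover have "a \<le> 1 / s * b" if "s * a \<le> b" "0 < s" for a b s :: real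
      using that by (simp add: field_simps)
    ultimately show ?thesis using s by blast
  qed
  show ?thesis
  proof (rule Lim_null_comparison[OF _ lim])
    show "\<forall>\<^sub>F n in sequentially. norm (expectation (\<lambda>\<omega>. \<bar>?U n \<omega>\<bar>)) \<le>
        1 / sqrt (real n) * (?e n + ?c * sqrt proj_variance)"
      using le by (intro eventually_sequentiallyI[of 1]) simp
  qed
qed

end

subsection \<open>Valuations of the selection expectation\<close>

lemma max_inner_lipschitz:
  fixes x u v :: "'a::real_inner"
  shows "\<bar>max 0 (x \<bullet> u) - max 0 (x \<bullet> v)\<bar> \<le> norm x * norm (u - v)"
proof -
  have "\<bar>max 0 (x \<bullet> u) - max 0 (x \<bullet> v)\<bar> \<le> \<bar>x \<bullet> (u - v)\<bar>"
    by (simp add: max_def inner_diff_right)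
  also have "\<dots> \<le> norm x * norm (u - v)" by (rule Cauchy_Schwarz_ineq2)
  finally show ?thesis .
qed

context iid_sequence
begin

text \<open>A finite net of directions \<open>D\<close> and the Lipschitz continuity of support functions turn
  the weak law in each single direction into Hausdorff convergence.\<close>
lemma hausdorff_within_selection_expectation:
  assumes X: "integrable M X" and \<eta>: "0 < \<eta>"
  obtains D where "finite D" and "\<And>n \<omega>. 1 \<le> n \<Longrightarrow>
    hausdorff_within
      ((\<Sum>u\<in>D. \<bar>(\<Sum>i=1..n. max 0 (Xs i \<omega> \<bullet> u)) / real n - expectation (\<lambda>\<omega>. max 0 (X \<omega> \<bullet> u))\<bar>)
        + \<eta> * ((\<Sum>i=1..n. norm (Xs i \<omega>)) / real n + expectation (\<lambda>\<omega>. norm (X \<omega>))))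
      ((*\<^sub>R) (1 / real n) ` segment_sum (\<lambda>i. Xs i \<omega>) {1..n}) (selection_expectation_segment M X)"
proof -
  define h where "h n \<omega> u = (\<Sum>i=1..n. max 0 (Xs i \<omega> \<bullet> u)) / real n" for n \<omega> u
  define H where "H u = expectation (\<lambda>\<omega>. max 0 (X \<omega> \<bullet> u))" for u
  define R where "R n \<omega> = (\<Sum>i=1..n. norm (Xs i \<omega>)) / real n" for n \<omega>
  define m where "m = expectation (\<lambda>\<omega>. norm (X \<omega>))"
  have "compact (sphere (0::'a) 1)" by simp
  then obtain D where D: "finite D" "sphere (0::'a) 1 \<subseteq> (\<Union>u\<in>D. ball u \<eta>)"
    using \<eta> unfolding compact_eq_totally_bounded by metis
  have h_scale: "h n \<omega> (c *\<^sub>R u) = c * h n \<omega> u" if "0 \<le> c" for n \<omega> c u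
  proof -
    have "max 0 (x \<bullet> (c *\<^sub>R u)) = c * max 0 (x \<bullet> u)" for x
      using that by (auto simp: max_def zero_le_mult_iff)
    then show ?thesis by (simp add: h_def sum_distrib_left)
  qed
  have H_scale: "H (c *\<^sub>R u) = c * H u" if "0 \<le> c" for c u
  proof -
    have "max 0 (x \<bullet> (c *\<^sub>R u)) = c * max 0 (x \<bullet> u)" for x
      using that by (auto simp: max_def zero_le_mult_iff)
    then show ?thesis by (simp add: H_def)
  qed
  have h_lip: "\<bar>h n \<omega> u - h n \<omega> v\<bar> \<le> R n \<omega> * norm (u - v)" for n \<omega> u v
  proof -
    have "\<bar>h n \<omega> u - h n \<omega> v\<bar> = \<bar>\<Sum>i=1..n. max 0 (Xs i \<omega> \<bullet> u) - max 0 (Xs i \<omega> \<bullet> v)\<bar> / real n"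
      unfolding h_def by (simp add: sum_subtractf flip: diff_divide_distrib)
    also have "\<dots> \<le> (\<Sum>i=1..n. norm (Xs i \<omega>) * norm (u - v)) / real n"
      by (intro divide_right_mono order_trans[OF sum_abs] sum_mono max_inner_lipschitz) auto
    also have "\<dots> = R n \<omega> * norm (u - v)" by (simp add: R_def sum_distrib_right)
    finally show ?thesis .
  qed
  have int_max: "integrable M (\<lambda>\<omega>. max 0 (X \<omega> \<bullet> u))" for u
    using X by (intro integrable_max integrable_inner_left) auto
  have H_lip: "\<bar>H u - H v\<bar> \<le> m * norm (u - v)" for u v
  proof -
    have "H u - H v = expectation (\<lambda>\<omega>. max 0 (X \<omega> \<bullet> u) - max 0 (X \<omega> \<bullet> v))"
      unfolding H_def by (rule Bochner_Integration.integral_diff[symmetric]; rule int_max)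
    then have "\<bar>H u - H v\<bar> \<le> expectation (\<lambda>\<omega>. \<bar>max 0 (X \<omega> \<bullet> u) - max 0 (X \<omega> \<bullet> v)\<bar>)"
      by (simp only: integral_abs_bound)
    also have "\<dots> \<le> expectation (\<lambda>\<omega>. norm (X \<omega>) * norm (u - v))"
    proof (rule integral_mono)
      show "integrable M (\<lambda>\<omega>. \<bar>max 0 (X \<omega> \<bullet> u) - max 0 (X \<omega> \<bullet> v)\<bar>)"
        by (intro integrable_abs Bochner_Integration.integrable_diff int_max)
      show "integrable M (\<lambda>\<omega>. norm (X \<omega>) * norm (u - v))"
        using X by (intro integrable_mult_left integrable_norm)
    qed (rule max_inner_lipschitz)
    also have "\<dots> = m * norm (u - v)" by (simp add: m_def)
    finally show ?thesis .
  qed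
  have m0: "0 \<le> m" by (simp add: m_def)
  have R0: "0 \<le> R n \<omega>" for n \<omega> by (simp add: R_def sum_nonneg)
  let ?Q = "\<lambda>n \<omega>. (\<Sum>u\<in>D. \<bar>h n \<omega> u - H u\<bar>) + \<eta> * (R n \<omega> + m)"
  have Q0: "0 \<le> ?Q n \<omega>" for n \<omega>
    using \<eta> m0 R0[of n \<omega>] by (intro add_nonneg_nonneg sum_nonneg mult_nonneg_nonneg) auto
  \<comment> \<open>The nearest net direction \<open>v\<close> is compared with \<open>u\<close>: by
    the two Lipschitz constants \<open>R n \<omega>\<close> and \<open>m\<close>, moving from
    \<open>u\<close> to \<open>v\<close> costs at most
    \<open>\<eta> * (R n \<omega> + m)\<close>.\<close>
  have sphere: "\<bar>h n \<omega> u - H u\<bar> \<le> ?Q n \<omega>" if u: "norm u = 1" for n \<omega> u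
  proof -
    have "u \<in> sphere 0 1" using u by simp
    then obtain v where v: "v \<in> D" "norm (u - v) \<le> \<eta>"
      using D(2) by (force simp: dist_norm norm_minus_commute)
    have "\<bar>h n \<omega> u - h n \<omega> v\<bar> \<le> R n \<omega> * \<eta>"
      using h_lip[of n \<omega> u v] mult_left_mono[OF v(2) R0[of n \<omega>]] by linarith
    moreover have "\<bar>H u - H v\<bar> \<le> m * \<eta>"
      using H_lip[of u v] mult_left_mono[OF v(2) m0] by linarith
    moreover have "\<bar>h n \<omega> v - H v\<bar> \<le> (\<Sum>u\<in>D. \<bar>h n \<omega> u - H u\<bar>)"
      using D(1) v(1) by (intro member_le_sum) auto
    moreover have "\<eta> * (R n \<omega> + m) = R n \<omega> * \<eta> + m * \<eta>" by (simp add: algebra_simps)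
    ultimately show ?thesis by linarith
  qed
  \<comment> \<open>Both \<open>h\<close> and \<open>H\<close> are positively homogeneous, so the
    bound on the sphere extends to all directions.\<close>
  have all: "\<bar>h n \<omega> u - H u\<bar> \<le> ?Q n \<omega> * norm u" for n \<omega> u
  proof (cases "u = 0")
    case True
    then show ?thesis by (simp add: h_def H_def)
  next
    case False
    define w where "w = (1 / norm u) *\<^sub>R u"
    have w: "norm w = 1" "u = norm u *\<^sub>R w" using False by (auto simp: w_def)
    have "\<bar>h n \<omega> u - H u\<bar> = \<bar>norm u * (h n \<omega> w - H w)\<bar>"
      by (subst (1 2) w(2)) (simp add: h_scale H_scale right_diff_distrib)
    also have "\<dots> = norm u * \<bar>h n \<omega> w - H w\<bar>" by (simp add: abs_mult)
    also have "\<dots> \<le> norm u * ?Q n \<omega>" by (intro mult_left_mono sphere w) auto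
    finally show ?thesis by (simp only: mult.commute)
  qed
  have "hausdorff_within (?Q n \<omega>) ((*\<^sub>R) (1 / real n) ` segment_sum (\<lambda>i. Xs i \<omega>) {1..n})
      (selection_expectation_segment M X)" for n \<omega>
  proof (rule hausdorff_within_support_function[OF _ _ Q0])
    show "(*\<^sub>R) (1 / real n) ` segment_sum (\<lambda>i. Xs i \<omega>) {1..n} \<in> convex_bodies"
      by (intro convex_bodies_scaleR convex_bodies_segment_sum)
    show "selection_expectation_segment M X \<in> convex_bodies"
      by (rule selection_expectation_segment_convex_body[OF X])
    fix u
    have "support_function ((*\<^sub>R) (1 / real n) ` segment_sum (\<lambda>i. Xs i \<omega>) {1..n}) u = h n \<omega> u"
      by (simp add: support_function_scaleR convex_bodies_segment_sum support_function_segment_sum h_def)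
    moreover have "support_function (selection_expectation_segment M X) u = H u"
      by (simp add: support_function_selection_expectation_segment[OF X] H_def)
    ultimately show "\<bar>support_function ((*\<^sub>R) (1 / real n) ` segment_sum (\<lambda>i. Xs i \<omega>) {1..n}) u -
        support_function (selection_expectation_segment M X) u\<bar> \<le> ?Q n \<omega> * norm u"
      using all[of n \<omega> u] by simp
  qed
  then show thesis
    by (intro that[OF D(1)]) (simp only: h_def H_def R_def m_def)
qed

text \<open>\<open>\<phi> (Z n)\<close> is close to \<open>c\<close> by hypothesis and close to
  \<phi> of the selection expectation by continuity, both with high probability. As the two limits
  are deterministic numbers, one common outcome is enough to compare them.\<close>

lemma Val_selection_expectation_eqI:
  fixes \<phi> :: "'a set \<Rightarrow> real"
  defines "Z \<equiv> \<lambda>n \<omega>. (*\<^sub>R) (1 / real n) ` segment_sum (\<lambda>i. Xs i \<omega>) {1..n}"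
  assumes \<phi>: "\<phi> \<in> Val" and X2: "integrable M (\<lambda>\<omega>. (norm (X \<omega>))\<^sup>2)"
    and int: "\<And>n. integrable M (\<lambda>\<omega>. \<phi> (Z n \<omega>) - c)"
    and lim: "(\<lambda>n. expectation (\<lambda>\<omega>. \<bar>\<phi> (Z n \<omega>) - c\<bar>)) \<longlonglongrightarrow> 0"
  shows "\<phi> (selection_expectation_segment M X) = c"
proof -
  let ?ZX = "selection_expectation_segment M X"
  have normX: "integrable M (\<lambda>\<omega>. norm (X \<omega>))"
    by (rule square_integrable_imp_integrable) (use X2 in auto)
  then have X: "integrable M X" by (subst (asm) integrable_norm_iff) auto
  have "\<bar>\<phi> ?ZX - c\<bar> < 2 * e" if e: "0 < e" for e
  proof -
    obtain d where d: "0 < d"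
      "\<And>L. L \<in> convex_bodies \<Longrightarrow> hausdorff_within d L ?ZX \<Longrightarrow> \<bar>\<phi> L - \<phi> ?ZX\<bar> < e"
      using Val_continuous[OF \<phi> selection_expectation_segment_convex_body[OF X] e] by metis
    define m where "m = expectation (\<lambda>\<omega>. norm (X \<omega>))"
    have m: "0 \<le> m" by (simp add: m_def)
    \<comment> \<open>Makes the net error small in mean:
      \<open>\<eta> * (2 * m) / d = m / (2 * (m + 1)) < 1/2\<close>. The summand 1 covers
      \<open>m = 0\<close>.\<close>
    define \<eta> where "\<eta> = d / (4 * (m + 1))"
    have \<eta>: "0 < \<eta>" using d m by (simp add: \<eta>_def)
    define h where "h n \<omega> u = (\<Sum>i=1..n. max 0 (Xs i \<omega> \<bullet> u)) / real n" for n \<omega> u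
    define H where "H u = expectation (\<lambda>\<omega>. max 0 (X \<omega> \<bullet> u))" for u
    define R where "R n \<omega> = (\<Sum>i=1..n. norm (Xs i \<omega>)) / real n" for n \<omega>
    obtain D where D: "finite D" "\<And>n \<omega>. 1 \<le> n \<Longrightarrow>
        hausdorff_within ((\<Sum>u\<in>D. \<bar>h n \<omega> u - H u\<bar>) + \<eta> * (R n \<omega> + m)) (Z n \<omega>) ?ZX"
      using hausdorff_within_selection_expectation[OF X \<eta>]
      unfolding h_def H_def R_def m_def Z_def by blast
    have int_norm: "integrable M (\<lambda>\<omega>. norm (Xs i \<omega>))" if "i \<in> {1..n}" for i n
      using that normX integrable_Xs[of norm i] by auto
    have intR: "integrable M (R n)" for n
      unfolding R_def[abs_def] by (intro integrable_divide Bochner_Integration.integrable_sum int_norm)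
    have ER: "expectation (R n) = m" if "1 \<le> n" for n
    proof -
      have "expectation (R n) = (\<Sum>i=1..n. expectation (\<lambda>\<omega>. norm (Xs i \<omega>))) / real n"
        unfolding R_def[abs_def] using int_norm[of _ n]
        by (simp add: Bochner_Integration.integral_sum)
      also have "(\<Sum>i=1..n. expectation (\<lambda>\<omega>. norm (Xs i \<omega>))) = (\<Sum>i=1..n. m)"
        unfolding m_def by (intro sum.cong integral_Xs) auto
      finally show ?thesis using that by simp
    qed
    have max_sq: "integrable M (\<lambda>\<omega>. (max 0 (X \<omega> \<bullet> u))\<^sup>2)" for u
    proof (rule Bochner_Integration.integrable_bound)
      show "integrable M (\<lambda>\<omega>. (norm u)\<^sup>2 * (norm (X \<omega>))\<^sup>2)" using X2 by simp
      show "AE \<omega> in M. norm ((max 0 (X \<omega> \<bullet> u))\<^sup>2) \<le> norm ((norm u)\<^sup>2 * (norm (X \<omega>))\<^sup>2)"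
      proof (intro AE_I2)
        fix \<omega>
        have "max 0 (X \<omega> \<bullet> u) \<le> norm u * norm (X \<omega>)"
          using norm_cauchy_schwarz[of "X \<omega>" u] by (simp add: mult.commute)
        then have "(max 0 (X \<omega> \<bullet> u))\<^sup>2 \<le> (norm u * norm (X \<omega>))\<^sup>2"
          by (intro power_mono) auto
        then show "norm ((max 0 (X \<omega> \<bullet> u))\<^sup>2) \<le> norm ((norm u)\<^sup>2 * (norm (X \<omega>))\<^sup>2)"
          by (simp add: power_mult_distrib)
      qed
    qed measurable
    have hlim: "(\<lambda>n. expectation (\<lambda>\<omega>. \<bar>h n \<omega> u - H u\<bar>)) \<longlonglongrightarrow> 0" for u
      unfolding h_def H_def by (rule weak_law_L1[OF _ max_sq]) measurable
    have inth: "integrable M (\<lambda>\<omega>. \<bar>h n \<omega> u - H u\<bar>)" for n u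
    proof -
      have "integrable M (\<lambda>\<omega>. max 0 (X \<omega> \<bullet> u))"
        using X by (intro integrable_max integrable_inner_left) auto
      then have "integrable M (\<lambda>\<omega>. max 0 (Xs i \<omega> \<bullet> u))" if "i \<in> {1..n}" for i
        using that integrable_Xs[of "\<lambda>x. max 0 (x \<bullet> u)" i] by auto
      then show ?thesis
        unfolding h_def
        by (intro integrable_abs Bochner_Integration.integrable_diff integrable_divide
            Bochner_Integration.integrable_sum integrable_const)
    qed
    \<comment> \<open>A Markov argument in one quantity: \<open>T n \<omega> < 1\<close> forces both
      the Hausdorff bound below \<open>d\<close> and
      \<open>\<bar>\<phi> (Z n \<omega>) - c\<bar> < e\<close>, and it happens for some outcome as
      soon as the expectation is below 1.\<close>
    define T where "T n \<omega> = ((\<Sum>u\<in>D. \<bar>h n \<omega> u - H u\<bar>) + \<eta> * (R n \<omega> + m)) / d + \<bar>\<phi> (Z n \<omega>) - c\<bar> / e" for n \<omega>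
    have intT: "integrable M (T n)" for n
      unfolding T_def[abs_def] using integrable_abs[OF int]
      by (intro Bochner_Integration.integrable_add integrable_divide Bochner_Integration.integrable_sum
          integrable_mult_right integrable_const inth intR)
    have ET: "expectation (T n) = ((\<Sum>u\<in>D. expectation (\<lambda>\<omega>. \<bar>h n \<omega> u - H u\<bar>)) + \<eta> * (2 * m)) / d
        + expectation (\<lambda>\<omega>. \<bar>\<phi> (Z n \<omega>) - c\<bar>) / e" if "1 \<le> n" for n
      unfolding T_def[abs_def] using inth[of n] intR[of n] int[of n] ER[OF that]
      by (simp add: Bochner_Integration.integral_sum prob_space)
    have "(\<lambda>n. ((\<Sum>u\<in>D. expectation (\<lambda>\<omega>. \<bar>h n \<omega> u - H u\<bar>)) + \<eta> * (2 * m)) / d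
        + expectation (\<lambda>\<omega>. \<bar>\<phi> (Z n \<omega>) - c\<bar>) / e) \<longlonglongrightarrow> ((\<Sum>u\<in>D. 0) + \<eta> * (2 * m)) / d + 0 / e"
      using d e by (intro tendsto_intros hlim lim) auto
    moreover have "((\<Sum>u\<in>D. 0) + \<eta> * (2 * m)) / d + 0 / e < 1"
    proof -
      have "\<eta> * (2 * m) = d * (m / (2 * (m + 1)))" using m by (simp add: \<eta>_def field_simps)
      then show ?thesis using d m by simp
    qed
    ultimately have "\<forall>\<^sub>F n in sequentially. ((\<Sum>u\<in>D. expectation (\<lambda>\<omega>. \<bar>h n \<omega> u - H u\<bar>)) + \<eta> * (2 * m)) / d
        + expectation (\<lambda>\<omega>. \<bar>\<phi> (Z n \<omega>) - c\<bar>) / e < 1"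
      by (rule order_tendstoD(2))
    with eventually_ge_at_top[of 1] have "\<forall>\<^sub>F n in sequentially. 1 \<le> n \<and> expectation (T n) < 1"
      by eventually_elim (simp add: ET)
    then obtain n where n: "1 \<le> n" "expectation (T n) < 1"
      using eventually_happens by fastforce
    have "\<exists>\<omega>. T n \<omega> < 1"
    proof (rule ccontr)
      assume "\<not> (\<exists>\<omega>. T n \<omega> < 1)"
      then have "expectation (\<lambda>_. 1) \<le> expectation (T n)"
        using intT[of n] by (intro integral_mono) (auto simp: not_less)
      then show False using n(2) by (simp add: prob_space)
    qed
    then obtain \<omega> where \<omega>: "T n \<omega> < 1" by blast
    let ?Q = "(\<Sum>u\<in>D. \<bar>h n \<omega> u - H u\<bar>) + \<eta> * (R n \<omega> + m)"
    have "0 \<le> ?Q"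
      using \<eta> m by (intro add_nonneg_nonneg sum_nonneg mult_nonneg_nonneg) (auto simp: R_def sum_nonneg)
    then have "0 \<le> ?Q / d" "0 \<le> \<bar>\<phi> (Z n \<omega>) - c\<bar> / e" using d e by auto
    then have "?Q / d < 1" "\<bar>\<phi> (Z n \<omega>) - c\<bar> / e < 1" using \<omega> unfolding T_def by linarith+
    then have "?Q \<le> d" and 1: "\<bar>\<phi> (Z n \<omega>) - c\<bar> < e" using d e by (auto simp: field_simps)
    then have "hausdorff_within d (Z n \<omega>) ?ZX"
      using D(2)[OF n(1)] hausdorff_within_mono by blast
    moreover have "Z n \<omega> \<in> convex_bodies"
      unfolding Z_def by (intro convex_bodies_scaleR convex_bodies_segment_sum)
    ultimately have "\<bar>\<phi> (Z n \<omega>) - \<phi> ?ZX\<bar> < e" by (rule d(2)[rotated])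
    with 1 show ?thesis by linarith
  qed
  \<comment> \<open>If the values differed, half their distance would be an admissible
    \<open>e\<close> and the distance would be less than itself.\<close>
  from this[of "\<bar>\<phi> ?ZX - c\<bar> / 2"] show ?thesis by (cases "\<phi> ?ZX = c") auto
qed

end

theorem theorem3:
  fixes M :: "'w measure"
    and X :: "'w \<Rightarrow> 'a::euclidean_space"
    and Xs :: "nat \<Rightarrow> 'w \<Rightarrow> 'a"
    and \<phi> :: "'a set \<Rightarrow> real"
    and j :: nat
    and Z :: "nat \<Rightarrow> 'w \<Rightarrow> 'a set"
    and ZX :: "'a set"
    and \<theta> \<zeta>1 :: real
    and h1 :: "'a \<Rightarrow> real"
  assumes "prob_space M"
    and "j \<in> {1..DIM('a)}"
    and "\<phi> \<in> Val_deg j"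
    and "X \<in> borel_measurable M"
    and "integrable M (\<lambda>\<omega>. (norm (X \<omega>))\<^sup>2)"
    and "prob_space.indep_vars M (\<lambda>_. borel) Xs {1..}"
    and "\<And>i. i \<ge> 1 \<Longrightarrow> distr M borel (Xs i) = distr M borel X"
    and "0 \<in> measure_support (distr M borel X)"
    and "\<not> (\<exists>S. subspace S \<and> dim S = j - 1 \<and> measure_support (distr M borel X) \<subseteq> S)"
    and "\<And>K. K \<in> convex_bodies \<Longrightarrow> aff_dim K \<ge> int j \<Longrightarrow> \<phi> K \<noteq> 0"
  defines "Z \<equiv> (\<lambda>n \<omega>. (*\<^sub>R) (1 / real n) ` (\<Sum>i=1..n. closed_segment 0 (Xs i \<omega>)))"
    and "ZX \<equiv> selection_expectation_segment M X"
    and "\<theta> \<equiv> (\<integral>\<omega>. \<phi> (\<Sum>i=1..j. closed_segment 0 (Xs i \<omega>)) \<partial>M)"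
    and "h1 \<equiv> (\<lambda>x. \<integral>\<omega>. \<phi> (closed_segment 0 x + (\<Sum>i=2..j. closed_segment 0 (Xs i \<omega>))) \<partial>M)"
    and "\<zeta>1 \<equiv> (\<integral>\<omega>. (h1 (Xs 1 \<omega>) - \<theta>)\<^sup>2 \<partial>M)"
  shows "weak_conv_m
           (\<lambda>n. distr M borel (\<lambda>\<omega>. sqrt (real n) * (\<phi> (Z n \<omega>) - \<phi> ZX)))
           (normal_distribution 0 ((real j / fact j)\<^sup>2 * \<zeta>1))"
proof -
  note \<phi> = \<open>\<phi> \<in> Val_deg j\<close>
  have Val: "\<phi> \<in> Val" using \<phi> by (simp add: Val_deg_def)
  have j: "1 \<le> j" using assms(2) by simp
  obtain C where C: "0 \<le> C" "\<And>(x::nat \<Rightarrow> 'a) I. finite I \<Longrightarrow> card I = j \<Longrightarrow>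
      \<bar>\<phi> (segment_sum x I)\<bar> \<le> C * (\<Prod>i\<in>I. norm (x i))"
    using Val_deg_segment_sum_bound[OF \<phi>] by blast
  interpret prob_space M by fact
  interpret product_bounded_kernel M X Xs "\<lambda>x I. \<phi> (segment_sum x I)" j C
  proof unfold_locales
    fix t :: "nat \<Rightarrow> nat" and I and x y :: "nat \<Rightarrow> 'a"
    show "inj_on t I \<Longrightarrow> \<phi> (segment_sum x (t ` I)) = \<phi> (segment_sum (\<lambda>i. x (t i)) I)"
      by (simp add: segment_sum_reindex)
    show "\<phi> (segment_sum x I) = \<phi> (segment_sum y I)" if "\<And>i. i \<in> I \<Longrightarrow> x i = y i"
      using segment_sum_cong[of I x y] that by simp
    show "(\<lambda>x. \<phi> (segment_sum x I)) \<in> borel_measurable (PiM UNIV (\<lambda>_. borel))"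
      by (rule measurable_Val_segment_sum[OF Val])
  qed (use assms(4-7) j C in auto)
  have Z: "Z n \<omega> = (*\<^sub>R) (1 / real n) ` segment_sum (\<lambda>i. Xs i \<omega>) {1..n}" for n \<omega>
    by (simp add: Z_def segment_sum_def)
  \<comment> \<open>The scaling \<open>1 / n\<close> contributes \<open>1 / n^j\<close>. At
    \<open>n = 0\<close> the factor is 0 rather than positive, so that case is excluded
    here.\<close>
  have \<phi>Z: "\<phi> (Z n \<omega>) = subset_sum n \<omega> / real n ^ j" if "1 \<le> n" for n \<omega>
  proof -
    have "\<phi> (Z n \<omega>) = (1 / real n) ^ j * \<phi> (segment_sum (\<lambda>i. Xs i \<omega>) {1..n})"
    proof -
      have "0 < 1 / real n" using that by simp
      then show ?thesis
        using \<phi> unfolding Z Val_deg_def homogeneous_def by (simp only: mem_Collect_eq convex_bodies_segment_sum)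
    qed
    also have "\<phi> (segment_sum (\<lambda>i. Xs i \<omega>) {1..n}) = subset_sum n \<omega>"
      unfolding subset_sum_def by (rule Val_deg_segment_sum[OF \<phi>]) simp
    finally show ?thesis by (simp add: power_divide)
  qed
  have mean: "mean = \<theta>" unfolding mean_def \<theta>_def by (simp only: segment_sum_def)
  have "proj x = h1 x" for x
  proof -
    \<comment> \<open>For \<open>j = 1\<close> the range \<open>{2..j}\<close> is empty and the
      empty Minkowski sum is \<open>{0}\<close>, in accordance with the convention for
      \<open>h1\<close>.\<close>
    have "segment_sum ((\<lambda>i. Xs i \<omega>)(1 := x)) {1..j} =
        closed_segment 0 x + (\<Sum>i=2..j. closed_segment 0 (Xs i \<omega>))" for \<omega>
    proof -
      have "segment_sum ((\<lambda>i. Xs i \<omega>)(1 := x)) {1..j} =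
          closed_segment 0 x + segment_sum ((\<lambda>i. Xs i \<omega>)(1 := x)) ({1..j} - {1})"
        using j by (subst segment_sum_remove[of _ 1]) auto
      also have "{1..j} - {1} = {2..j}" by auto
      also have "segment_sum ((\<lambda>i. Xs i \<omega>)(1 := x)) {2..j} = (\<Sum>i=2..j. closed_segment 0 (Xs i \<omega>))"
        unfolding segment_sum_def by (intro sum.cong) auto
      finally show ?thesis .
    qed
    then show ?thesis unfolding proj_def h1_def by (simp only:)
  qed
  then have "(\<lambda>\<omega>. (h1 (Xs 1 \<omega>) - \<theta>)\<^sup>2) = (\<lambda>\<omega>. (centred (Xs 1 \<omega>))\<^sup>2)"
    by (simp add: centred_def mean)
  then have var: "proj_variance = \<zeta>1"
    using integral_Xs[of "\<lambda>x. (centred x)\<^sup>2" 1] by (simp add: proj_variance_def \<zeta>1_def)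
  have ZX: "\<phi> ZX = mean / fact j"
    unfolding ZX_def
  proof (rule Val_selection_expectation_eqI[OF Val assms(5)])
    show "(\<lambda>n. expectation (\<lambda>\<omega>. \<bar>\<phi> ((*\<^sub>R) (1 / real n) ` segment_sum (\<lambda>i. Xs i \<omega>) {1..n}) - mean / fact j\<bar>)) \<longlonglongrightarrow> 0"
      unfolding Z[symmetric]
    proof (rule Lim_transform_eventually[OF subset_sum_L1_consistent])
      show "\<forall>\<^sub>F n in sequentially. expectation (\<lambda>\<omega>. \<bar>subset_sum n \<omega> / real n ^ j - mean / fact j\<bar>) =
          expectation (\<lambda>\<omega>. \<bar>\<phi> (Z n \<omega>) - mean / fact j\<bar>)"
        by (intro eventually_sequentiallyI[of 1]) (simp add: \<phi>Z)
    qed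
    show "integrable M (\<lambda>\<omega>. \<phi> ((*\<^sub>R) (1 / real n) ` segment_sum (\<lambda>i. Xs i \<omega>) {1..n}) - mean / fact j)" for n
      unfolding Z[symmetric]
    proof (cases "1 \<le> n")
      case True
      then show "integrable M (\<lambda>\<omega>. \<phi> (Z n \<omega>) - mean / fact j)"
        using subset_sum_integrable[of n] by (simp add: \<phi>Z)
    next
      case False
      then have "Z n \<omega> = {0}" for \<omega> by (simp add: Z segment_sum_empty)
      then show "integrable M (\<lambda>\<omega>. \<phi> (Z n \<omega>) - mean / fact j)" by simp
    qed
  qed
  \<comment> \<open>At \<open>n = 0\<close> both sides vanish through the factor
    \<open>sqrt 0\<close>, so the identity holds for every \<open>n\<close>.\<close>
  have "sqrt (real n) * (\<phi> (Z n \<omega>) - \<phi> ZX) = sqrt (real n) * (subset_sum n \<omega> / real n ^ j - mean / fact j)" for n \<omega>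
    by (cases "1 \<le> n") (auto simp: \<phi>Z ZX)
  then show ?thesis using subset_sum_central_limit by (simp only: var)
qed

end
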